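(* Let $p$ be a prime and $t\ge 1$. If all small minimal $1$-blocking sets in $\mathrm{PG}(n,p^t)$ are linear, then all small minimal $k$-blocking sets with exponent $e$ in $\mathrm{PG}(n,p^t)$, where $n>k$ and $p^e\geq t/e+11$, are linear.
   Context: All dimensions of subspaces of projective spaces are projective; an $m$-space is an $m$-dimensional subspace. Put $q=p^t$. For $1\le k\le n-1$, a $k$-blocking set in $\mathrm{PG}(n,q)$ is a set $B$ of points such that every $(n-k)$-space contains at least one point of $B$. It is small if $|B|<3(q^k+1)/2$, and minimal if no proper subset of $B$ is a $k$-blocking set. The exponent of a small minimal $k$-blocking set $B$ in $\mathrm{PG}(n,p^t)$ is the largest integer $e$ such that every $(n-k)$-space intersects $B$ in $1 \bmod p^e$ points (it is known that $e\ge 1$ exists). A point set $S$ of $\mathrm{PG}(V)$, $V$ an $(n+1)$-dimensional vector space over $\mathbb{F}_{p^t}$, is linear if there are a subfield $\mathbb{F}_{p_0}$ of $\mathbb{F}_{p^t}$ and a subset $U\subseteq V$ that is an $\mathbb{F}_{p_0}$-vector space such that $S=\{\langle u\rangle_{\mathbb{F}_{p^t}} : u\in U\setminus\{0\}\}$. *)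

theory Defs
  imports "HOL-Analysis.Cartesian_Space" "HOL-Number_Theory.Cong" "HOL-Computational_Algebra.Primes"
begin

text \<open>
  \<open>PG(n,q)\<close> is modelled on the vector space \<^typ>\<open>'a ^ 'n\<close> with \<open>CARD('a) = q\<close> and
  \<open>CARD('n) = n + 1\<close>.  Subspaces of \<open>PG(n,q)\<close> are identified with linear subspaces; in particular
  a point is a one-dimensional linear subspace, so that a set of points is a set of sets of vectors
  and ``the point \<open>P\<close> lies in \<open>W\<close>'' is \<open>P \<subseteq> W\<close>.
\<close>

definition proj_subspace :: "nat \<Rightarrow> ('a::field ^ 'n) set \<Rightarrow> bool" where
  "proj_subspace m W \<longleftrightarrow> vec.subspace W \<and> vec.dim W = m + 1"

definition proj_points :: "('a::field ^ 'n) set set" where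
  "proj_points = {P. proj_subspace 0 P}"

definition points_in :: "('a::field ^ 'n) set set \<Rightarrow> ('a ^ 'n) set \<Rightarrow> ('a ^ 'n) set set" where
  "points_in B W = {P \<in> B. P \<subseteq> W}"

text \<open>
  The number \<open>CARD('n) - 1 - k\<close> below is \<open>n - k\<close>.  The definitions are meant for
  \<open>1 \<le> k \<le> n - 1\<close>, where the subtraction does not truncate.
\<close>

definition blocking_set :: "nat \<Rightarrow> ('a::field ^ 'n) set set \<Rightarrow> bool" where
  "blocking_set k B \<longleftrightarrow> B \<subseteq> proj_points \<and>
     (\<forall>W. proj_subspace (CARD('n) - 1 - k) W \<longrightarrow> points_in B W \<noteq> {})"

definition minimal_blocking_set :: "nat \<Rightarrow> ('a::field ^ 'n) set set \<Rightarrow> bool" where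
  "minimal_blocking_set k B \<longleftrightarrow> blocking_set k B \<and> (\<forall>C. C \<subset> B \<longrightarrow> \<not> blocking_set k C)"

definition small_minimal_blocking_set :: "nat \<Rightarrow> ('a::{field,finite} ^ 'n) set set \<Rightarrow> bool" where
  "small_minimal_blocking_set k B \<longleftrightarrow> minimal_blocking_set k B \<and>
     real (card B) < 3 * (real CARD('a) ^ k + 1) / 2"

definition meets_one_mod :: "nat \<Rightarrow> nat \<Rightarrow> ('a::field ^ 'n) set set \<Rightarrow> bool" where
  "meets_one_mod m k B \<longleftrightarrow>
     (\<forall>W. proj_subspace (CARD('n) - 1 - k) W \<longrightarrow> [card (points_in B W) = 1] (mod m))"

definition has_exponent :: "nat \<Rightarrow> nat \<Rightarrow> ('a::field ^ 'n) set set \<Rightarrow> nat \<Rightarrow> bool" where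
  "has_exponent p k B e \<longleftrightarrow>
     meets_one_mod (p ^ e) k B \<and> (\<forall>e'. meets_one_mod (p ^ e') k B \<longrightarrow> e' \<le> e)"

definition is_subfield :: "'a::field set \<Rightarrow> bool" where
  "is_subfield K \<longleftrightarrow> 0 \<in> K \<and> 1 \<in> K \<and>
     (\<forall>x\<in>K. \<forall>y\<in>K. x - y \<in> K \<and> x * y \<in> K) \<and> (\<forall>x\<in>K. x \<noteq> 0 \<longrightarrow> inverse x \<in> K)"

definition subspace_over :: "'a::field set \<Rightarrow> ('a ^ 'n) set \<Rightarrow> bool" where
  "subspace_over K U \<longleftrightarrow> 0 \<in> U \<and> (\<forall>u\<in>U. \<forall>v\<in>U. u + v \<in> U) \<and> (\<forall>a\<in>K. \<forall>u\<in>U. a *s u \<in> U)"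

definition linear_point_set :: "('a::field ^ 'n) set set \<Rightarrow> bool" where
  "linear_point_set S \<longleftrightarrow>
     (\<exists>K U. is_subfield K \<and> subspace_over K U \<and> S = {vec.span {u} |u. u \<in> U - {0}})"

end

theory Submission
  imports Defs "HOL-Computational_Algebra.Polynomial"
begin

text \<open>
  Let \<open>q\<close> be the order of the field, \<open>p\<close> its characteristic and \<open>m = p ^ e\<close>. The hypothesis
  on the exponent forces \<open>m \<ge> 12\<close>. Linear sets are described by additive groups \<open>U\<close> of
  vectors, and the weight of a point or line is the number of vectors of \<open>U\<close> in it. The idea
  is to cut \<open>B\<close> down to 1-blocking sets, whose groups exist by hypothesis, and to glue these
  groups.

  Pencils show that \<open>B\<close> meets not only every \<open>(n - k)\<close>-space but every larger subspace in 1
  mod \<open>m\<close> points (\<open>one_mod_larger_subspaces\<close>). The number of points of \<open>B\<close> in a random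
  \<open>(n - k)\<close>-space is thus \<open>1\<close> or at least \<open>m + 1\<close>. Its first two moments are known, and they
  leave a gap: a set of this kind with fewer than \<open>(m - 2) * q ^ k\<close> points has at most
  \<open>(m - 1) / (m - 2) * q ^ k\<close> points (\<open>size_gap\<close>), which is at most \<open>11 / 10 * q ^ k\<close>. The
  same applies with \<open>k = 1\<close> to the points of \<open>B\<close> in a subspace of dimension \<open>n - k + 1\<close>,
  called a section. A section is small if it has fewer than \<open>(m - 2) * q\<close> points of \<open>B\<close>;
  every line lies in a small section (\<open>line_in_small_section\<close>).

  A small section contains a small minimal 1-blocking set, which is linear by hypothesis,
  and a count modulo \<open>p\<close> shows that there are no other points
  (\<open>one_blocking_set_small_linear\<close>). This gives a group \<open>U\<close> of order \<open>p * q\<close>, a vector space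
  over the prime field only. In fact the section is linear over a field of order at least
  \<open>m\<close> (\<open>linear_section\<close>). To see this, project \<open>U\<close> from a point of weight \<open>p\<close>. The result is
  a group \<open>Y\<close> of order \<open>q\<close> in which all weights are at least \<open>m\<close>, because lines carry 1 mod
  \<open>m\<close> points. Such a group has few points, so a form of low degree vanishes on all of \<open>Y\<close>
  outside one given point. Sums of functions of low degree over groups vanish
  (\<open>sum_low_degree\<close>), and therefore certain power sums over the part of \<open>Y\<close> in this point
  vanish. This suffices to identify that part with a subfield
  (\<open>power_sums_imp_frobenius_fixed\<close>), and \<open>Y\<close> turns out to be a vector space over this field
  (\<open>large_weights_imp_subfield\<close>). The same field occurs for most centres of projection, and
  the intersection of the corresponding groups is a vector space over it with the same
  points as \<open>U\<close>.

  Since \<open>e\<close> is the exponent, some line with two points of \<open>B\<close> violates the congruence modulo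
  \<open>p ^ Suc e\<close>. A small section through it is linear over the field of order \<open>m\<close>, but no
  larger field, and so there is a line with exactly \<open>m + 1\<close> points, a secant
  (\<open>exists_secant\<close>). If \<open>m = q\<close>, lines with two points of \<open>B\<close> are contained in \<open>B\<close>, and \<open>B\<close>
  is a subspace. Otherwise fix a vector \<open>v\<close> whose point belongs to \<open>B\<close> and lies on a secant.

  Consider small sections that contain a secant through \<open>v\<close>, and choose the scalar factor of
  their groups so that they contain \<open>v\<close>. Whether a vector \<open>w\<close> on a secant through \<open>v\<close>
  belongs to such a group does not depend on the section: it does if and only if \<open>w\<close> and
  \<open>v + w\<close> span points of \<open>B\<close> (\<open>section_group_mem_iff\<close>). Let \<open>G\<close> be the set of all these \<open>w\<close>.
  It contains most of every group, and since nearly all sections through a suitable subspace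
  containing \<open>v\<close> and \<open>w\<close> are small, one finds \<open>w + u \<in> G\<close> for more than three quarters of
  all \<open>u \<in> G\<close>, for every \<open>w \<in> G\<close> (\<open>many_sums\<close>). Hence the differences of elements of \<open>G\<close>
  form a group with more than \<open>q ^ k\<close> elements. Its points belong to \<open>B\<close>
  (\<open>linear_set_subset_via_secants\<close>): a point outside \<open>B\<close> lies on at least \<open>q ^ k\<close> lines that
  meet \<open>B\<close>, which does not allow many of them to have two points of \<open>B\<close>. A group with more
  than \<open>q ^ k\<close> elements yields a \<open>k\<close>-blocking set, so by minimality its points are all of
  \<open>B\<close>.
\<close>

section \<open>Finite fields and their subfields\<close>

lemma prime_CHAR_finite: "prime CHAR('a::{field,finite})"
  by (rule prime_CHAR_semidom[OF finite_imp_CHAR_pos]) simp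

lemma power_card_field:
  fixes x :: "'a::{field,finite}"
  shows "x ^ CARD('a) = x"
proof (cases "x = 0")
  case False
  have "x * (\<Prod>y\<in>UNIV-{0}. x * y) = x * x ^ (CARD('a) - 1) * \<Prod>(UNIV-{0})"
    by (simp add: prod.distrib mult_ac)
  also have "(\<Prod>y\<in>UNIV-{0}. x * y) = (\<Prod>y\<in>UNIV-{0}. y)"
    by (rule prod.reindex_bij_witness[of _ "\<lambda>y. y / x" "\<lambda>y. x * y"]) (use False in auto)
  also have "x * x ^ (CARD('a) - 1) = x ^ CARD('a)"
    by (metis mult.commute power_minus_mult zero_less_card_finite)
  finally show ?thesis by simp
qed auto

lemma card_field_ge2: "CARD('a::{field,finite}) \<ge> 2"
proof -
  have "card {0, 1 :: 'a} \<le> CARD('a)" by (rule card_mono) auto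
  thus ?thesis by simp
qed

text \<open>
  Negatives and inverses come for free: \<open>- 1\<close> is a multiple of \<open>1\<close>, and \<open>inverse x\<close> is the power
  of \<open>x\<close> with exponent \<open>CARD('a) - 2\<close>.
\<close>

lemma subring_is_subfield:
  fixes K :: "'a::{field,finite} set"
  assumes "0 \<in> K" "1 \<in> K" and add: "\<And>x y. x \<in> K \<Longrightarrow> y \<in> K \<Longrightarrow> x + y \<in> K"
    and mult: "\<And>x y. x \<in> K \<Longrightarrow> y \<in> K \<Longrightarrow> x * y \<in> K"
  shows "is_subfield K"
proof -
  have nat: "of_nat i \<in> K" for i by (induction i) (auto intro: assms)
  have "(of_nat (CHAR('a) - 1) :: 'a) = - 1"
    using prime_gt_1_nat[OF prime_CHAR_finite[where 'a='a]] by (simp add: of_nat_diff)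
  hence m1: "- 1 \<in> K" using nat by metis
  have diff: "x - y \<in> K" if "x \<in> K" "y \<in> K" for x y
    using add[OF that(1) mult[OF m1 that(2)]] by simp
  have pow: "x ^ i \<in> K" if "x \<in> K" for x i
    using that by (induction i) (auto intro: assms)
  have inv: "inverse x \<in> K" if "x \<in> K" "x \<noteq> 0" for x
  proof -
    have "x * x * x ^ (CARD('a) - 2) = x"
      using power_card_field[of x] card_field_ge2[where 'a='a]
      by (metis le_add_diff_inverse power_add power2_eq_square)
    hence "x ^ (CARD('a) - 2) = inverse x"
      using that(2) by (simp add: field_simps)
    thus ?thesis using pow[OF that(1)] by metis
  qed
  show ?thesis unfolding is_subfield_def using assms diff inv by auto
qed

lemma is_subfield_UNIV: "is_subfield UNIV" by (simp add: is_subfield_def)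

lemma subfield_add:
  assumes "is_subfield K" "x \<in> K" "y \<in> K" shows "x + y \<in> K"
proof -
  have "0 - y \<in> K" using assms unfolding is_subfield_def by blast
  hence "x - (0 - y) \<in> K" using assms unfolding is_subfield_def by blast
  thus ?thesis by simp
qed

text \<open>
  The name is justified in positive characteristic, where the multiples of \<open>1\<close> form a field.
\<close>

definition prime_field :: "'a::field set" where "prime_field = range of_nat"

lemma is_subfield_prime_field: "is_subfield (prime_field :: 'a::{field,finite} set)"
proof (rule subring_is_subfield)
  show "0 \<in> (prime_field :: 'a set)" unfolding prime_field_def by (metis of_nat_0 rangeI)
  show "1 \<in> (prime_field :: 'a set)" unfolding prime_field_def by (metis of_nat_1 rangeI)
qed (auto simp: prime_field_def simp flip: of_nat_add of_nat_mult)

lemma prime_field_eq: "(prime_field :: 'a::{field,finite} set) = of_nat ` {..<CHAR('a)}"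
proof -
  have "of_nat i \<in> (of_nat ` {..<CHAR('a)} :: 'a set)" for i
  proof -
    have "(of_nat i :: 'a) = of_nat (i mod CHAR('a))"
      by (simp add: of_nat_eq_iff_cong_CHAR cong_def)
    thus ?thesis using prime_gt_0_nat[OF prime_CHAR_finite[where 'a='a]] by auto
  qed
  thus ?thesis unfolding prime_field_def by auto
qed

lemma inj_on_of_nat_CHAR: "inj_on (of_nat :: nat \<Rightarrow> 'a::{field,finite}) {..<CHAR('a)}"
  by (auto simp: inj_on_def of_nat_eq_iff_cong_CHAR cong_def)

lemma card_prime_field: "card (prime_field :: 'a::{field,finite} set) = CHAR('a)"
  unfolding prime_field_eq by (simp add: card_image inj_on_of_nat_CHAR)

text \<open>
  This subfield is the handle on all larger subfields. It has at most \<open>CHAR('a) ^ d\<close>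
  elements; that it has exactly so many (that is, that a subfield of this order exists) is a
  separate condition wherever it matters.
\<close>

definition frobenius_fixed :: "nat \<Rightarrow> 'a::{field,finite} set" where
  "frobenius_fixed d = {x. x ^ (CHAR('a) ^ d) = x}"

lemma frobenius_add:
  fixes x y :: "'a::{field,finite}"
  shows "(x + y) ^ (CHAR('a) ^ d) = x ^ (CHAR('a) ^ d) + y ^ (CHAR('a) ^ d)"
  by (rule freshmans_dream'[OF prime_CHAR_finite refl])

lemma is_subfield_frobenius_fixed: "is_subfield (frobenius_fixed d)"
  using prime_gt_0_nat[OF prime_CHAR_finite[where 'a='a]]
  by (intro subring_is_subfield) (auto simp: frobenius_fixed_def frobenius_add power_mult_distrib)

lemma card_frobenius_fixed_le:
  assumes "d \<ge> 1"
  shows "card (frobenius_fixed d :: 'a::{field,finite} set) \<le> CHAR('a) ^ d"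
proof -
  define M where "M = CHAR('a) ^ d"
  have "CHAR('a) \<ge> 2" by (rule prime_ge_2_nat[OF prime_CHAR_finite])
  hence M: "M > 1" unfolding M_def using assms by (intro one_less_power) auto
  define P :: "'a poly" where "P = monom 1 M - monom 1 1"
  have deg: "degree P \<le> M" unfolding P_def
    using M by (intro degree_diff_le order.trans[OF degree_monom_le]) auto
  have "coeff P M = 1" unfolding P_def using M by simp
  hence "P \<noteq> 0" by auto
  from card_poly_roots_bound[OF this] have "card {x. poly P x = 0} \<le> M" using deg by simp
  moreover have "{x. poly P x = 0} = frobenius_fixed d"
    unfolding P_def frobenius_fixed_def M_def by (auto simp: poly_monom)
  ultimately show ?thesis by (simp add: M_def)
qed

section \<open>Subspaces over a subfield\<close>

lemma subspace_over_add: "subspace_over K U \<Longrightarrow> u \<in> U \<Longrightarrow> v \<in> U \<Longrightarrow> u + v \<in> U"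
  and subspace_over_scale: "subspace_over K U \<Longrightarrow> c \<in> K \<Longrightarrow> u \<in> U \<Longrightarrow> c *s u \<in> U"
  and subspace_over_zero: "subspace_over K U \<Longrightarrow> 0 \<in> U"
  by (auto simp: subspace_over_def)

text \<open>
  Scaling by an element of the prime field is repeated addition, so subspaces over the prime
  field are just the additive subgroups.
\<close>

lemma additive_closed_scale:
  fixes U :: "('a::{field,finite} ^ 'n) set"
  assumes "0 \<in> U" "\<And>u v. u \<in> U \<Longrightarrow> v \<in> U \<Longrightarrow> u + v \<in> U"
  shows "subspace_over prime_field U"
proof -
  have "of_nat i *s u \<in> U" if "u \<in> U" for u i
    using that assms by (induction i) (auto simp: vec.scale_left_distrib)
  thus ?thesis unfolding subspace_over_def prime_field_def using assms by auto
qed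

lemma subspace_over_prime_field:
  fixes U :: "('a::{field,finite} ^ 'n) set"
  shows "subspace_over K U \<Longrightarrow> subspace_over prime_field U"
  by (rule additive_closed_scale) (auto simp: subspace_over_def)

lemma subspace_over_diff:
  fixes U :: "('a::{field,finite} ^ 'n) set"
  assumes "subspace_over K U" "u \<in> U" "v \<in> U"
  shows "u - v \<in> U"
proof -
  have "(of_nat (CHAR('a) - 1) :: 'a) = - 1"
    using prime_gt_1_nat[OF prime_CHAR_finite[where 'a='a]] by (simp add: of_nat_diff)
  hence "- 1 \<in> (prime_field :: 'a set)" unfolding prime_field_def by (metis rangeI)
  from subspace_over_scale[OF subspace_over_prime_field[OF assms(1)] this assms(3)]
  have "- v \<in> U" by (simp add: vector_sneg_minus1 [symmetric])
  thus ?thesis using subspace_over_add[OF assms(1,2)] by fastforce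
qed

lemma subspace_over_Int: "subspace_over K U \<Longrightarrow> subspace_over K W \<Longrightarrow> subspace_over K (U \<inter> W)"
  by (auto simp: subspace_over_def)

lemma subspace_over_mono: "subspace_over L U \<Longrightarrow> K \<subseteq> L \<Longrightarrow> subspace_over K U"
  by (auto simp: subspace_over_def)

lemma subspace_over_UNIV_iff: "subspace_over UNIV W \<longleftrightarrow> vec.subspace W"
  by (auto simp: subspace_over_def vec.subspace_def)

lemma subspace_over_UNIV_UNIV: "subspace_over K UNIV"
  and subspace_over_zero_space: "subspace_over K {0}"
  by (auto simp: subspace_over_def)

definition adjoin :: "'a::field set \<Rightarrow> 'a ^ 'n \<Rightarrow> ('a ^ 'n) set \<Rightarrow> ('a ^ 'n) set" where
  "adjoin K b W = {w + c *s b | w c. w \<in> W \<and> c \<in> K}"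

lemma adjoin_superset: "0 \<in> K \<Longrightarrow> W \<subseteq> adjoin K b W"
proof
  fix w assume "0 \<in> K" "w \<in> W"
  moreover have "w = w + 0 *s b" by simp
  ultimately show "w \<in> adjoin K b W" unfolding adjoin_def by blast
qed

lemma adjoin_mem: "1 \<in> K \<Longrightarrow> 0 \<in> W \<Longrightarrow> b \<in> adjoin K b W"
proof -
  assume "1 \<in> K" "0 \<in> W"
  moreover have "b = 0 + 1 *s b" by simp
  ultimately show "b \<in> adjoin K b W" unfolding adjoin_def by blast
qed

lemma adjoin_subset:
  "subspace_over K U \<Longrightarrow> W \<subseteq> U \<Longrightarrow> b \<in> U \<Longrightarrow> adjoin K b W \<subseteq> U"
  unfolding adjoin_def subspace_over_def by blast

lemma subspace_over_adjoin:
  assumes K: "is_subfield K" and W: "subspace_over K W"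
  shows "subspace_over K (adjoin K b W)"
  unfolding subspace_over_def
proof (intro conjI ballI)
  have K0: "0 \<in> K" and Km: "\<And>x y. x \<in> K \<Longrightarrow> y \<in> K \<Longrightarrow> x * y \<in> K"
    using K by (auto simp: is_subfield_def)
  show "0 \<in> adjoin K b W" using adjoin_superset[OF K0, of W b] subspace_over_zero[OF W] by auto
  fix u assume "u \<in> adjoin K b W"
  then obtain w c where u: "u = w + c *s b" "w \<in> W" "c \<in> K" unfolding adjoin_def by auto
  show "u + v \<in> adjoin K b W" if vW: "v \<in> adjoin K b W" for v
  proof -
    obtain w' c' where v: "v = w' + c' *s b" "w' \<in> W" "c' \<in> K" using vW unfolding adjoin_def by auto
    have "u + v = (w + w') + (c + c') *s b" by (simp add: u v vec.scale_left_distrib)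
    thus ?thesis unfolding adjoin_def using u v subspace_over_add[OF W] subfield_add[OF K] by blast
  qed
  show "a *s u \<in> adjoin K b W" if "a \<in> K" for a
  proof -
    have "a *s u = a *s w + (a * c) *s b" by (simp add: u vec.scale_right_distrib)
    thus ?thesis unfolding adjoin_def using that u subspace_over_scale[OF W] Km by blast
  qed
qed

lemma adjoin_inj:
  fixes W :: "('a::{field,finite} ^ 'n) set"
  assumes K: "is_subfield K" and W: "subspace_over K W" and b: "b \<notin> W"
  shows "inj_on (\<lambda>(w, c). w + c *s b) (W \<times> K)"
proof (rule inj_onI, clarify)
  fix w c w' c' assume *: "w \<in> W" "c \<in> K" "w' \<in> W" "c' \<in> K" "w + c *s b = w' + c' *s b"
  have "c *s b - c' *s b = w' - w" using *(5) by (metis add_diff_cancel_left' add_diff_cancel_right' diff_add_eq diff_diff_eq2)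
  hence eq: "(c - c') *s b = w' - w" by (simp add: vec.scale_left_diff_distrib)
  have "c = c'"
  proof (rule ccontr)
    assume ne: "c \<noteq> c'"
    have "inverse (c - c') \<in> K" using K * ne by (auto simp: is_subfield_def)
    hence "inverse (c - c') *s ((c - c') *s b) \<in> W"
      unfolding eq using subspace_over_scale[OF W] subspace_over_diff[OF W] * by blast
    thus False using b ne by simp
  qed
  thus "w = w' \<and> c = c'" using * by simp
qed

lemma card_adjoin:
  fixes W :: "('a::{field,finite} ^ 'n) set"
  assumes K: "is_subfield K" and W: "subspace_over K W" and b: "b \<notin> W"
  shows "card (adjoin K b W) = card K * card W"
proof -
  have "adjoin K b W = (\<lambda>(w, c). w + c *s b) ` (W \<times> K)" unfolding adjoin_def by auto
  thus ?thesis using card_image[OF adjoin_inj[OF assms]] by (simp add: card_cartesian_product)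
qed

text \<open>
  The induction that replaces the choice of bases: \<open>U\<close> is reached from \<open>W\<close> by adjoining one
  vector at a time, over whichever subfield is of interest.
\<close>

lemma subspace_induct:
  fixes U :: "('a::{field,finite} ^ 'n) set"
  assumes K: "is_subfield K" and W: "subspace_over K W" and U: "subspace_over K U"
    and sub: "W \<subseteq> U" and base: "P W"
    and step: "\<And>X b. subspace_over K X \<Longrightarrow> W \<subseteq> X \<Longrightarrow> X \<subseteq> U \<Longrightarrow> b \<in> U \<Longrightarrow> b \<notin> X \<Longrightarrow> P X
      \<Longrightarrow> P (adjoin K b X)"
  shows "P U"
proof -
  have "P U" if "subspace_over K X" "W \<subseteq> X" "X \<subseteq> U" "P X" for X
    using that
  proof (induction "card U - card X" arbitrary: X rule: less_induct)
    case less
    show ?case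
    proof (cases "X = U")
      case False
      then obtain b where b: "b \<in> U" "b \<notin> X" using less by blast
      let ?Y = "adjoin K b X"
      have K01: "0 \<in> K" "1 \<in> K" using K by (auto simp: is_subfield_def)
      have sup: "X \<subset> ?Y"
        using adjoin_superset[OF K01(1), of X b] adjoin_mem[OF K01(2), of X b] b
          subspace_over_zero[OF less.prems(1)] by blast
      have YU: "?Y \<subseteq> U" using adjoin_subset[OF U] less b by blast
      have "card X < card ?Y" by (rule psubset_card_mono[OF finite sup])
      moreover have "card ?Y \<le> card U" by (rule card_mono[OF finite YU])
      ultimately have "card U - card ?Y < card U - card X" by linarith
      from less.hyps[OF this subspace_over_adjoin[OF K less.prems(1)] _ YU step]
      show ?thesis using less.prems b sup by blast
    qed (use less in simp)
  qed
  from this[OF W _ sub base] show ?thesis by simp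
qed

lemma card_subspace_over_quotient:
  fixes U :: "('a::{field,finite} ^ 'n) set"
  assumes K: "is_subfield K" and W: "subspace_over K W" and U: "subspace_over K U" and "W \<subseteq> U"
  shows "\<exists>r. card U = card K ^ r * card W"
proof (rule subspace_induct[OF assms])
  show "\<exists>r. card W = card K ^ r * card W" by (rule exI[of _ 0]) simp
  fix X b assume X: "subspace_over K X" "b \<notin> X" "\<exists>r. card X = card K ^ r * card W"
  then obtain r where "card X = card K ^ r * card W" by auto
  thus "\<exists>r. card (adjoin K b X) = card K ^ r * card W"
    using card_adjoin[OF K X(1,2)] by (intro exI[of _ "Suc r"]) simp
qed

lemma card_subspace_over:
  fixes U :: "('a::{field,finite} ^ 'n) set"
  assumes "is_subfield K" and "subspace_over K U"
  shows "\<exists>r. card U = card K ^ r"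
  using card_subspace_over_quotient[OF assms(1) subspace_over_zero_space assms(2)]
    subspace_over_zero[OF assms(2)] by auto

lemma card_subgroup:
  fixes Y :: "('a::{field,finite} ^ 'n) set"
  assumes "subspace_over K Y"
  obtains r where "card Y = CHAR('a) ^ r"
  using card_subspace_over[OF is_subfield_prime_field subspace_over_prime_field[OF assms]]
  unfolding card_prime_field by blast

lemma card_subfield_ge2:
  assumes "is_subfield (K :: 'a::{field,finite} set)" shows "card K \<ge> 2"
proof -
  have "card {0, 1 :: 'a} \<le> card K" by (rule card_mono) (use assms in \<open>auto simp: is_subfield_def\<close>)
  thus ?thesis by simp
qed

lemma card_dvd_subspace_over:
  fixes U :: "('a::{field,finite} ^ 'n) set"
  assumes "is_subfield K" "subspace_over K U" "u \<in> U" "u \<noteq> 0"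
  shows "card K dvd card U"
proof -
  obtain r where r: "card U = card K ^ r" using card_subspace_over[OF assms(1,2)] by auto
  have "card {0, u} \<le> card U" by (rule card_mono) (use assms subspace_over_zero[OF assms(2)] in auto)
  hence "r \<noteq> 0" using r assms(4) by (intro notI) simp
  thus ?thesis using r by (metis dvd_power gr0I)
qed

text \<open>
  Adjoining one vector multiplies the size by the order of \<open>K\<close>, so no power of this order is
  skipped on the way from \<open>W\<close> to \<open>U\<close>.
\<close>

lemma intermediate_subspace:
  fixes U :: "('a::{field,finite} ^ 'n) set"
  assumes K: "is_subfield K" and W: "subspace_over K W" and U: "subspace_over K U" and sub: "W \<subseteq> U"
    and cW: "card W \<le> card K ^ s" and cU: "card K ^ s \<le> card U"
  shows "\<exists>X. subspace_over K X \<and> W \<subseteq> X \<and> X \<subseteq> U \<and> card X = card K ^ s"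
proof -
  have k2: "card K > 1" using card_subfield_ge2[OF K] by simp
  have "card K ^ s \<le> card U \<longrightarrow> (\<exists>X. subspace_over K X \<and> W \<subseteq> X \<and> X \<subseteq> U \<and> card X = card K ^ s)"
  proof (rule subspace_induct[OF K W U sub])
    show "card K ^ s \<le> card W \<longrightarrow> (\<exists>X. subspace_over K X \<and> W \<subseteq> X \<and> X \<subseteq> W \<and> card X = card K ^ s)"
      using cW W by (metis order_antisym order_refl)
    fix X b assume X: "subspace_over K X" "W \<subseteq> X" "b \<notin> X" "b \<in> U" "X \<subseteq> U"
      and IH: "card K ^ s \<le> card X \<longrightarrow> (\<exists>Z. subspace_over K Z \<and> W \<subseteq> Z \<and> Z \<subseteq> X \<and> card Z = card K ^ s)"
    have sup: "X \<subseteq> adjoin K b X" using K by (intro adjoin_superset) (auto simp: is_subfield_def)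
    obtain r where r: "card X = card K ^ r" using card_subspace_over[OF K X(1)] by auto
    show "card K ^ s \<le> card (adjoin K b X) \<longrightarrow>
      (\<exists>Z. subspace_over K Z \<and> W \<subseteq> Z \<and> Z \<subseteq> adjoin K b X \<and> card Z = card K ^ s)"
    proof (rule impI)
      assume le: "card K ^ s \<le> card (adjoin K b X)"
      have c: "card (adjoin K b X) = card K ^ Suc r" using card_adjoin[OF K X(1,3)] r by simp
      show "\<exists>Z. subspace_over K Z \<and> W \<subseteq> Z \<and> Z \<subseteq> adjoin K b X \<and> card Z = card K ^ s"
      proof (cases "s \<le> r")
        case True
        hence "card K ^ s \<le> card X" unfolding r using k2 by (intro power_increasing) auto
        then obtain Z where "subspace_over K Z" "W \<subseteq> Z" "Z \<subseteq> X" "card Z = card K ^ s"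
          using IH by blast
        thus ?thesis using sup by (meson order_trans)
      next
        case False
        have "s \<le> Suc r" using le unfolding c by (rule power_le_imp_le_exp[OF k2])
        hence "s = Suc r" using False by simp
        hence "card (adjoin K b X) = card K ^ s" using c by blast
        thus ?thesis using subspace_over_adjoin[OF K X(1)] order_trans[OF X(2) sup] by blast
      qed
    qed
  qed
  thus ?thesis using cU by simp
qed

lemma adjoin_UNIV_eq_span:
  assumes "vec.subspace X" shows "adjoin UNIV b X = vec.span (insert b X)"
proof -
  have sp: "vec.span X = X" using assms by (rule vec.span_eq_iff[THEN iffD2])
  have iff: "x \<in> adjoin UNIV b X \<longleftrightarrow> (\<exists>k. x - k *s b \<in> X)" for x
  proof (rule iffI)
    assume "x \<in> adjoin UNIV b X"
    then obtain w c where "x = w + c *s b" "w \<in> X" unfolding adjoin_def by auto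
    thus "\<exists>k. x - k *s b \<in> X" by (intro exI[of _ c]) simp
  next
    assume "\<exists>k. x - k *s b \<in> X"
    then obtain k where k: "x - k *s b \<in> X" by auto
    have "x = (x - k *s b) + k *s b" by simp
    thus "x \<in> adjoin UNIV b X" unfolding adjoin_def using k by blast
  qed
  show ?thesis unfolding vec.span_insert sp by (intro set_eqI) (simp only: mem_Collect_eq iff)
qed

lemma card_vec_subspace:
  fixes W :: "('a::{field,finite} ^ 'n) set"
  assumes "subspace_over UNIV W"
  shows "card W = CARD('a) ^ vec.dim W"
proof (rule subspace_induct[OF is_subfield_UNIV subspace_over_zero_space assms])
  show "{0} \<subseteq> W" using subspace_over_zero[OF assms] by simp
  show "card {0 :: 'a ^ 'n} = CARD('a) ^ vec.dim {0 :: 'a ^ 'n}"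
    using vec.dim_span[of "{} :: ('a ^ 'n) set"] by (simp del: vec.dim_span)
  fix X :: "('a ^ 'n) set" and b
  assume X: "subspace_over UNIV X" "b \<notin> X" "card X = CARD('a) ^ vec.dim X"
  have s: "vec.subspace X" using X subspace_over_UNIV_iff by blast
  have "b \<notin> vec.span X" using X(2) s by (metis vec.span_eq_iff)
  hence "vec.dim (adjoin UNIV b X) = vec.dim X + 1"
    unfolding adjoin_UNIV_eq_span[OF s] vec.dim_span vec.dim_insert by simp
  thus "card (adjoin UNIV b X) = CARD('a) ^ vec.dim (adjoin UNIV b X)"
    using card_adjoin[OF is_subfield_UNIV X(1,2)] X(3) by simp
qed

text \<open>
  From here on sizes replace dimensions: subspaces over different subfields are compared by
  their numbers of elements.
\<close>

lemma proj_subspace_iff: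
  fixes W :: "('a::{field,finite} ^ 'n) set"
  shows "proj_subspace m W \<longleftrightarrow> subspace_over UNIV W \<and> card W = CARD('a) ^ (m + 1)"
proof -
  have "CARD('a) ^ vec.dim W = CARD('a) ^ (m + 1) \<longleftrightarrow> vec.dim W = m + 1"
    using card_field_ge2[where 'a='a] by (intro power_inject_exp) simp
  moreover have "card W = CARD('a) ^ vec.dim W" if "vec.subspace W"
    using card_vec_subspace[of W] that unfolding subspace_over_UNIV_iff by blast
  ultimately show ?thesis unfolding proj_subspace_def subspace_over_UNIV_iff by auto
qed

section \<open>Points and linear sets\<close>

lemma mem_span_singleton: "w \<in> vec.span {v} \<longleftrightarrow> (\<exists>c. w = c *s v)"
  unfolding vec.span_singleton by auto

lemma mem_span_pair: "x \<in> vec.span {v, w} \<longleftrightarrow> (\<exists>a b. x = a *s v + b *s w)"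
proof -
  have "x \<in> vec.span {v, w} \<longleftrightarrow> (\<exists>k. x - k *s v \<in> vec.span {w})" by (simp add: vec.span_insert)
  also have "\<dots> \<longleftrightarrow> (\<exists>a b. x = a *s v + b *s w)"
    unfolding mem_span_singleton by (metis add.commute add_diff_cancel_left' diff_add_cancel)
  finally show ?thesis .
qed

lemma subspace_over_span: "subspace_over UNIV (vec.span S)"
  by (simp add: subspace_over_UNIV_iff)

lemma span_subset_iff: "subspace_over UNIV W \<Longrightarrow> vec.span S \<subseteq> W \<longleftrightarrow> S \<subseteq> W"
  by (meson subspace_over_UNIV_iff order_trans vec.span_minimal vec.span_superset)

lemma span_singleton_subset_iff: "subspace_over UNIV W \<Longrightarrow> vec.span {v} \<subseteq> W \<longleftrightarrow> v \<in> W"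
  by (simp add: span_subset_iff)

lemma span_singleton_self: "v \<in> vec.span {v}"
  by (simp add: vec.span_base)

lemma span_singleton_eq:
  assumes "w \<in> vec.span {v}" "w \<noteq> 0" shows "vec.span {w} = vec.span {v}"
proof -
  obtain c where c: "w = c *s v" using assms mem_span_singleton by blast
  hence c0: "c \<noteq> 0" using assms by auto
  have "v = inverse c *s w" using c c0 by simp
  hence "v \<in> vec.span {w}" using mem_span_singleton by blast
  hence "vec.span {v} \<subseteq> vec.span {w}" by (simp add: span_singleton_subset_iff subspace_over_span)
  moreover have "vec.span {w} \<subseteq> vec.span {v}"
    using assms by (simp add: span_singleton_subset_iff subspace_over_span)
  ultimately show ?thesis by simp
qed

lemma span_singleton_scale: "c \<noteq> 0 \<Longrightarrow> vec.span {c *s v} = vec.span {v}"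
  by (cases "v = 0") (auto intro!: span_singleton_eq simp: mem_span_singleton)

lemma card_span_singleton:
  fixes v :: "'a::{field,finite} ^ 'n"
  assumes "v \<noteq> 0" shows "card (vec.span {v}) = CARD('a)"
proof -
  have "inj (\<lambda>c. c *s v)" using assms by (auto simp: inj_def)
  thus ?thesis unfolding vec.span_singleton by (rule card_image)
qed

lemma proj_points_iff:
  fixes P :: "('a::{field,finite} ^ 'n) set"
  shows "P \<in> proj_points \<longleftrightarrow> (\<exists>v. v \<noteq> 0 \<and> P = vec.span {v})"
proof
  assume "P \<in> proj_points"
  hence P: "subspace_over UNIV P" "card P = CARD('a)"
    unfolding proj_points_def proj_subspace_iff by auto
  have "\<not> P \<subseteq> {0}"
  proof
    assume "P \<subseteq> {0}"
    hence "card P \<le> 1" using card_mono[of "{0}" P] by simp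
    thus False using P(2) card_field_ge2[where 'a='a] by simp
  qed
  then obtain v where v: "v \<in> P" "v \<noteq> 0" by auto
  have "vec.span {v} \<subseteq> P" using v P(1) by (simp add: span_singleton_subset_iff)
  hence "vec.span {v} = P"
    using P(2) card_span_singleton[OF v(2)] by (intro card_subset_eq) auto
  thus "\<exists>v. v \<noteq> 0 \<and> P = vec.span {v}" using v by blast
next
  assume "\<exists>v. v \<noteq> 0 \<and> P = vec.span {v}"
  then obtain v where "v \<noteq> 0" "P = vec.span {v}" by auto
  thus "P \<in> proj_points" unfolding proj_points_def proj_subspace_iff
    using card_span_singleton[of v] subspace_over_span by auto
qed

lemma proj_pointsE:
  fixes P :: "('a::{field,finite} ^ 'n) set"
  assumes "P \<in> proj_points" obtains v where "v \<noteq> 0" "P = vec.span {v}"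
  using assms unfolding proj_points_iff by auto

lemma point_span_nonzero:
  assumes "vec.span {v} \<in> proj_points" shows "(v :: 'a::{field,finite} ^ 'n) \<noteq> 0"
proof
  assume "v = 0"
  moreover obtain u where "u \<noteq> 0" "vec.span {v} = vec.span {u}" using assms by (rule proj_pointsE)
  ultimately have "u \<in> {0}" using span_singleton_self[of u] by simp
  thus False using \<open>u \<noteq> 0\<close> by simp
qed

lemma span_insert_span_singleton: "vec.span (insert x (vec.span {v})) = vec.span {x, v}"
proof (rule antisym)
  have "vec.span {v} \<subseteq> vec.span {x, v}" by (rule vec.span_mono) simp
  moreover have "x \<in> vec.span {x, v}" by (rule vec.span_base) simp
  ultimately show "vec.span (insert x (vec.span {v})) \<subseteq> vec.span {x, v}"
    by (intro span_subset_iff[OF subspace_over_span, THEN iffD2]) (simp only: insert_subset)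
  show "vec.span {x, v} \<subseteq> vec.span (insert x (vec.span {v}))"
    using span_singleton_self[of v] by (intro vec.span_mono) simp
qed

lemma adjoin_span_singleton:
  "adjoin UNIV w (vec.span {v}) = vec.span {v, w}"
  by (simp add: adjoin_UNIV_eq_span span_insert_span_singleton insert_commute)

lemma adjoin_zero_space: "adjoin UNIV v {0} = vec.span {v}"
  unfolding adjoin_def vec.span_singleton by auto

lemma span_pair_eq:
  fixes v w u :: "'a::field ^ 'n"
  assumes "u \<in> vec.span {v, w}" "u \<notin> vec.span {v}"
  shows "vec.span {v, u} = vec.span {v, w}"
proof -
  obtain a b where u: "u = a *s v + b *s w" using assms(1) mem_span_pair by blast
  have b: "b \<noteq> 0" using assms(2) u mem_span_singleton by force
  have "w = (- (inverse b * a)) *s v + inverse b *s u"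
    unfolding u using b by (simp add: vec.scale_right_distrib)
  hence w: "w \<in> vec.span {v, u}" unfolding mem_span_pair by blast
  have v: "v \<in> vec.span {v, x}" for x by (rule vec.span_base) simp
  show ?thesis
    using v w assms(1) by (intro antisym span_subset_iff[OF subspace_over_span, THEN iffD2]) simp_all
qed

lemma card_span_pair:
  fixes v w :: "'a::{field,finite} ^ 'n"
  assumes "v \<noteq> 0" "w \<notin> vec.span {v}"
  shows "card (vec.span {v, w}) = CARD('a) ^ 2"
  unfolding adjoin_span_singleton[symmetric] card_adjoin[OF is_subfield_UNIV subspace_over_span assms(2)]
    card_span_singleton[OF assms(1)] by (simp add: power2_eq_square)

lemma points_in_UNIV: "points_in S UNIV = S"
  by (simp add: points_in_def)

lemma points_in_mono: "Z \<subseteq> Z' \<Longrightarrow> points_in S Z \<subseteq> points_in S Z'"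
  unfolding points_in_def by blast

lemma points_in_points_in: "points_in (points_in S X) Y = points_in S (X \<inter> Y)"
  unfolding points_in_def by blast

lemma points_in_span_singleton:
  fixes S :: "('a::{field,finite} ^ 'n) set set"
  assumes "S \<subseteq> proj_points" "v \<noteq> 0" "vec.span {v} \<in> S"
  shows "points_in S (vec.span {v}) = {vec.span {v}}"
proof -
  have "R = vec.span {v}" if R: "R \<in> S" "R \<subseteq> vec.span {v}" for R
  proof -
    obtain w where w: "w \<noteq> 0" "R = vec.span {w}" using assms(1) R(1) proj_pointsE by blast
    have "w \<in> vec.span {v}" using w(2) R(2) span_singleton_self by blast
    thus ?thesis using span_singleton_eq[OF _ w(1)] w(2) by metis
  qed
  thus ?thesis using assms(3) unfolding points_in_def by blast
qed

lemma points_in_zero: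
  fixes S :: "('a::{field,finite} ^ 'n) set set"
  assumes "S \<subseteq> proj_points" shows "points_in S {0} = {}"
proof (rule equals0I)
  fix P assume "P \<in> points_in S {0}"
  hence P: "P \<in> S" "P \<subseteq> {0}" unfolding points_in_def by blast+
  obtain v where v: "v \<noteq> 0" "P = vec.span {v}" using assms P(1) proj_pointsE by blast
  have "v \<in> {0}" using P(2) v(2) span_singleton_self[of v] by blast
  thus False using v(1) by simp
qed

lemma card_two_points_line:
  fixes A :: "('a::{field,finite} ^ 'n) set set"
  assumes "vec.span {v} \<in> A" "vec.span {w} \<in> A" "w \<notin> vec.span {v}"
  shows "2 \<le> card (points_in A (vec.span {v, w}))"
proof -
  have "vec.span {v} \<subseteq> vec.span {v, w}" "vec.span {w} \<subseteq> vec.span {v, w}"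
    by (rule vec.span_mono, simp)+
  hence "{vec.span {v}, vec.span {w}} \<subseteq> points_in A (vec.span {v, w})"
    using assms unfolding points_in_def by blast
  hence "card {vec.span {v}, vec.span {w}} \<le> card (points_in A (vec.span {v, w}))"
    by (rule card_mono[rotated]) simp
  moreover have "vec.span {v} \<noteq> vec.span {w}" using assms(3) span_singleton_self by blast
  ultimately show ?thesis by simp
qed

definition linear_set :: "('a::field ^ 'n) set \<Rightarrow> ('a ^ 'n) set set" where
  "linear_set U = {vec.span {u} | u. u \<in> U - {0}}"

lemma linear_setI: "u \<in> U \<Longrightarrow> u \<noteq> 0 \<Longrightarrow> vec.span {u} \<in> linear_set U"
  unfolding linear_set_def by blast

lemma linear_setE: assumes "P \<in> linear_set U" obtains u where "u \<in> U" "u \<noteq> 0" "P = vec.span {u}"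
  using assms unfolding linear_set_def by blast

lemma linear_set_proj_points: "linear_set (U :: ('a::{field,finite} ^ 'n) set) \<subseteq> proj_points"
  unfolding proj_points_iff subset_iff by (auto elim!: linear_setE)

lemma linear_set_mono: "U \<subseteq> U' \<Longrightarrow> linear_set U \<subseteq> linear_set U'"
  unfolding linear_set_def by auto

text \<open>
  Distinct points share only the zero vector, so the points of a linear set partition the
  nonzero vectors of \<open>U\<close>. The number \<open>card (U \<inter> P)\<close> will be called the weight of the point
  \<open>P\<close> (with respect to \<open>U\<close>), and \<open>card (U \<inter> Z)\<close> the weight of the subspace \<open>Z\<close>.
\<close>

lemma card_vectors_on_points:
  fixes U :: "('a::{field,finite} ^ 'n) set"
  assumes U: "subspace_over K U" and R: "R \<subseteq> linear_set U"
  shows "card {u \<in> U - {0}. vec.span {u} \<in> R} = (\<Sum>P\<in>R. card (U \<inter> P) - 1)"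
proof -
  have pt: "\<exists>u. u \<noteq> 0 \<and> P = vec.span {u}" if "P \<in> R" for P
    using R that by (blast elim: linear_setE)
  have eq: "{u \<in> U - {0}. vec.span {u} \<in> R} = (\<Union>P\<in>R. U \<inter> P - {0})"
  proof (intro set_eqI iffI)
    fix u assume "u \<in> {u \<in> U - {0}. vec.span {u} \<in> R}"
    thus "u \<in> (\<Union>P\<in>R. U \<inter> P - {0})" using span_singleton_self by blast
  next
    fix u assume "u \<in> (\<Union>P\<in>R. U \<inter> P - {0})"
    then obtain P where P: "P \<in> R" "u \<in> U" "u \<in> P" "u \<noteq> 0" by blast
    then obtain v where "P = vec.span {v}" using pt by blast
    hence "vec.span {u} = P" using span_singleton_eq[of u v] P by simp
    thus "u \<in> {u \<in> U - {0}. vec.span {u} \<in> R}" using P by simp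
  qed
  have "card {u \<in> U - {0}. vec.span {u} \<in> R} = (\<Sum>P\<in>R. card (U \<inter> P - {0}))"
    unfolding eq
  proof (rule card_UN_disjoint, simp, simp, intro ballI impI)
    fix P Q assume PQ: "P \<in> R" "Q \<in> R" and ne: "P \<noteq> Q"
    obtain u v where uv: "P = vec.span {u}" "Q = vec.span {v}" using pt PQ by blast
    show "(U \<inter> P - {0}) \<inter> (U \<inter> Q - {0}) = {}"
    proof (rule ccontr)
      assume "(U \<inter> P - {0}) \<inter> (U \<inter> Q - {0}) \<noteq> {}"
      then obtain x where "x \<in> P" "x \<in> Q" "x \<noteq> 0" by blast
      hence "P = Q" using span_singleton_eq uv by metis
      thus False using ne by simp
    qed
  qed
  also have "\<dots> = (\<Sum>P\<in>R. card (U \<inter> P) - 1)"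
  proof (rule sum.cong[OF refl])
    fix P assume "P \<in> R"
    then obtain v where "P = vec.span {v}" using pt by blast
    hence "0 \<in> U \<inter> P" using subspace_over_zero[OF U] by (simp add: vec.span_zero)
    thus "card (U \<inter> P - {0}) = card (U \<inter> P) - 1" by (rule card_Diff_singleton)
  qed
  finally show ?thesis .
qed

lemma sum_weights:
  fixes U :: "('a::{field,finite} ^ 'n) set"
  assumes U: "subspace_over K U" and Z: "subspace_over UNIV Z"
  shows "(\<Sum>P\<in>points_in (linear_set U) Z. card (U \<inter> P) - 1) = card (U \<inter> Z) - 1"
proof -
  have "{u \<in> U - {0}. vec.span {u} \<in> points_in (linear_set U) Z} = U \<inter> Z - {0}"
    unfolding points_in_def using span_singleton_subset_iff[OF Z] by (auto intro: linear_setI)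
  moreover have "points_in (linear_set U) Z \<subseteq> linear_set U" unfolding points_in_def by blast
  ultimately have "(\<Sum>P\<in>points_in (linear_set U) Z. card (U \<inter> P) - 1) = card (U \<inter> Z - {0})"
    using card_vectors_on_points[OF U, of "points_in (linear_set U) Z"] by simp
  also have "\<dots> = card (U \<inter> Z) - 1"
    using subspace_over_zero[OF U] subspace_over_zero[OF Z] by (intro card_Diff_singleton) auto
  finally show ?thesis .
qed

lemma sum_all_weights:
  fixes Y :: "('a::{field,finite} ^ 'n) set"
  assumes "subspace_over K Y"
  shows "(\<Sum>P\<in>linear_set Y. card (Y \<inter> P) - 1) = card Y - 1"
  using sum_weights[OF assms subspace_over_UNIV_UNIV] by (simp add: points_in_UNIV)

lemma subspace_over_linear_set_point: "P \<in> linear_set U \<Longrightarrow> subspace_over K P"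
  by (auto elim!: linear_setE intro: subspace_over_mono[OF subspace_over_span])

text \<open>
  All weights are divisible by the order of \<open>K\<close>, and so is \<open>card (U \<inter> Z)\<close>. Modulo this order
  the identity for the sum of the weights therefore says that minus the number of points is
  \<open>- 1\<close>.
\<close>

lemma linear_set_mod:
  fixes U :: "('a::{field,finite} ^ 'n) set"
  assumes K: "is_subfield K" and U: "subspace_over K U" and Z: "subspace_over UNIV Z"
    and ne: "points_in (linear_set U) Z \<noteq> {}"
  shows "[card (points_in (linear_set U) Z) = 1] (mod card K)"
proof -
  let ?A = "points_in (linear_set U) Z"
  have dvdP: "card K dvd card (U \<inter> P)" and geP: "card (U \<inter> P) \<ge> 1" if P: "P \<in> ?A" for P
  proof -
    obtain u where u: "u \<in> U" "u \<noteq> 0" "P = vec.span {u}"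
      using P unfolding points_in_def by (auto elim: linear_setE)
    have "subspace_over K (U \<inter> P)"
      using U subspace_over_linear_set_point P unfolding points_in_def by (intro subspace_over_Int) auto
    from card_dvd_subspace_over[OF K this, of u] show "card K dvd card (U \<inter> P)"
      using u span_singleton_self by auto
    have "card (U \<inter> P) > 0" using u span_singleton_self by (auto simp: card_gt_0_iff)
    thus "card (U \<inter> P) \<ge> 1" by simp
  qed
  have ZK: "subspace_over K (U \<inter> Z)" using U subspace_over_mono[OF Z] by (intro subspace_over_Int) auto
  obtain P where P: "P \<in> ?A" using ne by auto
  then obtain u where u: "u \<in> U" "u \<noteq> 0" "u \<in> Z"
    unfolding points_in_def using span_singleton_self by (auto elim!: linear_setE)
  have dZ: "card K dvd card (U \<inter> Z)" using card_dvd_subspace_over[OF K ZK, of u] u by auto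
  have gZ: "card (U \<inter> Z) \<ge> 1" using u by (simp add: Suc_le_eq card_gt_0_iff) blast
  have "(\<Sum>P\<in>?A. card (U \<inter> P)) = (\<Sum>P\<in>?A. (card (U \<inter> P) - 1) + 1)"
  proof (rule sum.cong[OF refl])
    fix P assume "P \<in> ?A" thus "card (U \<inter> P) = (card (U \<inter> P) - 1) + 1" using geP[of P] by linarith
  qed
  also have "\<dots> = (card (U \<inter> Z) - 1) + card ?A"
    by (simp only: sum.distrib sum_weights[OF U Z]) simp
  finally have eq: "(\<Sum>P\<in>?A. card (U \<inter> P)) + 1 = card (U \<inter> Z) + card ?A" using gZ by simp
  have "card K dvd (\<Sum>P\<in>?A. card (U \<inter> P))" using dvdP by (rule dvd_sum)
  then obtain a b where "(\<Sum>P\<in>?A. card (U \<inter> P)) = card K * a" "card (U \<inter> Z) = card K * b"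
    using dZ by (auto elim!: dvdE)
  hence "card ?A + b * card K = 1 + a * card K" using eq by (simp add: mult.commute)
  thus ?thesis by (metis cong_iff_lin_nat cong_sym)
qed

section \<open>Linear forms and averaging\<close>

definition dot :: "'a::field ^ 'n \<Rightarrow> 'a ^ 'n \<Rightarrow> 'a" where
  "dot \<phi> x = (\<Sum>i\<in>UNIV. \<phi> $ i * x $ i)"

lemma dot_add_left: "dot (\<phi> + \<psi>) x = dot \<phi> x + dot \<psi> x"
  and dot_add_right: "dot \<phi> (x + y) = dot \<phi> x + dot \<phi> y"
  and dot_scale_left: "dot (c *s \<phi>) x = c * dot \<phi> x"
  and dot_scale_right: "dot \<phi> (c *s x) = c * dot \<phi> x"
  by (simp_all add: dot_def sum.distrib distrib_left distrib_right sum_distrib_left mult_ac)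

lemma dot_zero_left [simp]: "dot 0 x = 0" and dot_zero_right [simp]: "dot \<phi> 0 = 0"
  by (simp_all add: dot_def)

lemma dot_commute: "dot \<phi> x = dot x \<phi>"
  by (simp add: dot_def mult.commute)

lemma dot_axis: "dot \<phi> (axis i 1) = \<phi> $ i"
proof -
  have "dot \<phi> (axis i 1) = (\<Sum>j\<in>UNIV. if j = i then \<phi> $ j else 0)"
    unfolding dot_def axis_def by (intro sum.cong) auto
  thus ?thesis by simp
qed

definition perp :: "('a::field ^ 'n) set \<Rightarrow> ('a ^ 'n) set" where
  "perp S = {\<phi>. \<forall>x\<in>S. dot \<phi> x = 0}"

lemma subspace_over_perp: "subspace_over K (perp S)"
  unfolding subspace_over_def perp_def by (auto simp: dot_add_left dot_scale_left)

text \<open>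
  The fibres of an additive map are translates of its kernel.
\<close>

lemma card_hom:
  fixes X :: "('a::{field,finite} ^ 'n) set" and f :: "'a ^ 'n \<Rightarrow> 'b::ab_group_add"
  assumes X: "subspace_over K X" and add: "\<And>x y. x \<in> X \<Longrightarrow> y \<in> X \<Longrightarrow> f (x + y) = f x + f y"
  shows "card X = card (f ` X) * card {x \<in> X. f x = 0}"
proof -
  have fd: "f (x - y) = f x - f y" if "x \<in> X" "y \<in> X" for x y
    using add[OF subspace_over_diff[OF X that] that(2)] by simp
  have "X = (\<Union>y\<in>f ` X. {x \<in> X. f x = y})" by auto
  hence "card X = card (\<Union>y\<in>f ` X. {x \<in> X. f x = y})" by simp
  also have "\<dots> = (\<Sum>y\<in>f ` X. card {x \<in> X. f x = y})"
    by (rule card_UN_disjoint) auto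
  also have "\<dots> = (\<Sum>y\<in>f ` X. card {x \<in> X. f x = 0})"
  proof (rule sum.cong[OF refl])
    fix y assume "y \<in> f ` X"
    then obtain a where a: "a \<in> X" "y = f a" by auto
    have "bij_betw (\<lambda>x. x - a) {x \<in> X. f x = y} {x \<in> X. f x = 0}"
      by (rule bij_betw_byWitness[of _ "\<lambda>x. x + a"])
        (use a add fd subspace_over_diff[OF X] subspace_over_add[OF X] in auto)
    thus "card {x \<in> X. f x = y} = card {x \<in> X. f x = 0}" by (rule bij_betw_same_card)
  qed
  finally show ?thesis by simp
qed

lemma card_kernel_le:
  fixes X :: "('a::{field,finite} ^ 'n) set"
  assumes X: "subspace_over K X"
  shows "card X \<le> CARD('a) * card {x \<in> X. dot \<phi> x = 0}"
proof -
  have "card X = card (dot \<phi> ` X) * card {x \<in> X. dot \<phi> x = 0}"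
    by (rule card_hom[OF X dot_add_right])
  also have "\<dots> \<le> CARD('a) * card {x \<in> X. dot \<phi> x = 0}"
    by (intro mult_right_mono card_mono) auto
  finally show ?thesis .
qed

lemma perp_adjoin:
  assumes "subspace_over UNIV X" shows "perp (adjoin UNIV b X) = {\<phi> \<in> perp X. dot b \<phi> = 0}"
proof (intro set_eqI iffI)
  fix \<phi> assume \<phi>: "\<phi> \<in> perp (adjoin UNIV b X)"
  have "X \<subseteq> adjoin UNIV b X" by (rule adjoin_superset) simp
  moreover have "b \<in> adjoin UNIV b X" using subspace_over_zero[OF assms] by (intro adjoin_mem) auto
  ultimately show "\<phi> \<in> {\<phi> \<in> perp X. dot b \<phi> = 0}"
    using \<phi> unfolding perp_def by (auto simp: dot_commute[of b])
next
  fix \<phi> assume "\<phi> \<in> {\<phi> \<in> perp X. dot b \<phi> = 0}"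
  thus "\<phi> \<in> perp (adjoin UNIV b X)"
    unfolding perp_def adjoin_def by (auto simp: dot_add_right dot_scale_right dot_commute[of b])
qed

text \<open>
  Adjoining a vector multiplies the size of \<open>L\<close> by \<open>CARD('a)\<close> and divides that of \<open>perp L\<close>
  by at most \<open>CARD('a)\<close>, so their product does not decrease along a chain from \<open>{0}\<close> through
  \<open>L\<close> to \<open>UNIV\<close>. It has the same value at both ends.
\<close>

lemma card_perp:
  fixes L :: "('a::{field,finite} ^ 'n) set"
  assumes L: "subspace_over UNIV L"
  shows "card (perp L) * card L = CARD('a) ^ CARD('n)"
proof -
  have step: "card (perp X) * card X \<le> card (perp (adjoin UNIV b X)) * card (adjoin UNIV b X)"
    if X: "subspace_over UNIV X" "b \<notin> X" for X :: "('a ^ 'n) set" and b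
  proof -
    have "card (perp X) \<le> CARD('a) * card (perp (adjoin UNIV b X))"
      unfolding perp_adjoin[OF X(1)] by (rule card_kernel_le[OF subspace_over_perp])
    hence "card (perp X) * card X \<le> CARD('a) * card (perp (adjoin UNIV b X)) * card X"
      by (rule mult_right_mono) simp
    thus ?thesis unfolding card_adjoin[OF is_subfield_UNIV X] by (simp add: mult_ac)
  qed
  have "CARD('a) ^ CARD('n) \<le> card (perp L) * card L"
  proof (rule subspace_induct[OF is_subfield_UNIV subspace_over_zero_space L])
    show "{0} \<subseteq> L" using subspace_over_zero[OF L] by simp
    have "perp {0} = (UNIV :: ('a ^ 'n) set)" by (auto simp: perp_def)
    thus "CARD('a) ^ CARD('n) \<le> card (perp {0 :: 'a ^ 'n}) * card {0 :: 'a ^ 'n}" by simp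
  qed (use step order_trans in blast)
  moreover have "card (perp L) * card L \<le> card (perp (UNIV :: ('a ^ 'n) set)) * card (UNIV :: ('a ^ 'n) set)"
  proof (rule subspace_induct[OF is_subfield_UNIV L subspace_over_UNIV_UNIV])
  qed (use step order_trans in blast)+
  moreover have "perp UNIV = {0 :: 'a ^ 'n}"
  proof (intro equalityI subsetI)
    fix \<phi> :: "'a ^ 'n" assume "\<phi> \<in> perp UNIV"
    hence "dot \<phi> (axis i 1) = 0" for i unfolding perp_def by blast
    hence "\<phi> = 0" by (simp add: dot_axis vec_eq_iff)
    thus "\<phi> \<in> {0}" by simp
  qed (simp add: perp_def)
  ultimately show ?thesis by simp
qed

lemma card_perp_adjoin:
  fixes L :: "('a::{field,finite} ^ 'n) set"
  assumes L: "subspace_over UNIV L" and b: "b \<notin> L"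
  shows "CARD('a) * card (perp (adjoin UNIV b L)) = card (perp L)"
proof -
  have "card (perp (adjoin UNIV b L)) * (CARD('a) * card L) = card (perp L) * card L"
    using card_perp[OF L] card_perp[OF subspace_over_adjoin[OF is_subfield_UNIV L], of b]
      card_adjoin[OF is_subfield_UNIV L b] by simp
  moreover have "L \<noteq> {}" using subspace_over_zero[OF L] by auto
  ultimately show ?thesis by (simp add: mult_ac)
qed

definition common_zeros :: "(nat \<Rightarrow> 'a::field ^ 'n) \<Rightarrow> nat \<Rightarrow> ('a ^ 'n) set" where
  "common_zeros f j = {x. \<forall>i<j. dot (f i) x = 0}"

lemma subspace_over_common_zeros: "subspace_over K (common_zeros f j)"
  unfolding subspace_over_def common_zeros_def by (auto simp: dot_add_right dot_scale_right)

lemma card_common_zeros: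
  fixes f :: "nat \<Rightarrow> 'a::{field,finite} ^ 'n"
  shows "CARD('a) ^ CARD('n) \<le> CARD('a) ^ j * card (common_zeros f j)"
proof (induction j)
  case 0 show ?case by (simp add: common_zeros_def)
next
  case (Suc j)
  have eq: "common_zeros f (Suc j) = {x \<in> common_zeros f j. dot (f j) x = 0}"
    unfolding common_zeros_def by (auto simp: less_Suc_eq)
  have "card (common_zeros f j) \<le> CARD('a) * card (common_zeros f (Suc j))"
    unfolding eq by (rule card_kernel_le[OF subspace_over_common_zeros])
  hence "CARD('a) ^ j * card (common_zeros f j) \<le> CARD('a) ^ j * (CARD('a) * card (common_zeros f (Suc j)))"
    by (rule mult_left_mono) simp
  from order_trans[OF Suc.IH this] show ?case by (simp add: mult_ac)
qed

text \<open>
  Families of \<open>j\<close> linear forms that vanish on \<open>L\<close>. They are extensional in the index, which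
  makes the set of families finite, so that one can average over it.
\<close>

definition forms :: "('a::field ^ 'n) set \<Rightarrow> nat \<Rightarrow> (nat \<Rightarrow> 'a ^ 'n) set" where
  "forms L j = (PiE {..<j} (\<lambda>_. perp L))"

lemma finite_forms: "finite (forms (L :: ('a::{field,finite} ^ 'n) set) j)"
  unfolding forms_def by (intro finite_PiE) auto

lemma card_forms: "card (forms L j) = card (perp L) ^ j"
  unfolding forms_def by (simp add: card_PiE)

lemma forms_nonempty: "forms L j \<noteq> {}"
  unfolding forms_def using subspace_over_zero[OF subspace_over_perp] by (auto simp: PiE_eq_empty_iff)

lemma common_zeros_superset: "f \<in> forms L j \<Longrightarrow> L \<subseteq> common_zeros f j"
  unfolding forms_def common_zeros_def perp_def by (auto simp: PiE_def Pi_def)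

lemma forms_adjoin:
  assumes "subspace_over UNIV L"
  shows "{f \<in> forms L j. v \<in> common_zeros f j} = forms (adjoin UNIV v L) j"
  unfolding forms_def perp_adjoin[OF assms] common_zeros_def
  by (auto simp: PiE_def Pi_def dot_commute[of v])

lemma card_forms_adjoin:
  fixes L :: "('a::{field,finite} ^ 'n) set"
  assumes "subspace_over UNIV L" "v \<notin> L"
  shows "CARD('a) ^ j * card (forms (adjoin UNIV v L) j) = card (forms L j)"
  unfolding card_forms power_mult_distrib[symmetric] card_perp_adjoin[OF assms] ..

text \<open>
  A point outside \<open>L\<close> lies in the common zeros of a random family with probability
  \<open>CARD('a) ^ (- j)\<close>, a point inside \<open>L\<close> always does. Families of forms take the place of
  the subspaces that they cut out, as they are easier to count.
\<close>

lemma sum_points_in_common_zeros: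
  fixes L :: "('a::{field,finite} ^ 'n) set"
  assumes L: "subspace_over UNIV L" and S: "S \<subseteq> proj_points"
  shows "CARD('a) ^ j * (\<Sum>f\<in>forms L j. card (points_in S (common_zeros f j))) =
    card (forms L j) * (CARD('a) ^ j * card (points_in S L) + (card S - card (points_in S L)))"
proof -
  have "(\<Sum>f\<in>forms L j. card (points_in S (common_zeros f j)))
      = (\<Sum>f\<in>forms L j. \<Sum>P\<in>S. if P \<subseteq> common_zeros f j then 1 else 0)"
    by (intro sum.cong refl) (simp add: points_in_def sum.If_cases Int_def)
  also have "\<dots> = (\<Sum>P\<in>S. \<Sum>f\<in>forms L j. if P \<subseteq> common_zeros f j then 1 else 0)"
    by (rule sum.swap)
  also have "\<dots> = (\<Sum>P\<in>S. card {f \<in> forms L j. P \<subseteq> common_zeros f j})"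
    using finite_forms[of L j] by (intro sum.cong refl) (simp add: sum.If_cases Int_def)
  finally have "CARD('a) ^ j * (\<Sum>f\<in>forms L j. card (points_in S (common_zeros f j))) =
    (\<Sum>P\<in>S. CARD('a) ^ j * card {f \<in> forms L j. P \<subseteq> common_zeros f j})"
    by (simp add: sum_distrib_left)
  also have "\<dots> = (\<Sum>P\<in>S. card (forms L j) * (if P \<subseteq> L then CARD('a) ^ j else 1))"
  proof (rule sum.cong[OF refl])
    fix P assume "P \<in> S"
    then obtain v where v: "v \<noteq> 0" "P = vec.span {v}" using S proj_pointsE by blast
    have "{f \<in> forms L j. P \<subseteq> common_zeros f j} = {f \<in> forms L j. v \<in> common_zeros f j}"
      unfolding v(2) using span_singleton_subset_iff[OF subspace_over_common_zeros] by blast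
    hence eq: "{f \<in> forms L j. P \<subseteq> common_zeros f j} = forms (adjoin UNIV v L) j"
      using forms_adjoin[OF L] by metis
    show "CARD('a) ^ j * card {f \<in> forms L j. P \<subseteq> common_zeros f j}
      = card (forms L j) * (if P \<subseteq> L then CARD('a) ^ j else 1)"
    proof (cases "P \<subseteq> L")
      case True
      hence "{f \<in> forms L j. P \<subseteq> common_zeros f j} = forms L j" using common_zeros_superset by blast
      thus ?thesis using True by (simp add: mult.commute)
    next
      case False
      hence "v \<notin> L" using v(2) span_singleton_subset_iff[OF L] by metis
      thus ?thesis using card_forms_adjoin[OF L, of v j] eq False by simp
    qed
  qed
  also have "\<dots> = card (forms L j) * (\<Sum>P\<in>S. if P \<subseteq> L then CARD('a) ^ j else 1)"
    by (simp add: sum_distrib_left)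
  also have "(\<Sum>P\<in>S. if P \<subseteq> L then CARD('a) ^ j else 1)
    = CARD('a) ^ j * card (points_in S L) + card (S - points_in S L)"
  proof -
    have "S \<inter> {P. P \<subseteq> L} = points_in S L" "S \<inter> - {P. P \<subseteq> L} = S - points_in S L"
      by (auto simp: points_in_def)
    thus ?thesis by (simp add: sum.If_cases mult.commute)
  qed
  also have "card (S - points_in S L) = card S - card (points_in S L)"
    by (rule card_Diff_subset) (auto simp: points_in_def)
  finally show ?thesis .
qed

text \<open>
  Some family does not exceed the average.
\<close>

lemma exists_few_points:
  fixes L :: "('a::{field,finite} ^ 'n) set"
  assumes L: "subspace_over UNIV L" and S: "S \<subseteq> proj_points"
  obtains f where "f \<in> forms L j"
    "CARD('a) ^ j * card (points_in S (common_zeros f j)) \<le>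
      CARD('a) ^ j * card (points_in S L) + (card S - card (points_in S L))"
proof -
  let ?c = "CARD('a) ^ j * card (points_in S L) + (card S - card (points_in S L))"
  have "\<exists>f\<in>forms L j. CARD('a) ^ j * card (points_in S (common_zeros f j)) \<le> ?c"
  proof (rule ccontr)
    assume "\<not> ?thesis"
    hence "(\<Sum>f\<in>forms L j. ?c) < (\<Sum>f\<in>forms L j. CARD('a) ^ j * card (points_in S (common_zeros f j)))"
      using finite_forms[of L j] forms_nonempty[of L j] by (intro sum_strict_mono) auto
    thus False using sum_points_in_common_zeros[OF assms, of j] by (simp add: sum_distrib_left)
  qed
  thus thesis using that by blast
qed

lemma all_many_points:
  fixes L :: "('a::{field,finite} ^ 'n) set"
  assumes L: "subspace_over UNIV L" and S: "S \<subseteq> proj_points"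
    and ge: "\<And>f. f \<in> forms L j \<Longrightarrow> c \<le> card (points_in S (common_zeros f j))"
  shows "CARD('a) ^ j * c \<le> CARD('a) ^ j * card (points_in S L) + (card S - card (points_in S L))"
proof -
  obtain f where f: "f \<in> forms L j" "CARD('a) ^ j * card (points_in S (common_zeros f j)) \<le>
      CARD('a) ^ j * card (points_in S L) + (card S - card (points_in S L))"
    using exists_few_points[OF L S] by blast
  have "CARD('a) ^ j * c \<le> CARD('a) ^ j * card (points_in S (common_zeros f j))"
    using ge[OF f(1)] by (rule mult_left_mono) simp
  thus ?thesis using f(2) by linarith
qed

section \<open>The size of a set that meets subspaces in 1 mod m points\<close>

text \<open>
  The square counts pairs of points. With the first point \<open>P\<close> of the pair fixed, the second
  one is counted by the first moment over the families that vanish on \<open>P\<close>.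
\<close>

lemma sum_squares_points_in_common_zeros:
  fixes S :: "('a::{field,finite} ^ 'n) set set" and j :: nat
  assumes S: "S \<subseteq> proj_points"
  defines "Q \<equiv> CARD('a) ^ j" and "x \<equiv> card S"
  shows "Q * Q * (\<Sum>f\<in>forms {0} j. (card (points_in S (common_zeros f j)))\<^sup>2) =
    card (forms {0 :: 'a ^ 'n} j) * (x * (Q + (x - 1)))"
proof -
  let ?T = "card (forms {0 :: 'a ^ 'n} j)"
  let ?X = "\<lambda>f. card (points_in S (common_zeros f j))"
  note fin = finite_forms[of "{0 :: 'a ^ 'n}" j]
  have "(\<Sum>f\<in>forms {0} j. (?X f)\<^sup>2) = (\<Sum>f\<in>forms {0} j. \<Sum>P\<in>S. if P \<subseteq> common_zeros f j then ?X f else 0)"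
    by (intro sum.cong refl) (simp add: points_in_def power2_eq_square flip: sum.inter_filter)
  also have "\<dots> = (\<Sum>P\<in>S. \<Sum>f\<in>forms {0} j. if P \<subseteq> common_zeros f j then ?X f else 0)"
    by (rule sum.swap)
  also have "\<dots> = (\<Sum>P\<in>S. \<Sum>f\<in>forms P j. ?X f)"
  proof (rule sum.cong[OF refl])
    fix P assume "P \<in> S"
    then obtain v where v: "v \<noteq> 0" "P = vec.span {v}" using S proj_pointsE by blast
    have "{f \<in> forms {0} j. P \<subseteq> common_zeros f j} = {f \<in> forms {0} j. v \<in> common_zeros f j}"
      unfolding v(2) using span_singleton_subset_iff[OF subspace_over_common_zeros] by blast
    also have "\<dots> = forms (adjoin UNIV v {0}) j"
      by (rule forms_adjoin) (rule subspace_over_zero_space)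
    also have "adjoin UNIV v {0} = P"
      unfolding v(2) by (rule adjoin_zero_space)
    finally have "{f \<in> forms {0} j. P \<subseteq> common_zeros f j} = forms P j" .
    moreover have "(\<Sum>f\<in>forms {0} j. if P \<subseteq> common_zeros f j then ?X f else 0)
      = (\<Sum>f\<in>{f \<in> forms {0} j. P \<subseteq> common_zeros f j}. ?X f)"
      using fin by (simp add: sum.If_cases Int_def)
    ultimately show "(\<Sum>f\<in>forms {0} j. if P \<subseteq> common_zeros f j then ?X f else 0)
      = (\<Sum>f\<in>forms P j. ?X f)" by simp
  qed
  finally have "Q * Q * (\<Sum>f\<in>forms {0} j. (?X f)\<^sup>2) = (\<Sum>P\<in>S. Q * (Q * (\<Sum>f\<in>forms P j. ?X f)))"
    by (simp only: sum_distrib_left mult.assoc)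
  also have "\<dots> = (\<Sum>P\<in>S. ?T * (Q + (x - 1)))"
  proof (rule sum.cong[OF refl])
    fix P assume PS: "P \<in> S"
    then obtain v where v: "v \<noteq> 0" "P = vec.span {v}" using S proj_pointsE by blast
    have "points_in S P = {P}" using points_in_span_singleton[OF S v(1)] PS v(2) by simp
    hence 1: "card (points_in S P) = 1" by simp
    have "Q * (\<Sum>f\<in>forms P j. ?X f) = card (forms P j) * (Q * 1 + (x - 1))"
      using sum_points_in_common_zeros[OF subspace_over_span S, of j "{v}"]
      unfolding Q_def x_def v(2)[symmetric] 1 .
    hence "Q * (Q * (\<Sum>f\<in>forms P j. ?X f)) = Q * card (forms P j) * (Q + (x - 1))" by simp
    also have "adjoin UNIV v {0} = P"
      unfolding v(2) by (rule adjoin_zero_space)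
    hence "Q * card (forms P j) = ?T"
      unfolding Q_def using card_forms_adjoin[OF subspace_over_zero_space, of v j] v(1) by simp
    finally show "Q * (Q * (\<Sum>f\<in>forms P j. ?X f)) = ?T * (Q + (x - 1))" .
  qed
  also have "\<dots> = ?T * (x * (Q + (x - 1)))" unfolding x_def by simp
  finally show ?thesis .
qed

lemma cong_1_ge:
  assumes "[x = 1] (mod m)" "x \<noteq> 1" "m > 1" shows "x \<ge> m + (1::nat)"
proof -
  have "x mod m = 1" using assms(1,3) by (simp add: cong_def)
  hence "x = m * (x div m) + 1" by (metis div_mult_mod_eq mult.commute)
  moreover have "x div m \<noteq> 0" using calculation assms(2) by (intro notI) simp
  ultimately show ?thesis by (metis One_nat_def Suc_leI add_le_mono1 mult.right_neutral mult_le_mono2 neq0_conv)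
qed

text \<open>
  The number \<open>X\<close> of points of \<open>S\<close> in the common zeros of a random family is \<open>1\<close> or at least
  \<open>m + 1\<close>, so the mean of \<open>(X - 1) * (X - (m + 1))\<close> is not negative. The mean of \<open>X\<close> is
  \<open>x / Q\<close> and the mean of \<open>X\<^sup>2\<close> is \<open>x / Q + x * (x - 1) / Q\<^sup>2\<close>.
\<close>

lemma second_moment_inequality:
  fixes S :: "('a::{field,finite} ^ 'n) set set" and j m :: nat and Q x :: real
  assumes S: "S \<subseteq> proj_points" and m: "m > 1"
    and mod: "\<And>f. [card (points_in S (common_zeros f j)) = 1] (mod m)"
  defines "Q \<equiv> real CARD('a) ^ j" and "x \<equiv> real (card S)"
  shows "x * (x - 1) - (real m + 1) * x * Q + (real m + 1) * Q\<^sup>2 \<ge> 0" and "Q \<le> x"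
proof -
  let ?X = "\<lambda>f. card (points_in S (common_zeros f j))"
  let ?F = "forms {0 :: 'a ^ 'n} j"
  define T where "T = real (card ?F)"
  have T: "T > 0" unfolding T_def using finite_forms[of "{0 :: 'a ^ 'n}" j] forms_nonempty[of "{0 :: 'a ^ 'n}" j]
    by (simp add: card_gt_0_iff)
  have X1: "?X f \<ge> 1" for f
    using mod[of f] m by (cases "?X f = 0") (auto simp: cong_def)
  have S0: "card (points_in S {0}) = 0" by (simp add: points_in_zero[OF S])
  have "CARD('a) ^ j * (\<Sum>f\<in>?F. ?X f) = card ?F * card S"
    using sum_points_in_common_zeros[OF subspace_over_zero_space S, of j] S0 by simp
  from arg_cong[OF this, of real] have first: "Q * (\<Sum>f\<in>?F. real (?X f)) = T * x"
    unfolding Q_def T_def x_def by simp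
  have "CARD('a) ^ j * 1 \<le> card S"
    using all_many_points[OF subspace_over_zero_space S, of j 1] X1 S0 by simp
  thus Qx: "Q \<le> x" unfolding Q_def x_def by (metis mult.right_neutral of_nat_le_iff of_nat_power)
  have Q0: "Q > 0" unfolding Q_def by simp
  hence "card S \<ge> 1" using Qx unfolding x_def by linarith
  hence rx: "real (card S - 1) = x - 1" unfolding x_def by (simp add: of_nat_diff)
  have second: "Q * Q * (\<Sum>f\<in>?F. (real (?X f))\<^sup>2) = T * (x * (Q + (x - 1)))"
    using arg_cong[OF sum_squares_points_in_common_zeros[OF S, of j], of real]
    unfolding Q_def T_def of_nat_mult of_nat_sum of_nat_power of_nat_add rx unfolding x_def .
  have "0 \<le> (\<Sum>f\<in>?F. (real (?X f) - 1) * (real (?X f) - (real m + 1)))"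
  proof (rule sum_nonneg)
    fix f
    show "0 \<le> (real (?X f) - 1) * (real (?X f) - (real m + 1))"
    proof (cases "?X f = 1")
      case False
      hence "?X f \<ge> m + 1" by (rule cong_1_ge[OF mod _ m])
      hence "real (?X f) \<ge> real m + 1" by linarith
      thus ?thesis by (intro mult_nonneg_nonneg) auto
    qed simp
  qed
  also have "\<dots> = (\<Sum>f\<in>?F. (real (?X f))\<^sup>2) - (real m + 2) * (\<Sum>f\<in>?F. real (?X f)) + (real m + 1) * T"
    unfolding T_def by (simp add: sum.distrib sum_subtractf sum_distrib_left algebra_simps power2_eq_square)
  finally have "0 \<le> Q * Q * ((\<Sum>f\<in>?F. (real (?X f))\<^sup>2) - (real m + 2) * (\<Sum>f\<in>?F. real (?X f)) + (real m + 1) * T)"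
    using Q0 by (intro mult_nonneg_nonneg) auto
  also have "\<dots> = Q * Q * (\<Sum>f\<in>?F. (real (?X f))\<^sup>2) - (real m + 2) * Q * (Q * (\<Sum>f\<in>?F. real (?X f))) + (real m + 1) * (Q * Q) * T"
    by (simp add: algebra_simps)
  also have "\<dots> = T * (x * (x - 1) - (real m + 1) * x * Q + (real m + 1) * Q\<^sup>2)"
    unfolding first second by (simp add: algebra_simps power2_eq_square)
  finally show "x * (x - 1) - (real m + 1) * x * Q + (real m + 1) * Q\<^sup>2 \<ge> 0"
    using T by (simp add: zero_le_mult_iff)
qed

text \<open>
  In terms of \<open>y = x / Q - 1\<close> the inequality implies \<open>y\<^sup>2 - (m - 1) * y + 1 \<ge> 0\<close>, and this
  quadratic is negative for \<open>y\<close> between \<open>1 / (m - 2)\<close> and \<open>m - 3\<close>.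
\<close>

lemma quadratic_gap:
  fixes x Q m :: real
  assumes ineq: "x * (x - 1) - (m + 1) * x * Q + (m + 1) * Q\<^sup>2 \<ge> 0"
    and Q: "Q > 0" and x: "x \<ge> 0" and m: "m \<ge> 12" and small: "x < (m - 2) * Q"
  shows "x * (m - 2) \<le> (m - 1) * Q"
proof (rule ccontr)
  assume "\<not> ?thesis"
  hence big: "x * (m - 2) - (m - 1) * Q > 0" by simp
  define y where "y = x / Q - 1"
  define a where "a = 1 / (m - 2)"
  have xy: "x = (1 + y) * Q" unfolding y_def using Q by simp
  have a: "a * (m - 2) = 1" "a > 0" "a < 1" unfolding a_def using m by auto
  have "Q * ((1 + y) * (m - 2) - (m - 1)) > 0" using big unfolding xy by (simp add: algebra_simps)
  hence "(1 + y) * (m - 2) - (m - 1) > 0" using Q by (simp add: zero_less_mult_iff)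
  hence "y * (m - 2) > 1" by (simp add: algebra_simps)
  hence ya: "y > a" unfolding a_def using m by (simp add: field_simps)
  have yb: "y < m - 3" using small unfolding xy mult_less_cancel_right_pos[OF Q] by linarith
  have "Q\<^sup>2 * (y\<^sup>2 - (m - 1) * y + 1) = x * x - (m + 1) * x * Q + (m + 1) * Q\<^sup>2"
    unfolding xy by (simp add: algebra_simps power2_eq_square)
  also have "\<dots> \<ge> 0" using ineq x by (simp add: algebra_simps)
  finally have f: "y\<^sup>2 - (m - 1) * y + 1 \<ge> 0" using Q by (simp add: zero_le_mult_iff)
  (* the next three facts give the sign of each term in the expansion of the quadratic *)
  have "(y - a) * (m - 3 - y) > 0" using ya yb by (intro mult_pos_pos) auto
  moreover have "(2 - a) * (y - a) > 0" using a ya by (intro mult_pos_pos) auto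
  moreover have "a\<^sup>2 < a" using a by (simp add: power2_eq_square)
  moreover have "y\<^sup>2 - (m - 1) * y + 1 = - ((y - a) * (m - 3 - y)) - (2 - a) * (y - a) + (a\<^sup>2 - a) + (1 - a * (m - 2))"
    by (simp add: algebra_simps power2_eq_square)
  ultimately show False using f a(1) by linarith
qed

lemma size_gap:
  fixes S :: "('a::{field,finite} ^ 'n) set set"
  assumes S: "S \<subseteq> proj_points" and m: "m \<ge> 12"
    and mod: "\<And>f. [card (points_in S (common_zeros f j)) = 1] (mod m)"
    and small: "real (card S) < (real m - 2) * real CARD('a) ^ j"
  shows "real (card S) * (real m - 2) \<le> (real m - 1) * real CARD('a) ^ j"
  using second_moment_inequality(1)[OF S _ mod] small m
  by (intro quadratic_gap) auto

section \<open>Counting the lines through a point\<close>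

text \<open>
  Every fibre of \<open>f\<close> on \<open>S\<close> has an element, and at least two if it meets \<open>D\<close>; hence twice
  its size is at least two more than the size of its part in \<open>D\<close>.
\<close>

lemma card_image_paired:
  assumes fin: "finite S" and D: "D \<subseteq> S"
    and partner: "\<And>P. P \<in> D \<Longrightarrow> \<exists>P'\<in>S. P' \<noteq> P \<and> f P' = f P"
  shows "2 * card (f ` S) + card D \<le> 2 * card S"
proof -
  have fibre: "2 + card {P \<in> D. f P = l} \<le> 2 * card {P \<in> S. f P = l}" if "l \<in> f ` S" for l
  proof (cases "{P \<in> D. f P = l} = {}")
    case True
    have "card {P \<in> S. f P = l} > 0" using that fin by (auto simp: card_gt_0_iff)
    moreover have "card {P \<in> D. f P = l} = 0" unfolding True by simp
    ultimately show ?thesis by linarith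
  next
    case False
    then obtain P where P: "P \<in> D" "f P = l" by auto
    then obtain P' where P': "P' \<in> S" "P' \<noteq> P" "f P' = l" using partner by blast
    have "card {P, P'} \<le> card {P \<in> S. f P = l}" by (rule card_mono) (use P P' D fin in auto)
    moreover have "card {P \<in> D. f P = l} \<le> card {P \<in> S. f P = l}"
      by (rule card_mono) (use D fin in auto)
    ultimately show ?thesis using P' by simp
  qed
  have part: "card C = (\<Sum>l\<in>f ` S. card {P \<in> C. f P = l})" if "C \<subseteq> S" for C
  proof -
    have "C = (\<Union>l\<in>f ` S. {P \<in> C. f P = l})" using that by auto
    hence "card C = card (\<Union>l\<in>f ` S. {P \<in> C. f P = l})" by simp
    also have "\<dots> = (\<Sum>l\<in>f ` S. card {P \<in> C. f P = l})"
      by (rule card_UN_disjoint) (use fin finite_subset[OF that fin] in auto)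
    finally show ?thesis .
  qed
  have "2 * card (f ` S) + card D = (\<Sum>l\<in>f ` S. 2 + card {P \<in> D. f P = l})"
    by (subst part[OF D]) (simp only: sum.distrib sum_constant mult.commute of_nat_id)
  also have "\<dots> \<le> (\<Sum>l\<in>f ` S. 2 * card {P \<in> S. f P = l})" by (rule sum_mono[OF fibre])
  also have "\<dots> = 2 * card S" by (simp only: sum_distrib_left[symmetric] part[OF order_refl, symmetric])
  finally show ?thesis .
qed

text \<open>
  Every family of \<open>j\<close> forms that vanishes at \<open>x\<close> also vanishes at a point of \<open>S\<close>, hence on
  the line that joins the two. One line accounts only for the fraction \<open>CARD('a) ^ (- j)\<close> of
  the families.
\<close>

lemma lines_through_point:
  fixes S :: "('a::{field,finite} ^ 'n) set set"
  assumes S: "S \<subseteq> proj_points" and x: "x \<noteq> 0" and xS: "vec.span {x} \<notin> S"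
    and block: "\<And>f. points_in S (common_zeros f j) \<noteq> {}"
  shows "CARD('a) ^ j \<le> card ((\<lambda>P. vec.span (insert x P)) ` S)"
proof -
  let ?lines = "(\<lambda>P. vec.span (insert x P)) ` S"
  let ?Fx = "forms (vec.span {x}) j"
  have ins: "vec.span (insert x (vec.span {v})) = adjoin UNIV v (vec.span {x})" for v
    unfolding adjoin_span_singleton by (rule span_insert_span_singleton)
  have line: "CARD('a) ^ j * card (forms l j) = card ?Fx" if l: "l \<in> ?lines" for l
  proof -
    obtain P where P: "P \<in> S" "l = vec.span (insert x P)" using l by blast
    obtain v where v: "v \<noteq> 0" "P = vec.span {v}" using S P proj_pointsE by blast
    have "v \<notin> vec.span {x}" using span_singleton_eq[of v x] v P(1) xS by metis
    thus ?thesis unfolding P(2) v(2) ins by (intro card_forms_adjoin subspace_over_span)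
  qed
  have lineform: "f \<in> forms (vec.span (insert x P)) j"
    if P: "P \<in> S" "P \<subseteq> common_zeros f j" and f: "f \<in> ?Fx" for P f
  proof -
    obtain v where v: "v \<noteq> 0" "P = vec.span {v}" using S P proj_pointsE by blast
    have "v \<in> common_zeros f j" using P(2) v(2) span_singleton_self by blast
    hence "f \<in> {f \<in> ?Fx. v \<in> common_zeros f j}" using f by simp
    thus ?thesis unfolding v(2) ins forms_adjoin[OF subspace_over_span] .
  qed
  have "?Fx \<subseteq> (\<Union>l\<in>?lines. forms l j)"
  proof
    fix f assume f: "f \<in> ?Fx"
    obtain P where "P \<in> points_in S (common_zeros f j)" using block[of f] by (metis ex_in_conv)
    hence P: "P \<in> S" "P \<subseteq> common_zeros f j" unfolding points_in_def by simp_all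
    have l: "vec.span (insert x P) \<in> ?lines" using P(1) by (rule imageI)
    show "f \<in> (\<Union>l\<in>?lines. forms l j)" 
      by (rule UN_I[where a="vec.span (insert x P)"]) (rule l, rule lineform[OF P f])
  qed
  hence "card ?Fx \<le> card (\<Union>l\<in>?lines. forms l j)"
    by (rule card_mono[rotated]) (simp add: finite_forms)
  also have "\<dots> \<le> (\<Sum>l\<in>?lines. card (forms l j))" by (rule card_UN_le) simp
  finally have "CARD('a) ^ j * card ?Fx \<le> CARD('a) ^ j * (\<Sum>l\<in>?lines. card (forms l j))"
    by (rule mult_left_mono) simp
  also have "\<dots> = (\<Sum>l\<in>?lines. card ?Fx)" unfolding sum_distrib_left using line by (rule sum.cong[OF refl])
  also have "\<dots> = card ?lines * card ?Fx" by simp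
  finally have "CARD('a) ^ j * card ?Fx \<le> card ?lines * card ?Fx" .
  moreover have "card ?Fx > 0"
    using finite_forms[of "vec.span {x}" j] forms_nonempty[of "vec.span {x}" j]
    by (simp add: card_gt_0_iff)
  ultimately show ?thesis by (metis mult_le_cancel2)
qed

text \<open>
  This is how points are shown to belong to \<open>S\<close>: a point outside \<open>S\<close> sees \<open>S\<close> on at least
  \<open>CARD('a) ^ j\<close> lines, and if \<open>S\<close> is hardly larger than that, only few of its points can
  share their line through \<open>x\<close> with another point of \<open>S\<close>.
\<close>

lemma few_lines_contradiction:
  fixes S :: "('a::{field,finite} ^ 'n) set set"
  assumes S: "S \<subseteq> proj_points" and x: "x \<noteq> 0" and xS: "vec.span {x} \<notin> S"
    and block: "\<And>f. points_in S (common_zeros f j) \<noteq> {}"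
    and D: "D \<subseteq> S"
    and partner: "\<And>P. P \<in> D \<Longrightarrow> \<exists>P'\<in>S. P' \<noteq> P \<and> vec.span (insert x P') = vec.span (insert x P)"
  shows "2 * CARD('a) ^ j + card D \<le> 2 * card S"
proof -
  have "2 * card ((\<lambda>P. vec.span (insert x P)) ` S) + card D \<le> 2 * card S"
    by (rule card_image_paired[OF finite D]) (rule partner)
  thus ?thesis using lines_through_point[OF S x xS block] by linarith
qed

section \<open>Power sums over additive subgroups\<close>

definition additive_map :: "('a::field ^ 'n \<Rightarrow> 'a) \<Rightarrow> bool" where
  "additive_map g \<longleftrightarrow> (\<forall>x y. g (x + y) = g x + g y)"

lemma additive_map_dot: "additive_map (dot \<phi>)"
  by (simp add: additive_map_def dot_add_right)

lemma additive_map_zero: "additive_map g \<Longrightarrow> g 0 = 0"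
  unfolding additive_map_def by (metis add_cancel_right_right)

lemma additive_map_prime_field:
  assumes g: "additive_map (g :: 'a::{field,finite} ^ 'n \<Rightarrow> 'a)" and c: "c \<in> prime_field"
  shows "g (c *s b) = c * g b"
proof -
  have "g (of_nat i *s b) = of_nat i * g b" for i
  proof (induction i)
    case (Suc i)
    have "of_nat (Suc i) *s b = b + of_nat i *s b" by (simp add: vec.scale_left_distrib)
    thus ?case using g Suc unfolding additive_map_def by (simp add: distrib_right)
  qed (simp add: additive_map_zero[OF g])
  thus ?thesis using c unfolding prime_field_def by auto
qed

lemma frobenius_CHAR:
  "((x :: 'a::{field,finite}) + y) ^ CHAR('a) = x ^ CHAR('a) + y ^ CHAR('a)"
  using frobenius_add[of x y 1] by simp

lemma additive_map_power:
  assumes "additive_map (g :: 'a::{field,finite} ^ 'n \<Rightarrow> 'a)"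
  shows "additive_map (\<lambda>x. g x ^ (CHAR('a) ^ d))"
  using assms unfolding additive_map_def by (simp add: frobenius_add)

text \<open>
  The polynomial functions of degree at most \<open>n\<close>, where every additive map counts as linear.
  In particular the powers of a linear form with exponent a power of the characteristic have
  degree \<open>1\<close>.
\<close>

inductive low_degree :: "nat \<Rightarrow> ('a::field ^ 'n \<Rightarrow> 'a) \<Rightarrow> bool" where
  const: "low_degree n (\<lambda>_. c)"
| mult: "additive_map g \<Longrightarrow> low_degree n f \<Longrightarrow> low_degree (Suc n) (\<lambda>x. g x * f x)"
| add: "low_degree n f \<Longrightarrow> low_degree n h \<Longrightarrow> low_degree n (\<lambda>x. f x + h x)"

lemma low_degree_scale: "low_degree n f \<Longrightarrow> low_degree n (\<lambda>x. c * f x)"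
proof (induction rule: low_degree.induct)
  case (const n d) show ?case by (rule low_degree.const)
next
  case (mult g n f)
  have "low_degree (Suc n) (\<lambda>x. g x * (c * f x))" by (rule low_degree.mult[OF mult.hyps(1) mult.IH])
  thus ?case by (simp add: mult.left_commute)
next
  case (add n f h)
  have "low_degree n (\<lambda>x. c * f x + c * h x)" by (rule low_degree.add[OF add.IH])
  thus ?case by (simp add: distrib_left)
qed

lemma low_degree_diff:
  assumes "low_degree n f" "low_degree n h" shows "low_degree n (\<lambda>x. f x - h x)"
  using low_degree.add[OF assms(1) low_degree_scale[OF assms(2), of "- 1"]] by simp

lemma low_degree_mult_power:
  assumes "additive_map g" "low_degree n f" shows "low_degree (a + n) (\<lambda>x. g x ^ a * f x)"
proof (induction a)
  case (Suc a)
  have "low_degree (Suc (a + n)) (\<lambda>x. g x * (g x ^ a * f x))" by (rule low_degree.mult[OF assms(1) Suc])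
  thus ?case by (simp add: mult.assoc)
qed (use assms in simp)

text \<open>
  The Frobenius map is additive, so it respects sums and turns additive maps into additive
  maps.
\<close>

lemma low_degree_CHAR_power:
  assumes "low_degree n (f :: 'a::{field,finite} ^ 'n \<Rightarrow> 'a)"
  shows "low_degree n (\<lambda>x. f x ^ CHAR('a))"
  using assms
proof (induction rule: low_degree.induct)
  case (const n c) show ?case by (rule low_degree.const)
next
  case (mult g n f)
  have "additive_map (\<lambda>x. g x ^ CHAR('a))" using additive_map_power[OF mult.hyps(1), of 1] by simp
  from low_degree.mult[OF this mult.IH] show ?case by (simp add: power_mult_distrib)
next
  case (add n f h)
  from low_degree.add[OF add.IH] show ?case by (simp add: frobenius_CHAR)
qed

text \<open>
  The Taylor expansion along a line: the coefficient of \<open>c ^ j\<close> has degree at most \<open>n - j\<close>.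
  The scalar \<open>c\<close> is restricted to the prime field because additive maps are homogeneous
  there.
\<close>

lemma low_degree_translate:
  assumes "low_degree n (f :: 'a::{field,finite} ^ 'n \<Rightarrow> 'a)"
  shows "\<exists>h. (\<forall>j\<le>n. low_degree (n - j) (h j)) \<and>
    (\<forall>w. \<forall>c\<in>prime_field. f (w + c *s b) = (\<Sum>j\<le>n. c ^ j * h j w))"
  using assms
proof (induction rule: low_degree.induct)
  case (const n d)
  let ?h = "\<lambda>j (w :: 'a ^ 'n). if j = 0 then d else 0"
  have "low_degree (n - j) (?h j)" for j by (cases "j = 0") (simp_all add: low_degree.const)
  moreover have "d = (\<Sum>j\<le>n. c ^ j * (if j = 0 then d else 0))" for c
  proof -
    have "(\<Sum>j\<le>n. c ^ j * (if j = 0 then d else 0)) = (\<Sum>j\<le>n. if j = 0 then d else 0)"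
      by (rule sum.cong) auto
    thus ?thesis by simp
  qed
  ultimately show ?case by (intro exI[of _ ?h] conjI allI ballI impI)
next
  case (mult g n f)
  then obtain h where h: "\<And>j. j \<le> n \<Longrightarrow> low_degree (n - j) (h j)"
    "\<And>w c. c \<in> prime_field \<Longrightarrow> f (w + c *s b) = (\<Sum>j\<le>n. c ^ j * h j w)" by blast
  define h' where "h' = (\<lambda>j w. g w * (if j \<le> n then h j w else 0) + g b * (if j = 0 then 0 else h (j - 1) w))"
  have "low_degree (Suc n - j) (h' j)" if j: "j \<le> Suc n" for j
  proof -
    have 1: "low_degree (Suc n - j) (\<lambda>w. g w * (if j \<le> n then h j w else 0))"
    proof (cases "j \<le> n")
      case True
      have "low_degree (Suc (n - j)) (\<lambda>w. g w * h j w)" by (rule low_degree.mult[OF mult.hyps(1) h(1)[OF True]])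
      thus ?thesis using True by (simp add: Suc_diff_le)
    qed (simp add: low_degree.const)
    have 2: "low_degree (Suc n - j) (\<lambda>w. g b * (if j = 0 then 0 else h (j - 1) w))"
    proof (cases "j = 0")
      case False
      have "low_degree (n - (j - 1)) (\<lambda>w. g b * h (j - 1) w)" using j False by (intro low_degree_scale h(1)) simp
      moreover have "n - (j - 1) = Suc n - j" using False by simp
      ultimately show ?thesis using False by simp
    qed (simp add: low_degree.const)
    show ?thesis unfolding h'_def by (rule low_degree.add[OF 1 2])
  qed
  moreover have "g (w + c *s b) * f (w + c *s b) = (\<Sum>j\<le>Suc n. c ^ j * h' j w)" if c: "c \<in> prime_field" for w c
  proof -
    have "(\<Sum>j\<le>Suc n. c ^ j * h' j w) = (\<Sum>j\<le>Suc n. c ^ j * (g w * (if j \<le> n then h j w else 0)))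
      + (\<Sum>j\<le>Suc n. c ^ j * (g b * (if j = 0 then 0 else h (j - 1) w)))"
      unfolding h'_def by (simp only: distrib_left sum.distrib)
    also have "(\<Sum>j\<le>Suc n. c ^ j * (g w * (if j \<le> n then h j w else 0))) = g w * (\<Sum>j\<le>n. c ^ j * h j w)"
      unfolding sum.atMost_Suc by (simp add: sum_distrib_left mult.left_commute)
    also have "(\<Sum>j\<le>Suc n. c ^ j * (g b * (if j = 0 then 0 else h (j - 1) w))) = c * g b * (\<Sum>j\<le>n. c ^ j * h j w)"
      unfolding sum.atMost_Suc_shift by (simp add: sum_distrib_left mult_ac)
    also have "g w * (\<Sum>j\<le>n. c ^ j * h j w) + c * g b * (\<Sum>j\<le>n. c ^ j * h j w) = g (w + c *s b) * f (w + c *s b)"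
      using mult.hyps(1) additive_map_prime_field[OF mult.hyps(1) c, of b] h(2)[OF c, of w]
      unfolding additive_map_def by (simp add: distrib_right)
    finally show ?thesis ..
  qed
  ultimately show ?case by (intro exI[of _ h'] conjI allI ballI impI)
next
  case (add n f1 f2)
  then obtain h1 h2 where h: "\<And>j. j \<le> n \<Longrightarrow> low_degree (n - j) (h1 j)" "\<And>j. j \<le> n \<Longrightarrow> low_degree (n - j) (h2 j)"
    "\<And>w c. c \<in> prime_field \<Longrightarrow> f1 (w + c *s b) = (\<Sum>j\<le>n. c ^ j * h1 j w)"
    "\<And>w c. c \<in> prime_field \<Longrightarrow> f2 (w + c *s b) = (\<Sum>j\<le>n. c ^ j * h2 j w)" by blast
  have "low_degree (n - j) (\<lambda>w. h1 j w + h2 j w)" if "j \<le> n" for j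
    by (rule low_degree.add[OF h(1,2)[OF that]])
  moreover have "f1 (w + c *s b) + f2 (w + c *s b) = (\<Sum>j\<le>n. c ^ j * (h1 j w + h2 j w))"
    if "c \<in> prime_field" for w c
    unfolding h(3,4)[OF that] by (simp only: distrib_left sum.distrib)
  ultimately show ?case by (intro exI[of _ "\<lambda>j w. h1 j w + h2 j w"] conjI allI ballI impI)
qed

text \<open>
  If \<open>j > 0\<close>, some \<open>a\<close> has \<open>a ^ j \<noteq> 1\<close>, and multiplication by \<open>a\<close> permutes the prime field.
\<close>

lemma sum_prime_field_power:
  assumes "j < CHAR('a) - 1"
  shows "(\<Sum>c\<in>prime_field. c ^ j) = (0 :: 'a::{field,finite})"
proof (cases "j = 0")
  case True
  have "(\<Sum>c\<in>prime_field. c ^ j) = (of_nat (card (prime_field :: 'a set)) :: 'a)" using True by simp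
  thus ?thesis unfolding card_prime_field by simp
next
  case False
  have sf: "is_subfield (prime_field :: 'a set)" by (rule is_subfield_prime_field)
  have "\<exists>a\<in>prime_field - {0 :: 'a}. a ^ j \<noteq> 1"
  proof (rule ccontr)
    assume "\<not> ?thesis"
    hence sub: "prime_field - {0} \<subseteq> {x :: 'a. poly (monom 1 j - 1) x = 0}" by (auto simp: poly_monom)
    have deg: "degree (monom 1 j - 1 :: 'a poly) \<le> j"
      by (intro degree_diff_le degree_monom_le) simp
    have "coeff (monom 1 j - 1 :: 'a poly) j = 1" using False by simp
    hence nz: "(monom 1 j - 1 :: 'a poly) \<noteq> 0" by (metis coeff_0 zero_neq_one)
    have "card (prime_field - {0 :: 'a}) \<le> card {x :: 'a. poly (monom 1 j - 1) x = 0}"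
      by (rule card_mono[OF _ sub]) simp
    also have "\<dots> \<le> j" using card_poly_roots_bound[OF nz] deg by linarith
    finally have "card (prime_field - {0 :: 'a}) \<le> j" .
    moreover have "card (prime_field - {0 :: 'a}) = CHAR('a) - 1"
      using sf by (subst card_Diff_singleton) (auto simp: is_subfield_def card_prime_field)
    ultimately show False using assms by simp
  qed
  then obtain a :: 'a where a: "a \<in> prime_field" "a \<noteq> 0" "a ^ j \<noteq> 1" by blast
  have inv: "inverse a \<in> prime_field" using sf a by (simp add: is_subfield_def)
  have cl: "x * y \<in> prime_field" if "x \<in> prime_field" "y \<in> prime_field" for x y :: 'a
    using sf that by (simp add: is_subfield_def)
  have "(\<Sum>c\<in>prime_field. c ^ j) = (\<Sum>c\<in>prime_field. (a * c) ^ j)"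
    by (rule sum.reindex_bij_witness[of _ "\<lambda>c. a * c" "\<lambda>c. inverse a * c"])
      (use a inv cl in \<open>simp_all add: mult.assoc[symmetric]\<close>)
  also have "\<dots> = a ^ j * (\<Sum>c\<in>prime_field. c ^ j)"
    by (simp add: power_mult_distrib sum_distrib_left)
  finally have "(a ^ j - 1) * (\<Sum>c\<in>prime_field. c ^ j) = 0" by (simp add: algebra_simps)
  thus ?thesis using a by simp
qed

text \<open>
  The argument of Chevalley and Warning. When \<open>b\<close> is adjoined to \<open>X\<close>, the sum over \<open>c\<close> in
  the prime field kills the Taylor coefficients of \<open>c ^ j\<close> with \<open>j < CHAR('a) - 1\<close>; the
  degree of the other coefficients has dropped by at least \<open>CHAR('a) - 1\<close>, so that their
  sums over \<open>X\<close> vanish by induction.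
\<close>

theorem sum_low_degree:
  fixes W :: "('a::{field,finite} ^ 'n) set"
  assumes W: "subspace_over prime_field W" and card: "card W = CHAR('a) ^ r"
    and f: "low_degree n f" and n: "n < r * (CHAR('a) - 1)"
  shows "(\<Sum>w\<in>W. f w) = 0"
proof -
  have p2: "CHAR('a) \<ge> 2" by (rule prime_ge_2_nat[OF prime_CHAR_finite])
  have "\<forall>r n f. card W = CHAR('a) ^ r \<longrightarrow> low_degree n f \<longrightarrow> n < r * (CHAR('a) - 1) \<longrightarrow> (\<Sum>w\<in>W. f w) = 0"
  proof (rule subspace_induct[OF is_subfield_prime_field subspace_over_zero_space W])
    show "{0} \<subseteq> W" using subspace_over_zero[OF W] by simp
    have "r = 0" if "1 = CHAR('a) ^ r" for r using that p2 by (cases r) auto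
    thus "\<forall>r n f. card {0 :: 'a ^ 'n} = CHAR('a) ^ r \<longrightarrow> low_degree n f \<longrightarrow> n < r * (CHAR('a) - 1)
      \<longrightarrow> (\<Sum>w\<in>{0}. f w) = 0" by (metis card.empty card.insert empty_iff finite.emptyI One_nat_def mult_0 not_less0)
  next
    fix X :: "('a ^ 'n) set" and b
    assume X: "subspace_over prime_field X" "b \<notin> X" and IH:
      "\<forall>r n f. card X = CHAR('a) ^ r \<longrightarrow> low_degree n f \<longrightarrow> n < r * (CHAR('a) - 1) \<longrightarrow> (\<Sum>w\<in>X. f w) = 0"
    show "\<forall>r n f. card (adjoin prime_field b X) = CHAR('a) ^ r \<longrightarrow> low_degree n f \<longrightarrow>
      n < r * (CHAR('a) - 1) \<longrightarrow> (\<Sum>w\<in>adjoin prime_field b X. f w) = 0"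
    proof (intro allI impI)
      fix r n and f :: "'a ^ 'n \<Rightarrow> 'a"
      assume c: "card (adjoin prime_field b X) = CHAR('a) ^ r" and f: "low_degree n f"
        and n: "n < r * (CHAR('a) - 1)"
      obtain s where r: "r = Suc s" using n by (cases r) auto
      have cX: "card X = CHAR('a) ^ s"
        using c card_adjoin[OF is_subfield_prime_field X] p2 unfolding card_prime_field r by simp
      obtain h where h: "\<And>j. j \<le> n \<Longrightarrow> low_degree (n - j) (h j)"
        "\<And>w c. c \<in> prime_field \<Longrightarrow> f (w + c *s b) = (\<Sum>j\<le>n. c ^ j * h j w)"
        using low_degree_translate[OF f, of b] by blast
      have img: "adjoin prime_field b X = (\<lambda>(w, c). w + c *s b) ` (X \<times> prime_field)"
        unfolding adjoin_def by auto
      have "(\<Sum>w\<in>adjoin prime_field b X. f w) = (\<Sum>(w, c)\<in>X \<times> prime_field. f (w + c *s b))"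
        unfolding img by (subst sum.reindex[OF adjoin_inj[OF is_subfield_prime_field X]])
          (simp add: case_prod_unfold)
      also have "\<dots> = (\<Sum>w\<in>X. \<Sum>c\<in>prime_field. \<Sum>j\<le>n. c ^ j * h j w)"
        unfolding sum.cartesian_product[symmetric] using h(2) by (intro sum.cong refl)
      also have "\<dots> = (\<Sum>w\<in>X. \<Sum>j\<le>n. \<Sum>c\<in>prime_field. c ^ j * h j w)"
        by (intro sum.cong refl sum.swap)
      also have "\<dots> = (\<Sum>j\<le>n. \<Sum>w\<in>X. \<Sum>c\<in>prime_field. c ^ j * h j w)"
        by (rule sum.swap)
      also have "\<dots> = (\<Sum>j\<le>n. (\<Sum>c\<in>prime_field. c ^ j) * (\<Sum>w\<in>X. h j w))"
        by (intro sum.cong refl) (simp only: sum_distrib_right[symmetric] sum_distrib_left[symmetric])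
      also have "\<dots> = 0"
      proof (rule sum.neutral, rule ballI)
        fix j assume j: "j \<in> {..n}"
        show "(\<Sum>c\<in>prime_field. c ^ j) * (\<Sum>w\<in>X. h j w) = 0"
        proof (cases "j < CHAR('a) - 1")
          case True thus ?thesis by (simp add: sum_prime_field_power)
        next
          case False
          have "n - j < s * (CHAR('a) - 1)" using n j False unfolding r by simp
          hence "(\<Sum>w\<in>X. h j w) = 0" using IH cX h(1)[of j] j by blast
          thus ?thesis by simp
        qed
      qed
      finally show "(\<Sum>w\<in>adjoin prime_field b X. f w) = 0" .
    qed
  qed
  thus ?thesis using assms by blast
qed

text \<open>
  As \<open>i + j\<close> has only the digit \<open>CHAR('a) - 1\<close> in base \<open>CHAR('a)\<close>, adding \<open>i\<close> and \<open>j\<close>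
  produces no carries: in each of the \<open>k\<close> positions the two digits add up to \<open>CHAR('a) - 1\<close>,
  and a digit contributes its value to the degree.
\<close>

lemma low_degree_monomial:
  fixes z y :: "'a::{field,finite} ^ 'n \<Rightarrow> 'a"
  assumes z: "additive_map z" and y: "additive_map y"
  shows "i + j + 1 = CHAR('a) ^ k \<Longrightarrow> low_degree (k * (CHAR('a) - 1)) (\<lambda>w. z w ^ i * y w ^ j)"
proof (induction k arbitrary: i j)
  case 0
  hence "i = 0" "j = 0" by auto
  thus ?case by (simp add: low_degree.const)
next
  case (Suc k)
  let ?p = "CHAR('a)"
  have p2: "?p \<ge> 2" by (rule prime_ge_2_nat[OF prime_CHAR_finite])
  define i0 where "i0 = i mod ?p"
  have i: "i = i0 + ?p * (i div ?p)" unfolding i0_def by simp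
  have i0: "i0 \<le> ?p - 1" unfolding i0_def using p2 by (metis Suc_pred' mod_less_divisor less_Suc_eq_le order_less_le_trans zero_less_numeral)
  have "?p * (i div ?p) \<le> i" by (rule times_div_less_eq_dividend)
  hence "?p * (i div ?p) < ?p * ?p ^ k" using Suc.prems unfolding power_Suc by linarith
  hence "i div ?p < ?p ^ k" using p2 by simp
  then obtain j' where j': "i div ?p + j' + 1 = ?p ^ k" by (metis add.assoc less_imp_Suc_add Suc_eq_plus1 add_Suc_right)
  have "i + j + 1 = ?p * (i div ?p + j' + 1)" using Suc.prems j' by simp
  hence "i0 + j + 1 = ?p * (j' + 1)" using i by (simp add: algebra_simps)
  hence j: "j = (?p - 1 - i0) + ?p * j'" using i0 p2 by (simp add: algebra_simps)
  have "low_degree (k * (?p - 1)) (\<lambda>w. (z w ^ (i div ?p) * y w ^ j') ^ ?p)"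
    by (rule low_degree_CHAR_power[OF Suc.IH[OF j']])
  from low_degree_mult_power[OF z low_degree_mult_power[OF y this, of "?p - 1 - i0"], of i0]
  have "low_degree (i0 + ((?p - 1 - i0) + k * (?p - 1)))
    (\<lambda>w. z w ^ i0 * (y w ^ (?p - 1 - i0) * (z w ^ (i div ?p) * y w ^ j') ^ ?p))" .
  moreover have deg: "i0 + ((?p - 1 - i0) + k * (?p - 1)) = Suc k * (?p - 1)" using i0 by simp
  moreover have "z w ^ i0 * (y w ^ (?p - 1 - i0) * (z w ^ (i div ?p) * y w ^ j') ^ ?p) = z w ^ i * y w ^ j" for w
  proof -
    have "z w ^ i = z w ^ i0 * (z w ^ (i div ?p)) ^ ?p"
      by (subst i) (simp add: power_add power_mult[symmetric] mult.commute)
    moreover have "y w ^ j = y w ^ (?p - 1 - i0) * (y w ^ j') ^ ?p"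
      unfolding j by (simp add: power_add power_mult[symmetric] mult.commute)
    ultimately show ?thesis by (simp add: power_mult_distrib mult_ac)
  qed
  ultimately show ?case by (simp only: deg)
qed

text \<open>
  Multiplying out one factor at a time writes the form, which is homogeneous of degree
  \<open>CHAR('a) ^ k - 1\<close> in \<open>z\<close> and \<open>y\<close>, as a combination of the monomials treated before.
\<close>

lemma low_degree_form:
  fixes z y :: "'a::{field,finite} ^ 'n \<Rightarrow> 'a"
  assumes z: "additive_map z" and y: "additive_map y" and T: "finite T"
  shows "i + j + card T + 1 = CHAR('a) ^ k \<Longrightarrow>
    low_degree (k * (CHAR('a) - 1)) (\<lambda>w. z w ^ i * y w ^ j * (\<Prod>c\<in>T. z w - c * y w))"
  using T
proof (induction T arbitrary: i j rule: finite_induct)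
  case empty
  thus ?case using low_degree_monomial[OF z y, of i j k] by simp
next
  case (insert c T)
  have eq: "z w ^ i * y w ^ j * (\<Prod>c\<in>insert c T. z w - c * y w) =
    z w ^ Suc i * y w ^ j * (\<Prod>c\<in>T. z w - c * y w) - c * (z w ^ i * y w ^ Suc j * (\<Prod>c\<in>T. z w - c * y w))" for w
    using insert.hyps by (simp add: algebra_simps)
  show ?case unfolding eq
    by (intro low_degree_diff low_degree_scale insert.IH) (use insert.prems insert.hyps in simp_all)
qed

text \<open>
  Take a form of degree \<open>CHAR('a) ^ k - 1\<close> in \<open>z\<close> and \<open>y\<close> that has a factor \<open>z - c * y\<close> for
  every slope \<open>c\<close> that occurs, padded by a power of \<open>z\<close>. It vanishes wherever \<open>y\<close> does not,
  is a power of \<open>z\<close> where \<open>y\<close> vanishes, and its sum over \<open>Y\<close> is zero because its degree is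
  low.
\<close>

lemma few_slopes_power_sum:
  fixes Y :: "('a::{field,finite} ^ 'n) set" and z y :: "'a ^ 'n \<Rightarrow> 'a"
  assumes Y: "subspace_over prime_field Y" and card: "card Y = CHAR('a) ^ r"
    and z: "additive_map z" and y: "additive_map y" and k: "k < r"
    and T: "card ((\<lambda>w. z w / y w) ` {w \<in> Y. y w \<noteq> 0}) < CHAR('a) ^ k"
  shows "(\<Sum>w\<in>{w \<in> Y. y w = 0}. z w ^ (CHAR('a) ^ k - 1)) = 0"
proof -
  let ?T = "(\<lambda>w. z w / y w) ` {w \<in> Y. y w \<noteq> 0}"
  (* the padding that raises the degree of the product to CHAR('a) ^ k - 1 *)
  define i where "i = CHAR('a) ^ k - 1 - card ?T"
  have i: "i + 0 + card ?T + 1 = CHAR('a) ^ k" using T unfolding i_def by simp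
  define H where "H = (\<lambda>w. z w ^ i * y w ^ 0 * (\<Prod>c\<in>?T. z w - c * y w))"
  have "low_degree (k * (CHAR('a) - 1)) H"
    unfolding H_def by (rule low_degree_form[OF z y _ i]) simp
  moreover have "k * (CHAR('a) - 1) < r * (CHAR('a) - 1)"
    using k prime_ge_2_nat[OF prime_CHAR_finite[where 'a='a]] by simp
  ultimately have "0 = (\<Sum>w\<in>Y. H w)" using sum_low_degree[OF Y card] by simp
  also have "\<dots> = (\<Sum>w\<in>{w \<in> Y. y w = 0}. H w)"
  proof (rule sum.mono_neutral_right)
    show "\<forall>w\<in>Y - {w \<in> Y. y w = 0}. H w = 0"
    proof
      fix w assume w: "w \<in> Y - {w \<in> Y. y w = 0}"
      hence T: "z w / y w \<in> ?T" and 0: "z w - z w / y w * y w = 0" by auto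
      have "(\<Prod>c\<in>?T. z w - c * y w) = 0" by (rule prod_zero[OF finite]) (rule bexI[where x="z w / y w"], rule 0, rule T)
      thus "H w = 0" unfolding H_def by simp
    qed
  qed auto
  also have "\<dots> = (\<Sum>w\<in>{w \<in> Y. y w = 0}. z w ^ (CHAR('a) ^ k - 1))"
  proof (rule sum.cong[OF refl])
    fix w assume "w \<in> {w \<in> Y. y w = 0}"
    hence "H w = z w ^ (i + card ?T)" unfolding H_def power_add by simp
    also have "i + card ?T = CHAR('a) ^ k - 1" using i by simp
    finally show "H w = z w ^ (CHAR('a) ^ k - 1)" .
  qed
  finally show ?thesis ..
qed

section \<open>Recognising a subfield by power sums\<close>

text \<open>
  The additive polynomial with kernel \<open>g ` W\<close>, written as a relation on \<open>W\<close>. If \<open>f\<close> belongs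
  to \<open>X\<close>, then \<open>f\<^sup>p - f(b) ^ (p - 1) * f\<close> belongs to the group obtained by adjoining \<open>b\<close>.
\<close>

lemma frobenius_relation:
  fixes W :: "('a::{field,finite} ^ 'n) set"
  assumes W: "subspace_over prime_field W" and card: "card W = CHAR('a) ^ r" and g: "additive_map g"
  shows "\<exists>\<beta>. \<forall>w\<in>W. g w ^ (CHAR('a) ^ r) = (\<Sum>i<r. \<beta> i * g w ^ (CHAR('a) ^ i))"
proof -
  let ?p = "CHAR('a)"
  have p2: "?p \<ge> 2" by (rule prime_ge_2_nat[OF prime_CHAR_finite])
  have "\<forall>r. card W = ?p ^ r \<longrightarrow> (\<exists>\<beta>. \<forall>w\<in>W. g w ^ (?p ^ r) = (\<Sum>i<r. \<beta> i * g w ^ (?p ^ i)))"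
  proof (rule subspace_induct[OF is_subfield_prime_field subspace_over_zero_space W])
    show "{0} \<subseteq> W" using subspace_over_zero[OF W] by simp
    have r: "r = 0" if "card {0 :: 'a ^ 'n} = ?p ^ r" for r using that p2 by (cases r) auto
    show "\<forall>r. card {0 :: 'a ^ 'n} = ?p ^ r \<longrightarrow>
      (\<exists>\<beta>. \<forall>w\<in>{0}. g w ^ (?p ^ r) = (\<Sum>i<r. \<beta> i * g w ^ (?p ^ i)))"
    proof (intro allI impI)
      fix r assume "card {0 :: 'a ^ 'n} = ?p ^ r"
      hence "r = 0" by (rule r)
      thus "\<exists>\<beta>. \<forall>w\<in>{0}. g w ^ (?p ^ r) = (\<Sum>i<r. \<beta> i * g w ^ (?p ^ i))"
        by (simp add: additive_map_zero[OF g])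
    qed
  next
    fix X :: "('a ^ 'n) set" and b
    assume X: "subspace_over prime_field X" "b \<notin> X" and IH:
      "\<forall>r. card X = ?p ^ r \<longrightarrow> (\<exists>\<beta>. \<forall>w\<in>X. g w ^ (?p ^ r) = (\<Sum>i<r. \<beta> i * g w ^ (?p ^ i)))"
    show "\<forall>r. card (adjoin prime_field b X) = ?p ^ r \<longrightarrow>
      (\<exists>\<beta>. \<forall>w\<in>adjoin prime_field b X. g w ^ (?p ^ r) = (\<Sum>i<r. \<beta> i * g w ^ (?p ^ i)))"
    proof (intro allI impI)
      fix r assume c: "card (adjoin prime_field b X) = ?p ^ r"
      hence c': "?p * card X = ?p ^ r" using card_adjoin[OF is_subfield_prime_field X] unfolding card_prime_field by simp
      have "r \<noteq> 0"
      proof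
        assume "r = 0" hence "?p * card X = 1" using c' by simp
        thus False using p2 by simp
      qed
      then obtain s where r: "r = Suc s" by (cases r) auto
      have "card X = ?p ^ s" using c' p2 unfolding r by simp
      then obtain \<beta> where \<beta>: "\<And>w. w \<in> X \<Longrightarrow> g w ^ (?p ^ s) = (\<Sum>i<s. \<beta> i * g w ^ (?p ^ i))"
        using IH by blast
      (* the additive map that vanishes on X by the relation for X *)
      define f where "f = (\<lambda>x. g x ^ (?p ^ s) - (\<Sum>i<s. \<beta> i * g x ^ (?p ^ i)))"
      have f_add: "f (x + y) = f x + f y" for x y
      proof -
        have "g (x + y) = g x + g y" using g by (simp add: additive_map_def)
        thus ?thesis unfolding f_def by (simp add: frobenius_add distrib_left sum.distrib)
      qed
      hence fa: "additive_map f" by (simp add: additive_map_def)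
      define A where "A = f b ^ (?p - 1)"
      have fp: "f x ^ ?p = A * f x" if "x \<in> adjoin prime_field b X" for x
      proof -
        obtain w c where x: "x = w + c *s b" "w \<in> X" "c \<in> prime_field"
          using \<open>x \<in> adjoin prime_field b X\<close> unfolding adjoin_def by blast
        have "f w = 0" unfolding f_def using \<beta>[OF x(2)] by simp
        hence fx: "f x = c * f b" unfolding x(1) f_add using additive_map_prime_field[OF fa x(3)] by simp
        obtain m where m: "c = of_nat m" using x(3) unfolding prime_field_def by blast
        have "(of_nat m :: 'a) ^ ?p = of_nat m"
        proof (induction m)
          case (Suc m) thus ?case by (simp add: frobenius_CHAR)
        qed (use p2 in simp)
        hence "c ^ ?p = c" using m by simp
        moreover have "f b ^ ?p = A * f b" unfolding A_def using p2 by (metis Suc_1 Suc_leD le_add_diff_inverse2 power_Suc2 Suc_eq_plus1 One_nat_def)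
        ultimately show ?thesis unfolding fx power_mult_distrib by (simp add: mult_ac)
      qed
      have f_pow: "f x ^ ?p = g x ^ (?p ^ Suc s) - (\<Sum>i<s. \<beta> i ^ ?p * g x ^ (?p ^ Suc i))" for x
      proof -
        have "(f x + (\<Sum>i<s. \<beta> i * g x ^ (?p ^ i))) ^ ?p = f x ^ ?p + (\<Sum>i<s. \<beta> i * g x ^ (?p ^ i)) ^ ?p"
          by (rule frobenius_CHAR)
        moreover have "f x + (\<Sum>i<s. \<beta> i * g x ^ (?p ^ i)) = g x ^ (?p ^ s)" unfolding f_def by simp
        moreover have "(\<Sum>i<s. \<beta> i * g x ^ (?p ^ i)) ^ ?p = (\<Sum>i<s. (\<beta> i * g x ^ (?p ^ i)) ^ ?p)"
          by (rule freshmans_dream_sum[OF prime_CHAR_finite refl])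
        ultimately show ?thesis
          by (simp add: power_mult_distrib power_mult[symmetric] mult.commute eq_diff_eq)
      qed
      (* coefficients of the relation f\<^sup>p = A * f *)
      define \<gamma> where "\<gamma> = (\<lambda>i. (if i = 0 then 0 else \<beta> (i - 1) ^ ?p) + A * (if i = s then 1 else - \<beta> i))"
      have "g w ^ (?p ^ Suc s) = (\<Sum>i<Suc s. \<gamma> i * g w ^ (?p ^ i))" if w: "w \<in> adjoin prime_field b X" for w
      proof -
        have "(\<Sum>i<Suc s. \<gamma> i * g w ^ (?p ^ i)) = (\<Sum>i<Suc s. (if i = 0 then 0 else \<beta> (i - 1) ^ ?p) * g w ^ (?p ^ i))
          + A * (\<Sum>i<Suc s. (if i = s then 1 else - \<beta> i) * g w ^ (?p ^ i))"
          unfolding \<gamma>_def by (simp only: distrib_right sum.distrib sum_distrib_left mult.assoc)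
        also have "(\<Sum>i<Suc s. (if i = 0 then 0 else \<beta> (i - 1) ^ ?p) * g w ^ (?p ^ i)) = (\<Sum>i<s. \<beta> i ^ ?p * g w ^ (?p ^ Suc i))"
          unfolding sum.lessThan_Suc_shift by simp
        also have "(\<Sum>i<Suc s. (if i = s then 1 else - \<beta> i) * g w ^ (?p ^ i)) = f w"
          unfolding f_def sum.lessThan_Suc by (simp add: sum_negf)
        also have "A * f w = f w ^ ?p" using fp[OF w] ..
        finally show ?thesis unfolding f_pow by simp
      qed
      thus "\<exists>\<beta>. \<forall>w\<in>adjoin prime_field b X. g w ^ (?p ^ r) = (\<Sum>i<r. \<beta> i * g w ^ (?p ^ i))"
        unfolding r by blast
    qed
  qed
  thus ?thesis using card by blast
qed

text \<open>
  All coefficients \<open>\<beta> l\<close> with \<open>0 < l\<close> of the relation for \<open>g\<close> vanish. To isolate \<open>\<beta> l\<close>,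
  divide the relation by the power of \<open>g\<close> with exponent \<open>p ^ l\<close> and sum over the nonzero
  vectors. This leads to the sums \<open>N a l\<close> of \<open>g ^ (p ^ a - p ^ l)\<close>. For \<open>l < a\<close> such a sum
  is a power of a power sum with exponent \<open>p ^ (a - l) - 1\<close>, which vanishes by degree if
  \<open>a - l < r\<close>. For \<open>a < l\<close> one may add \<open>t\<close> to \<open>a\<close>, as \<open>g ^ q = g\<close>, and then the hypothesis
  on power sums applies. Only \<open>N l l = - 1\<close> survives. What remains of the relation is
  \<open>g ^ (p ^ r) = \<beta> 0 * g\<close>, and \<open>u\<close> shows that \<open>\<beta> 0 = 1\<close>.
\<close>

lemma power_sums_imp_frobenius_fixed:
  fixes W :: "('a::{field,finite} ^ 'n) set"
  assumes W: "subspace_over prime_field W" and card: "card W = CHAR('a) ^ r"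
    and g: "additive_map g" and inj: "\<And>w. w \<in> W \<Longrightarrow> g w = 0 \<Longrightarrow> w = 0"
    and q: "CARD('a) = CHAR('a) ^ t" and r: "0 < r" "r < t"
    and sums: "\<And>k. t - r < k \<Longrightarrow> k < t \<Longrightarrow> (\<Sum>w\<in>W. g w ^ (CHAR('a) ^ k - 1)) = 0"
    and u: "u \<in> W" "g u = 1" and w: "w \<in> W"
  shows "g w ^ (CHAR('a) ^ r) = g w"
proof -
  let ?p = "CHAR('a)"
  have p2: "?p \<ge> 2" by (rule prime_ge_2_nat[OF prime_CHAR_finite])
  have ppos: "?p ^ i > 0" for i using p2 by simp
  obtain \<beta> where \<beta>: "\<And>w. w \<in> W \<Longrightarrow> g w ^ (?p ^ r) = (\<Sum>i<r. \<beta> i * g w ^ (?p ^ i))"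
    using frobenius_relation[OF W card g] by blast
  define N where "N = (\<lambda>a l. \<Sum>w\<in>W - {0}. g w ^ (?p ^ a) / g w ^ (?p ^ l))"
  have g0: "g 0 = 0" by (rule additive_map_zero[OF g])
  have W0: "0 \<in> W" by (rule subspace_over_zero[OF W])
  have small: "(\<Sum>w\<in>W. g w ^ (?p ^ k - 1)) = 0" if "k < r" for k
  proof -
    have "low_degree (k * (?p - 1)) (\<lambda>w. g w ^ (?p ^ k - 1) * g w ^ 0)"
      using ppos[of k] by (intro low_degree_monomial[OF g g]) simp
    moreover have "k * (?p - 1) < r * (?p - 1)" using that p2 by simp
    ultimately show ?thesis using sum_low_degree[OF W card] by simp
  qed
  (* powers with exponent p ^ l are additive, so N a l is such a power of a power sum *)
  have N0: "N a l = 0" if al: "l < a" and s: "(\<Sum>w\<in>W. g w ^ (?p ^ (a - l) - 1)) = 0" for a l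
  proof -
    define k where "k = a - l"
    have k: "k > 0" "a = l + k" using al unfolding k_def by auto
    have "?p ^ k > 1" using p2 k(1) by (intro one_less_power) auto
    hence z: "(0 :: 'a) ^ (?p ^ k - 1) = 0" by simp
    have "N a l = (\<Sum>w\<in>W - {0}. (g w ^ (?p ^ k - 1)) ^ (?p ^ l))"
      unfolding N_def
    proof (rule sum.cong[OF refl])
      fix w assume "w \<in> W - {0}"
      hence nz: "g w \<noteq> 0" using inj by blast
      have "g w ^ (?p ^ a) = (g w ^ (?p ^ k)) ^ (?p ^ l)"
        unfolding k(2) power_add by (simp add: power_mult[symmetric] mult.commute)
      also have "g w ^ (?p ^ k) = g w ^ (?p ^ k - 1) * g w"
        by (rule power_minus_mult[OF ppos, symmetric])
      finally have "g w ^ (?p ^ a) = (g w ^ (?p ^ k - 1) * g w) ^ (?p ^ l)" .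
      thus "g w ^ (?p ^ a) / g w ^ (?p ^ l) = (g w ^ (?p ^ k - 1)) ^ (?p ^ l)"
        using nz by (simp add: power_mult_distrib)
    qed
    also have "\<dots> = (\<Sum>w\<in>W - {0}. g w ^ (?p ^ k - 1)) ^ (?p ^ l)"
      by (rule freshmans_dream_sum'[OF prime_CHAR_finite refl, symmetric])
    also have "(\<Sum>w\<in>W - {0}. g w ^ (?p ^ k - 1)) = (\<Sum>w\<in>W. g w ^ (?p ^ k - 1))"
    proof (rule sum.mono_neutral_left)
      show "\<forall>w\<in>W - (W - {0}). g w ^ (?p ^ k - 1) = 0"
      proof
        fix w assume "w \<in> W - (W - {0})"
        hence "w = 0" by blast
        thus "g w ^ (?p ^ k - 1) = 0" by (simp only: g0 z)
      qed
    qed auto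
    also have "\<dots> = 0" using s unfolding k_def .
    finally show ?thesis using ppos[of l] by simp
  qed
  have Nneg: "N l l = - 1" for l
  proof -
    have "N l l = (\<Sum>w\<in>W - {0}. 1)" unfolding N_def
      by (rule sum.cong[OF refl]) (use inj in auto)
    also have "\<dots> = of_nat (?p ^ r - 1)" using W0 card by (simp add: card_Diff_singleton)
    also have "\<dots> = - 1" using ppos[of r] r by (simp add: of_nat_diff)
    finally show ?thesis .
  qed
  have \<beta>0: "\<beta> l = 0" if l: "0 < l" "l < r" for l
  proof -
    have "(\<Sum>i<r. \<beta> i * N i l) = (\<Sum>w\<in>W - {0}. (\<Sum>i<r. \<beta> i * g w ^ (?p ^ i)) / g w ^ (?p ^ l))"
      unfolding N_def sum_distrib_left sum_divide_distrib by (subst sum.swap) simp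
    also have "\<dots> = N r l" unfolding N_def by (rule sum.cong[OF refl]) (use \<beta> in simp)
    also have "N r l = 0" by (rule N0) (use l small in auto)
    finally have sum0: "(\<Sum>i<r. \<beta> i * N i l) = 0" .
    have Nz: "N i l = 0" if i: "i < r" "i \<noteq> l" for i
    proof (cases "l < i")
      case True thus ?thesis by (rule N0) (use i small in auto)
    next
      case False
      (* raising to the power q is the identity *)
      have "N i l = N (i + t) l" unfolding N_def power_add q[symmetric]
        by (simp add: power_mult power_card_field mult.commute)
      also have "\<dots> = 0" by (rule N0, use l r in simp, rule sums) (use i l r False in auto)
      finally show ?thesis .
    qed
    have "(\<Sum>i<r. if i = l then \<beta> l * N l l else 0) = (\<Sum>i<r. \<beta> i * N i l)"
      by (rule sum.cong[OF refl]) (use Nz in auto)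
    hence "(\<Sum>i<r. if i = l then \<beta> l * N l l else 0) = 0" unfolding sum0 .
    thus ?thesis using l Nneg by simp
  qed
  have rel: "g w ^ (?p ^ r) = \<beta> 0 * g w" if "w \<in> W" for w
  proof -
    have "g w ^ (?p ^ r) = (\<Sum>i<r. if i = 0 then \<beta> 0 * g w else 0)"
      unfolding \<beta>[OF that] by (rule sum.cong[OF refl]) (use \<beta>0 in auto)
    thus ?thesis using r by simp
  qed
  have "\<beta> 0 = 1" using rel[OF u(1)] u(2) by simp
  thus ?thesis using rel[OF w] by simp
qed

section \<open>Additive subgroups of full size whose points all have large weight\<close>

lemma exists_dot_eq_1:
  fixes u :: "'a::field ^ 'n"
  assumes "u \<noteq> 0" shows "\<exists>\<zeta>. dot \<zeta> u = 1"
proof -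
  obtain i where i: "u $ i \<noteq> 0" using assms by (auto simp: vec_eq_iff)
  have "dot (inverse (u $ i) *s axis i 1) u = inverse (u $ i) * dot u (axis i 1)"
    unfolding dot_scale_left by (simp only: dot_commute)
  also have "\<dots> = 1" using i by (simp add: dot_axis)
  finally show ?thesis by blast
qed

text \<open>
  Each of the at most \<open>CARD('a) - 1\<close> other points is a zero of only one in \<open>CARD('a)\<close> of the
  forms that vanish at \<open>u\<close>.
\<close>

lemma exists_form_only_vanishing_on_point:
  fixes Y :: "('a::{field,finite} ^ 'n) set"
  assumes u: "u \<in> Y" "u \<noteq> 0" and N: "card (linear_set Y) \<le> CARD('a)"
  obtains \<phi> where "dot \<phi> u = 0" "\<And>y. y \<in> Y \<Longrightarrow> dot \<phi> y = 0 \<Longrightarrow> y \<in> vec.span {u}"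
proof -
  let ?R = "linear_set Y - {vec.span {u}}"
  let ?L = "vec.span {u}"
  note sL = subspace_over_span[of "{u}"]
  have pos: "card (perp ?L) > 0"
    using subspace_over_zero[OF subspace_over_perp, of ?L] by (auto simp: card_gt_0_iff)
  have cR: "card ?R < CARD('a)"
    using N linear_setI[OF u] by (metis card_Diff1_less finite order_less_le_trans)
  have each: "CARD('a) * card {\<phi> \<in> perp ?L. P \<subseteq> perp {\<phi>}} = card (perp ?L)" if P: "P \<in> ?R" for P
  proof -
    obtain y where y: "y \<in> Y" "y \<noteq> 0" "P = vec.span {y}" using P by (blast elim: linear_setE)
    have yL: "y \<notin> ?L" using span_singleton_eq[of y u] y P by blast
    have "{\<phi> \<in> perp ?L. P \<subseteq> perp {\<phi>}} = {\<phi> \<in> perp ?L. dot y \<phi> = 0}"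
      unfolding y(3) span_singleton_subset_iff[OF subspace_over_perp] by (simp add: perp_def)
    also have "\<dots> = perp (adjoin UNIV y ?L)" by (rule perp_adjoin[OF sL, symmetric])
    finally show ?thesis using card_perp_adjoin[OF sL yL] by simp
  qed
  have "\<exists>\<phi>\<in>perp ?L. \<forall>P\<in>?R. \<not> P \<subseteq> perp {\<phi>}"
  proof (rule ccontr)
    assume "\<not> ?thesis"
    hence "perp ?L \<subseteq> (\<Union>P\<in>?R. {\<phi> \<in> perp ?L. P \<subseteq> perp {\<phi>}})" by blast
    hence "card (perp ?L) \<le> card (\<Union>P\<in>?R. {\<phi> \<in> perp ?L. P \<subseteq> perp {\<phi>}})"
      by (rule card_mono[rotated]) simp
    also have "\<dots> \<le> (\<Sum>P\<in>?R. card {\<phi> \<in> perp ?L. P \<subseteq> perp {\<phi>}})" by (rule card_UN_le) simp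
    finally have "CARD('a) * card (perp ?L) \<le> CARD('a) * (\<Sum>P\<in>?R. card {\<phi> \<in> perp ?L. P \<subseteq> perp {\<phi>}})"
      by (rule mult_left_mono) simp
    also have "\<dots> = (\<Sum>P\<in>?R. card (perp ?L))" unfolding sum_distrib_left using each by (rule sum.cong[OF refl])
    also have "\<dots> = card ?R * card (perp ?L)" by simp
    also have "\<dots> < CARD('a) * card (perp ?L)" using cR pos by (rule mult_strict_right_mono)
    finally show False by simp
  qed
  then obtain \<phi> where \<phi>: "\<phi> \<in> perp ?L" "\<And>P. P \<in> ?R \<Longrightarrow> \<not> P \<subseteq> perp {\<phi>}" by blast
  show thesis
  proof (rule that[of \<phi>])
    show "dot \<phi> u = 0" using \<phi>(1) span_singleton_self unfolding perp_def by blast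
    fix y assume y: "y \<in> Y" "dot \<phi> y = 0"
    show "y \<in> ?L"
    proof (rule ccontr)
      assume n: "y \<notin> ?L"
      hence "y \<noteq> 0" by (auto simp: vec.span_zero)
      moreover have "vec.span {y} \<noteq> ?L" using n span_singleton_self by blast
      ultimately have "vec.span {y} \<in> ?R" using linear_setI[OF y(1)] by blast
      moreover have "vec.span {y} \<subseteq> perp {\<phi>}"
        unfolding span_singleton_subset_iff[OF subspace_over_perp] using y by (simp add: perp_def dot_commute)
      ultimately show False using \<phi>(2) by blast
    qed
  qed
qed

text \<open>
  The quotient of two linear forms is constant on points. With a denominator that vanishes
  at no other point than \<open>vec.span {u}\<close> there are thus fewer slopes than points.
\<close>

lemma few_points_power_sum:
  fixes Y :: "('a::{field,finite} ^ 'n) set"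
  assumes Y: "subspace_over prime_field Y" and card: "card Y = CHAR('a) ^ r"
    and u: "u \<in> Y" "u \<noteq> 0" and N: "card (linear_set Y) \<le> CARD('a)"
    and Nk: "card (linear_set Y) \<le> CHAR('a) ^ k" and k: "k < r"
  shows "(\<Sum>w\<in>Y \<inter> vec.span {u}. dot \<zeta> w ^ (CHAR('a) ^ k - 1)) = 0"
proof -
  obtain \<phi> where \<phi>: "dot \<phi> u = 0" "\<And>y. y \<in> Y \<Longrightarrow> dot \<phi> y = 0 \<Longrightarrow> y \<in> vec.span {u}"
    using exists_form_only_vanishing_on_point[OF u N] by blast
  have \<phi>span: "dot \<phi> y = 0" if "y \<in> vec.span {u}" for y
    using that \<phi>(1) unfolding mem_span_singleton by (auto simp: dot_scale_right)
  let ?T = "(\<lambda>w. dot \<zeta> w / dot \<phi> w) ` {w \<in> Y. dot \<phi> w \<noteq> 0}"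
  let ?R = "linear_set Y - {vec.span {u}}"
  (* the slope of a point, evaluated at an arbitrary nonzero vector of it *)
  define h where "h = (\<lambda>P :: ('a ^ 'n) set. let w = (SOME w. w \<in> P \<and> w \<noteq> 0) in dot \<zeta> w / dot \<phi> w)"
  have "?T \<subseteq> h ` ?R"
  proof
    fix c assume "c \<in> ?T"
    then obtain y where y: "y \<in> Y" "dot \<phi> y \<noteq> 0" "c = dot \<zeta> y / dot \<phi> y" by blast
    have y0: "y \<noteq> 0" using y(2) by auto
    have "y \<notin> vec.span {u}" using y(2) \<phi>span by blast
    hence "vec.span {y} \<noteq> vec.span {u}" using span_singleton_self by blast
    hence R: "vec.span {y} \<in> ?R" using linear_setI[OF y(1) y0] by blast
    define w where "w = (SOME w. w \<in> vec.span {y} \<and> w \<noteq> 0)"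
    have "w \<in> vec.span {y} \<and> w \<noteq> 0" unfolding w_def
      by (rule someI[of _ y]) (use y0 span_singleton_self in blast)
    then obtain a where a: "w = a *s y" "a \<noteq> 0" unfolding mem_span_singleton by auto
    have "h (vec.span {y}) = c" unfolding h_def w_def[symmetric] Let_def a(1) y(3) dot_scale_right using a(2) by simp
    thus "c \<in> h ` ?R" using R by blast
  qed
  hence "card ?T \<le> card (h ` ?R)" by (rule card_mono[rotated]) simp
  also have "\<dots> \<le> card ?R" by (rule card_image_le) simp
  also have "\<dots> < card (linear_set Y)" using linear_setI[OF u] by (rule card_Diff1_less[rotated]) simp
  finally have "card ?T < CHAR('a) ^ k" using Nk by simp
  from few_slopes_power_sum[OF Y card additive_map_dot additive_map_dot k this]
  have "(\<Sum>w\<in>{w \<in> Y. dot \<phi> w = 0}. dot \<zeta> w ^ (CHAR('a) ^ k - 1)) = 0" .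
  moreover have "{w \<in> Y. dot \<phi> w = 0} = Y \<inter> vec.span {u}" using \<phi>(2) \<phi>span by blast
  ultimately show ?thesis by simp
qed

lemma subfield_exponent:
  assumes K: "is_subfield (K :: 'a::{field,finite} set)"
  obtains h where "CARD('a) = card K ^ h" "h > 0"
proof -
  let ?v = "axis undefined 1 :: 'a ^ 1"
  have v: "?v \<noteq> 0" by (simp add: vec_eq_iff axis_def)
  obtain h where h: "card (vec.span {?v}) = card K ^ h"
    using card_subspace_over[OF K subspace_over_mono[OF subspace_over_span]] by blast
  have "h > 0" using h card_span_singleton[OF v] card_field_ge2[where 'a='a] by (cases h) auto
  thus thesis using that h card_span_singleton[OF v] by simp
qed

lemma frobenius_fixed_iterate:
  assumes "x \<in> frobenius_fixed d" shows "x ^ ((CHAR('a) ^ d) ^ h) = (x :: 'a::{field,finite})"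
  using assms unfolding frobenius_fixed_def by (induction h) (simp_all add: power_mult)

text \<open>
  Otherwise the power sum of \<open>\<zeta>\<close> over \<open>Y \<inter> vec.span {u}\<close> with exponent
  \<open>CARD('a) / CHAR('a) ^ d - 1\<close> vanishes because \<open>Y\<close> has few points. But \<open>\<zeta>\<close> maps this group
  into the field of order \<open>CHAR('a) ^ d\<close>, where this power of a nonzero element is \<open>1\<close>, so
  the sum is \<open>- 1\<close>.
\<close>

lemma many_points:
  fixes Y :: "('a::{field,finite} ^ 'n) set"
  assumes Y: "subspace_over prime_field Y" and cardY: "card Y = CARD('a)"
    and K: "card (frobenius_fixed d :: 'a set) = CHAR('a) ^ d" and d: "d > 0" and lt: "CHAR('a) ^ d < CARD('a)"
    and u: "u \<in> Y" "u \<noteq> 0" and wt: "card (Y \<inter> vec.span {u}) = CHAR('a) ^ d"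
    and \<zeta>: "\<And>w. w \<in> Y \<inter> vec.span {u} \<Longrightarrow> dot \<zeta> w \<in> frobenius_fixed d" "dot \<zeta> u = 1"
  shows "CARD('a) + CHAR('a) ^ d \<le> CHAR('a) ^ d * card (linear_set Y)"
proof -
  let ?p = "CHAR('a)"
  have p2: "?p \<ge> 2" by (rule prime_ge_2_nat[OF prime_CHAR_finite])
  obtain h where h: "CARD('a) = card (frobenius_fixed d :: 'a set) ^ h"
    using subfield_exponent[OF is_subfield_frobenius_fixed] by blast
  hence q: "CARD('a) = (?p ^ d) ^ h" unfolding K .
  have "h \<noteq> 0"
  proof
    assume "h = 0" thus False using q card_field_ge2[where 'a='a] by simp
  qed
  moreover have "h \<noteq> 1"
  proof
    assume "h = 1" thus False using q lt by simp
  qed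
  ultimately obtain h' where h': "h = Suc h'" "h' > 0" by (cases h) auto
  define k where "k = d * h'"
  have qk: "?p ^ k = (?p ^ d) ^ h'" unfolding k_def by (rule power_mult)
  have q': "CARD('a) = ?p ^ d * ?p ^ k" unfolding q h' qk by simp
  have kt: "k < d + k" using d by simp
  have "card (linear_set Y) > ?p ^ k"
  proof (rule ccontr)
    assume "\<not> ?thesis"
    hence N: "card (linear_set Y) \<le> ?p ^ k" by simp
    also have "?p ^ k \<le> CARD('a)" unfolding q' using p2 by simp
    finally have Nq: "card (linear_set Y) \<le> CARD('a)" .
    have cY: "card Y = ?p ^ (d + k)" unfolding cardY q' power_add ..
    have kpos: "?p ^ k > 1" using p2 d h'(2) unfolding k_def by (intro one_less_power) auto
    have "0 = (\<Sum>w\<in>Y \<inter> vec.span {u}. dot \<zeta> w ^ (?p ^ k - 1))"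
      using few_points_power_sum[OF Y cY u Nq N kt] by simp
    also have "\<dots> = (\<Sum>w\<in>Y \<inter> vec.span {u}. if w = 0 then 0 else 1)"
    proof (rule sum.cong[OF refl])
      fix w assume w: "w \<in> Y \<inter> vec.span {u}"
      show "dot \<zeta> w ^ (?p ^ k - 1) = (if w = 0 then 0 else 1)"
      proof (cases "w = 0")
        case False
        obtain a where a: "w = a *s u" using w mem_span_singleton[of w u] by blast
        hence nz: "dot \<zeta> w \<noteq> 0" using False \<zeta>(2) by (auto simp: dot_scale_right)
        have "dot \<zeta> w ^ (?p ^ k - 1) * dot \<zeta> w = dot \<zeta> w ^ (?p ^ k)"
          by (rule power_minus_mult) (use kpos in linarith)
        also have "\<dots> = dot \<zeta> w" unfolding qk by (rule frobenius_fixed_iterate[OF \<zeta>(1)[OF w]])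
        finally show ?thesis using nz False by simp
      qed (use kpos in simp)
    qed
    also have "\<dots> = of_nat (card (Y \<inter> vec.span {u} - {0}))"
    proof -
      have "Y \<inter> vec.span {u} \<inter> - {w. w = 0} = Y \<inter> vec.span {u} - {0}" by auto
      thus ?thesis by (simp add: sum.If_cases)
    qed
    also have "card (Y \<inter> vec.span {u} - {0}) = ?p ^ d - 1"
      using subspace_over_zero[OF Y] wt by (subst card_Diff_singleton) (auto simp: vec.span_zero)
    also have "of_nat (?p ^ d - 1) = (- 1 :: 'a)" using p2 d by (simp add: of_nat_diff)
    finally show False by simp
  qed
  hence "?p ^ d * (?p ^ k + 1) \<le> ?p ^ d * card (linear_set Y)" by (intro mult_left_mono) auto
  thus ?thesis unfolding q' by (simp add: algebra_simps)
qed

text \<open>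
  Points of weight at least \<open>c * M\<close> use up many vectors. A linear set with many points
  therefore has most of its vectors on points of weight \<open>M\<close>.
\<close>

lemma light_vectors_bound:
  fixes Y :: "('a::{field,finite} ^ 'n) set" and c M :: nat
  assumes Y: "subspace_over K Y" and M: "M \<ge> 1" and c: "c \<ge> 1"
    and wts: "\<And>P. P \<in> linear_set Y \<Longrightarrow> card (Y \<inter> P) = M \<or> c * M \<le> card (Y \<inter> P)"
  shows "(real M - 1) * ((real c * real M - 1) * real (card (linear_set Y)) - (real (card Y) - 1)) \<le>
    (real c - 1) * real M * real (card {y \<in> Y - {0}. card (Y \<inter> vec.span {y}) = M})"
proof -
  let ?A = "linear_set Y"
  let ?L = "{P \<in> ?A. card (Y \<inter> P) = M}"
  have cA: "card ?A = card ?L + card (?A - ?L)"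
    by (subst card_Un_disjoint[symmetric]) (auto intro: arg_cong[where f=card])
  have "{y \<in> Y - {0}. card (Y \<inter> vec.span {y}) = M} = {y \<in> Y - {0}. vec.span {y} \<in> ?L}"
    by (auto intro: linear_setI)
  hence "card {y \<in> Y - {0}. card (Y \<inter> vec.span {y}) = M} = (\<Sum>P\<in>?L. card (Y \<inter> P) - 1)"
    using card_vectors_on_points[OF Y, of ?L] by simp
  also have "\<dots> = (\<Sum>P\<in>?L. M - 1)" by (rule sum.cong) auto
  also have "\<dots> = card ?L * (M - 1)" by simp
  finally have G: "real (card {y \<in> Y - {0}. card (Y \<inter> vec.span {y}) = M}) = real (card ?L) * (real M - 1)"
    using M by (simp add: of_nat_diff)
  have Ypos: "card Y \<ge> 1" using subspace_over_zero[OF Y] by (simp add: Suc_le_eq card_gt_0_iff) blast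
  have cM: "c * M \<ge> 1" using c M by simp
  have "(\<Sum>P\<in>?L. card (Y \<inter> P) - 1) + (\<Sum>P\<in>?A - ?L. card (Y \<inter> P) - 1) = card Y - 1"
    unfolding sum_all_weights[OF Y, symmetric]
    by (subst sum.union_disjoint[symmetric]) (auto intro: sum.cong)
  moreover have "(\<Sum>P\<in>?L. card (Y \<inter> P) - 1) = card ?L * (M - 1)" by simp
  moreover have "card (?A - ?L) * (c * M - 1) \<le> (\<Sum>P\<in>?A - ?L. card (Y \<inter> P) - 1)"
  proof -
    have "(\<Sum>P\<in>?A - ?L. c * M - 1) \<le> (\<Sum>P\<in>?A - ?L. card (Y \<inter> P) - 1)"
    proof (rule sum_mono)
      fix P assume "P \<in> ?A - ?L"
      hence "c * M \<le> card (Y \<inter> P)" using wts by blast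
      thus "c * M - 1 \<le> card (Y \<inter> P) - 1" by simp
    qed
    thus ?thesis by simp
  qed
  ultimately have "card ?L * (M - 1) + card (?A - ?L) * (c * M - 1) \<le> card Y - 1" by linarith
  hence "real (card ?L * (M - 1) + card (?A - ?L) * (c * M - 1)) \<le> real (card Y - 1)"
    by (rule of_nat_mono)
  hence "real (card ?L) * (real M - 1) + real (card (?A - ?L)) * (real c * real M - 1) \<le> real (card Y) - 1"
    using M cM Ypos by (simp add: of_nat_diff)
  moreover have "real (card ?A) = real (card ?L) + real (card (?A - ?L))" using cA by simp
  ultimately have "(real c * real M - 1) * real (card ?A) - (real (card Y) - 1) \<le> (real c - 1) * real M * real (card ?L)"
    by (simp add: algebra_simps)
  from mult_left_mono[OF this, of "real M - 1"] M show ?thesis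
    unfolding G by (simp add: mult_ac)
qed

text \<open>
  Over the field of order \<open>M\<close> all weights are powers of \<open>M\<close>, so a point that does not have
  weight \<open>M\<close> has weight at least \<open>M * M\<close>. The lower bound for the number of points then
  leaves room for few vectors on such points.
\<close>

lemma heavy_vectors_bound:
  fixes Y :: "('a::{field,finite} ^ 'n) set"
  assumes Y: "subspace_over (frobenius_fixed d) Y" and cardY: "card Y = CARD('a)"
    and K: "card (frobenius_fixed d :: 'a set) = M" "M = CHAR('a) ^ d" and d: "d > 0" and lt: "M < CARD('a)"
    and u: "u \<in> Y" "u \<noteq> 0" and wt: "card (Y \<inter> vec.span {u}) = M"
  shows "real (card {y \<in> Y. y = 0 \<or> card (Y \<inter> vec.span {y}) \<noteq> M}) * real M ^ 2 + real M ^ 3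
    \<le> real CARD('a) + real M * real CARD('a)"
proof -
  let ?K = "frobenius_fixed d :: 'a set"
  have sK: "is_subfield ?K" by (rule is_subfield_frobenius_fixed)
  have M2: "M \<ge> 2" using card_subfield_ge2[OF sK] K by simp
  obtain \<zeta> where \<zeta>: "dot \<zeta> u = 1" using exists_dot_eq_1[OF u(2)] by blast
  have "inj (\<lambda>c. c *s u)" using u(2) by (auto simp: inj_def)
  hence "card ((\<lambda>c. c *s u) ` ?K) = M" using K by (metis card_image inj_on_subset subset_UNIV)
  moreover have "(\<lambda>c. c *s u) ` ?K \<subseteq> Y \<inter> vec.span {u}"
    using subspace_over_scale[OF Y] u(1) mem_span_singleton by blast
  ultimately have W: "(\<lambda>c. c *s u) ` ?K = Y \<inter> vec.span {u}"
    using wt by (intro card_subset_eq) auto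
  have "dot \<zeta> w \<in> ?K" if "w \<in> Y \<inter> vec.span {u}" for w
    using that \<zeta> unfolding W[symmetric] by (auto simp: dot_scale_right)
  hence N: "CARD('a) + M \<le> M * card (linear_set Y)"
    using many_points[OF subspace_over_prime_field[OF Y] cardY _ d _ u, of \<zeta>] K lt wt \<zeta> by simp
  have wts: "card (Y \<inter> P) = M \<or> M * M \<le> card (Y \<inter> P)" if P: "P \<in> linear_set Y" for P
  proof -
    have sub: "subspace_over ?K (Y \<inter> P)" using Y subspace_over_linear_set_point[OF P] by (rule subspace_over_Int)
    obtain r where r: "card (Y \<inter> P) = M ^ r" using card_subspace_over[OF sK sub] K by auto
    obtain y where y: "y \<in> Y" "y \<noteq> 0" "P = vec.span {y}" using P by (rule linear_setE)
    have "M dvd card (Y \<inter> P)" using card_dvd_subspace_over[OF sK sub, of y] y span_singleton_self K by auto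
    hence "r \<noteq> 0" using r M2 by (intro notI) simp
    show ?thesis
    proof (cases "r = 1")
      case False
      hence "2 \<le> r" using \<open>r \<noteq> 0\<close> by simp
      hence "M ^ 2 \<le> M ^ r" using M2 by (intro power_increasing) auto
      thus ?thesis using r by (simp add: power2_eq_square)
    qed (use r in simp)
  qed
  define G where "G = {y \<in> Y - {0}. card (Y \<inter> vec.span {y}) = M}"
  have bad: "{y \<in> Y. y = 0 \<or> card (Y \<inter> vec.span {y}) \<noteq> M} = Y - G" unfolding G_def by auto
  have cb: "real (card (Y - G)) = real CARD('a) - real (card G)"
    using cardY card_mono[of Y G] unfolding G_def
    by (subst card_Diff_subset) (auto simp: of_nat_diff)
  have "(real M - 1) * ((real M * real M - 1) * real (card (linear_set Y)) - (real CARD('a) - 1))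
    \<le> (real M - 1) * (real M * real (card G))"
    using light_vectors_bound[OF Y _ _ wts] M2 cardY unfolding G_def by (simp add: mult_ac)
  hence "(real M * real M - 1) * real (card (linear_set Y)) - (real CARD('a) - 1) \<le> real M * real (card G)"
    using M2 by simp
  hence "real M * ((real M * real M - 1) * real (card (linear_set Y)) - (real CARD('a) - 1)) \<le> real M * (real M * real (card G))"
    by (intro mult_left_mono) auto
  hence 1: "(real M * real M - 1) * (real M * real (card (linear_set Y))) - real M * (real CARD('a) - 1) \<le> real M ^ 2 * real (card G)"
    by (simp add: algebra_simps power2_eq_square)
  have "real (CARD('a) + M) \<le> real (M * card (linear_set Y))" using N by (rule of_nat_mono)
  moreover have "real M * real M \<ge> 2 * 2" using M2 by (intro mult_mono) auto
  ultimately have "(real M * real M - 1) * (real CARD('a) + real M) \<le> (real M * real M - 1) * (real M * real (card (linear_set Y)))"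
    by (intro mult_left_mono) auto
  hence "(real M * real M - 1) * (real CARD('a) + real M) - real M * (real CARD('a) - 1) \<le> real M ^ 2 * real (card G)"
    using 1 by linarith
  thus ?thesis unfolding bad cb by (simp add: algebra_simps power2_eq_square power3_eq_cube)
qed

text \<open>
  The source of all subfields in the proof. Let \<open>M = CHAR('a) ^ d\<close> be the least weight. Then
  \<open>Y\<close> has about \<open>CARD('a) / M\<close> points at most, so the power sums over \<open>Y \<inter> vec.span {y}\<close>
  vanish, and if \<open>y\<close> has weight \<open>M\<close>, the coordinates of this group with respect to \<open>y\<close> form
  the field of order \<open>M\<close>. Hence \<open>Y\<close> contains the multiples of \<open>y\<close> by this field. More than
  half of the vectors of \<open>Y\<close> lie on such points, so every vector of \<open>Y\<close> is a sum of two of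
  them.
\<close>

theorem large_weights_imp_subfield:
  fixes Y :: "('a::{field,finite} ^ 'n) set"
  assumes Y: "subspace_over prime_field Y" and cardY: "card Y = CARD('a)"
    and e: "CHAR('a) ^ e \<ge> 4" and wts: "\<And>y. y \<in> Y \<Longrightarrow> y \<noteq> 0 \<Longrightarrow> CHAR('a) ^ e \<le> card (Y \<inter> vec.span {y})"
  obtains d where "d \<ge> e" "card (frobenius_fixed d :: 'a set) = CHAR('a) ^ d"
    "subspace_over (frobenius_fixed d) Y"
    "\<And>y. y \<in> Y \<Longrightarrow> y \<noteq> 0 \<Longrightarrow> CHAR('a) ^ d \<le> card (Y \<inter> vec.span {y})"
    "\<exists>y\<in>Y. y \<noteq> 0 \<and> card (Y \<inter> vec.span {y}) = CHAR('a) ^ d"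
proof -
  let ?p = "CHAR('a)"
  let ?wt = "\<lambda>y. card (Y \<inter> vec.span {y})"
  have p2: "?p \<ge> 2" by (rule prime_ge_2_nat[OF prime_CHAR_finite])
  hence p1: "1 < ?p" by simp
  have "Y - {0} \<noteq> {}"
  proof
    assume "Y - {0} = {}"
    hence "card Y \<le> card {0 :: 'a ^ 'n}" by (intro card_mono) auto
    thus False using cardY card_field_ge2[where 'a='a] by simp
  qed
  then obtain u where u: "u \<in> Y - {0}" "\<And>y. y \<in> Y - {0} \<Longrightarrow> ?wt u \<le> ?wt y"
    using ex_has_least_nat[of "\<lambda>y. y \<in> Y - {0}" _ ?wt] by blast
  have sW: "subspace_over prime_field (Y \<inter> vec.span {y})" for y
    by (rule subspace_over_Int[OF Y subspace_over_mono[OF subspace_over_span subset_UNIV]])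
  obtain d where d: "?wt u = ?p ^ d" using card_subgroup[OF sW] by blast
  have "?p ^ e \<le> ?p ^ d" using wts[of u] u(1) d by auto
  hence de: "d \<ge> e" by (rule power_le_imp_le_exp[OF p1])
  have "e > 0" using e by (intro gr0I) simp
  hence d0: "d > 0" using de by simp
  define M where "M = ?p ^ d"
  have M4: "M \<ge> 4" using e power_increasing[OF de, of ?p] p2 unfolding M_def by linarith
  obtain t where t: "card Y = ?p ^ t" using card_subgroup[OF Y] by blast
  have qt: "CARD('a) = ?p ^ t" using t cardY by simp
  have "?p ^ d \<le> ?p ^ t" using d t card_mono[of Y "Y \<inter> vec.span {u}"] by simp
  hence dt: "d \<le> t" by (rule power_le_imp_le_exp[OF p1])
  have "card (frobenius_fixed d :: 'a set) = ?p ^ d \<and> subspace_over (frobenius_fixed d) Y"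
  proof (cases "d = t")
    case True
    have ff: "frobenius_fixed d = (UNIV :: 'a set)"
      unfolding frobenius_fixed_def True qt[symmetric] using power_card_field by auto
    have "Y \<inter> vec.span {u} = Y" using d t True by (intro card_subset_eq) auto
    hence "Y \<subseteq> vec.span {u}" by blast
    hence "Y = vec.span {u}"
      using cardY card_span_singleton[of u] u(1) by (intro card_subset_eq) auto
    thus ?thesis unfolding ff using subspace_over_span qt True by simp
  next
    case False
    hence lt: "d < t" using dt by simp
    let ?N = "card (linear_set Y)"
    have "(\<Sum>P\<in>linear_set Y. M - 1) \<le> (\<Sum>P\<in>linear_set Y. card (Y \<inter> P) - 1)"
    proof (rule sum_mono)
      fix P assume "P \<in> linear_set Y"
      then obtain y where "y \<in> Y - {0}" "P = vec.span {y}" by (blast elim: linear_setE)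
      hence "M \<le> card (Y \<inter> P)" using u(2) d unfolding M_def by metis
      thus "M - 1 \<le> card (Y \<inter> P) - 1" by simp
    qed
    hence NM: "?N * (M - 1) \<le> CARD('a) - 1" unfolding sum_all_weights[OF Y] cardY by simp
    have "?N * 1 \<le> ?N * (M - 1)" using M4 by (intro mult_left_mono) auto
    hence Nq: "?N \<le> CARD('a)" using NM by linarith
    have Nk: "?N \<le> ?p ^ k" if k: "t - d < k" for k
    proof -
      have "?N * M \<le> 2 * (?N * (M - 1))" using M4 by (cases M) (auto simp: algebra_simps)
      also have "\<dots> \<le> 2 * CARD('a)" using NM by linarith
      also have "CARD('a) = ?p ^ (t - d) * M" unfolding M_def qt using dt by (simp flip: power_add)
      finally have "?N * M \<le> (2 * ?p ^ (t - d)) * M" by simp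
      hence "?N \<le> 2 * ?p ^ (t - d)" using M4 by simp
      also have "\<dots> \<le> ?p ^ Suc (t - d)" using p2 by simp
      also have "\<dots> \<le> ?p ^ k" using k p2 by (intro power_increasing) auto
      finally show ?thesis .
    qed
    (* for t - d < k the number of points of Y is at most p ^ k, so that the power sums
       vanish *)
    have key: "dot \<zeta> w \<in> frobenius_fixed d"
      if y: "y \<in> Y" "y \<noteq> 0" "?wt y = M" and \<zeta>: "dot \<zeta> y = 1" and w: "w \<in> Y \<inter> vec.span {y}" for y \<zeta> w
      unfolding frobenius_fixed_def mem_Collect_eq
    proof (rule power_sums_imp_frobenius_fixed[OF sW _ additive_map_dot _ qt d0 lt _ _ \<zeta> w])
      show "?wt y = ?p ^ d" using y(3) M_def by simp
      show "y \<in> Y \<inter> vec.span {y}" using y(1) span_singleton_self by blast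
      show "x = 0" if "x \<in> Y \<inter> vec.span {y}" "dot \<zeta> x = 0" for x
        using that mem_span_singleton[of x y] \<zeta> by (auto simp: dot_scale_right)
      show "(\<Sum>w\<in>Y \<inter> vec.span {y}. dot \<zeta> w ^ (?p ^ k - 1)) = 0" if "t - d < k" "k < t" for k
        by (rule few_points_power_sum[OF Y t y(1,2) Nq Nk[OF that(1)] that(2)])
    qed
    have closed: "card (frobenius_fixed d :: 'a set) = M \<and> (\<forall>\<kappa>\<in>frobenius_fixed d. \<kappa> *s y \<in> Y)"
      if y: "y \<in> Y" "y \<noteq> 0" "?wt y = M" for y
    proof -
      obtain \<zeta> where \<zeta>: "dot \<zeta> y = 1" using exists_dot_eq_1[OF y(2)] by blast
      let ?W = "Y \<inter> vec.span {y}"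
      have rep: "w = dot \<zeta> w *s y" if "w \<in> ?W" for w
        using that mem_span_singleton[of w y] \<zeta> by (auto simp: dot_scale_right)
      have "inj_on (dot \<zeta>) ?W" using rep by (metis inj_onI)
      hence c: "card (dot \<zeta> ` ?W) = M" using y(3) by (simp add: card_image)
      have sub: "dot \<zeta> ` ?W \<subseteq> frobenius_fixed d" using key[OF y \<zeta>] by blast
      have "card (frobenius_fixed d :: 'a set) \<le> M" using card_frobenius_fixed_le[of d] d0 unfolding M_def by simp
      moreover have "M \<le> card (frobenius_fixed d :: 'a set)" using card_mono[OF _ sub] c by simp
      ultimately have cf: "card (frobenius_fixed d :: 'a set) = M" by simp
      have eq: "dot \<zeta> ` ?W = frobenius_fixed d" using sub c cf by (intro card_subset_eq) auto
      have "\<kappa> *s y \<in> Y" if \<kappa>: "\<kappa> \<in> frobenius_fixed d" for \<kappa>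
      proof -
        obtain w where w: "w \<in> ?W" "\<kappa> = dot \<zeta> w" using \<kappa> unfolding eq[symmetric] by blast
        thus ?thesis using rep[OF w(1)] by auto
      qed
      thus ?thesis using cf by blast
    qed
    have wu: "u \<in> Y" "u \<noteq> 0" "?wt u = M" using u(1) d M_def by auto
    have cf: "card (frobenius_fixed d :: 'a set) = ?p ^ d" using closed[OF wu] M_def by simp
    obtain \<zeta> where \<zeta>: "dot \<zeta> u = 1" using exists_dot_eq_1[OF wu(2)] by blast
    have "?p ^ d < CARD('a)" unfolding qt using lt p2 by (intro power_strict_increasing) auto
    hence N: "CARD('a) + M \<le> M * ?N"
      using many_points[OF Y cardY cf d0 _ wu(1,2), of \<zeta>] wu(3) key[OF wu \<zeta>] \<zeta> unfolding M_def by simp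
    have wts2: "card (Y \<inter> P) = M \<or> 2 * M \<le> card (Y \<inter> P)" if P: "P \<in> linear_set Y" for P
    proof -
      obtain y where y: "y \<in> Y - {0}" "P = vec.span {y}" using P by (blast elim: linear_setE)
      obtain i where i: "card (Y \<inter> P) = ?p ^ i" using card_subgroup[OF sW] y(2) by blast
      have "?p ^ d \<le> ?p ^ i" using u(2)[OF y(1)] d i y(2) by simp
      hence "d \<le> i" by (rule power_le_imp_le_exp[OF p1])
      show ?thesis
      proof (cases "i = d")
        case False
        hence "Suc d \<le> i" using \<open>d \<le> i\<close> by simp
        hence "?p ^ Suc d \<le> ?p ^ i" using p2 by (intro power_increasing) auto
        moreover have "2 * M \<le> ?p ^ Suc d" unfolding M_def using p2 by simp
        ultimately show ?thesis using i by linarith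
      qed (use i M_def in simp)
    qed
    define G where "G = {y \<in> Y - {0}. ?wt y = M}"
    have "(real M - 1) * ((2 * real M - 1) * real ?N - (real CARD('a) - 1)) \<le> real M * real (card G)"
      using light_vectors_bound[OF Y _ _ wts2] M4 cardY unfolding G_def by simp
    hence "real M * ((real M - 1) * ((2 * real M - 1) * real ?N - (real CARD('a) - 1))) \<le> real M * (real M * real (card G))"
      by (intro mult_left_mono) auto
    hence 1: "(real M - 1) * ((2 * real M - 1) * (real M * real ?N) - real M * (real CARD('a) - 1)) \<le> real M ^ 2 * real (card G)"
      by (simp add: algebra_simps power2_eq_square)
    have "real (CARD('a) + M) \<le> real (M * ?N)" using N by (rule of_nat_mono)
    hence "(2 * real M - 1) * (real CARD('a) + real M) \<le> (2 * real M - 1) * (real M * real ?N)"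
      using M4 by (intro mult_left_mono) auto
    hence "(real M - 1) * ((2 * real M - 1) * (real CARD('a) + real M) - real M * (real CARD('a) - 1))
      \<le> (real M - 1) * ((2 * real M - 1) * (real M * real ?N) - real M * (real CARD('a) - 1))"
      using M4 by (intro mult_left_mono) auto
    also note 1
    also have "(real M - 1) * ((2 * real M - 1) * (real CARD('a) + real M) - real M * (real CARD('a) - 1))
      = (real M - 1)\<^sup>2 * real CARD('a) + (real M - 1) * (2 * real M ^ 2)"
      by (simp add: algebra_simps power2_eq_square power3_eq_cube)
    finally have 2: "(real M - 1)\<^sup>2 * real CARD('a) + (real M - 1) * (2 * real M ^ 2) \<le> real M ^ 2 * real (card G)" .
    have "(real M - 2) * (real M - 2) \<ge> 2 * 2" using M4 by (intro mult_mono) auto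
    hence "2 * (real M - 1)\<^sup>2 \<ge> real M ^ 2" by (simp add: algebra_simps power2_eq_square)
    hence "2 * (real M - 1)\<^sup>2 * real CARD('a) \<ge> real M ^ 2 * real CARD('a)" by (intro mult_right_mono) auto
    moreover have "(real M - 1) * (2 * real M ^ 2) > 0" using M4 by (intro mult_pos_pos) auto
    ultimately have "real M ^ 2 * real CARD('a) < real M ^ 2 * (2 * real (card G))" using 2 by linarith
    hence "real CARD('a) < 2 * real (card G)" using M4 by simp
    hence big: "CARD('a) < 2 * card G" by linarith
    have GY: "G \<subseteq> Y" unfolding G_def by blast
    have "subspace_over (frobenius_fixed d) Y"
      unfolding subspace_over_def
    proof (intro conjI ballI)
      show "0 \<in> Y" by (rule subspace_over_zero[OF Y])
      show "x + y \<in> Y" if "x \<in> Y" "y \<in> Y" for x y by (rule subspace_over_add[OF Y that])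
      fix \<kappa> :: 'a and y assume \<kappa>: "\<kappa> \<in> frobenius_fixed d" and y: "y \<in> Y"
      (* two subsets of Y with more than half of its elements meet *)
      have "G \<inter> (\<lambda>x. y - x) ` G \<noteq> {}"
      proof
        assume dis: "G \<inter> (\<lambda>x. y - x) ` G = {}"
        have "card ((\<lambda>x. y - x) ` G) = card G" by (rule card_image) (simp add: inj_on_def)
        hence "2 * card G = card (G \<union> (\<lambda>x. y - x) ` G)" using dis by (subst card_Un_disjoint) auto
        also have "\<dots> \<le> card Y"
          using GY subspace_over_diff[OF Y y] by (intro card_mono) auto
        finally show False using big cardY by simp
      qed
      then obtain x where x: "x \<in> G" "y - x \<in> G" by auto
      have "\<kappa> *s x \<in> Y" "\<kappa> *s (y - x) \<in> Y" using closed x \<kappa> unfolding G_def by auto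
      hence "\<kappa> *s x + \<kappa> *s (y - x) \<in> Y" by (rule subspace_over_add[OF Y])
      thus "\<kappa> *s y \<in> Y" by (simp add: vec.scale_right_diff_distrib)
    qed
    thus ?thesis using cf by blast
  qed
  thus thesis using that[of d] de u d by auto
qed

section \<open>Blocking sets and linear forms\<close>

lemma blocking_common_zeros:
  fixes B :: "('a::{field,finite} ^ 'n) set set"
  assumes B: "blocking_set k B" and k: "k < CARD('n)"
  shows "points_in B (common_zeros f k) \<noteq> {}"
proof -
  have "CARD('a) ^ k * CARD('a) ^ (CARD('n) - k) \<le> CARD('a) ^ k * card (common_zeros f k)"
    using card_common_zeros[of k f] k by (simp flip: power_add)
  hence "CARD('a) ^ (CARD('n) - k) \<le> card (common_zeros f k)" by simp
  then obtain W where W: "subspace_over UNIV W" "W \<subseteq> common_zeros f k" "card W = CARD('a) ^ (CARD('n) - k)"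
    using intermediate_subspace[OF is_subfield_UNIV subspace_over_zero_space subspace_over_common_zeros[where f=f and j=k], of "CARD('n) - k"]
      subspace_over_zero[OF subspace_over_common_zeros] by auto
  have "CARD('n) - 1 - k + 1 = CARD('n) - k" using k by simp
  hence "proj_subspace (CARD('n) - 1 - k) W" unfolding proj_subspace_iff using W by simp
  hence "points_in B W \<noteq> {}" using B unfolding blocking_set_def by blast
  thus ?thesis using points_in_mono[OF W(2)] by blast
qed

lemma card_blocking_set_ge:
  fixes B :: "('a::{field,finite} ^ 'n) set set"
  assumes B: "blocking_set k B" and k: "k < CARD('n)"
  shows "CARD('a) ^ k \<le> card B"
proof -
  have S: "B \<subseteq> proj_points" using B unfolding blocking_set_def by blast
  have "1 \<le> card (points_in B (common_zeros f k))" for f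
    using blocking_common_zeros[OF assms, of f] by (simp add: Suc_le_eq card_gt_0_iff)
  from all_many_points[OF subspace_over_zero_space S this]
  show ?thesis using points_in_zero[OF S] by simp
qed

lemma hyperplane_eq_common_zeros:
  fixes W :: "('a::{field,finite} ^ 'n) set"
  assumes W: "subspace_over UNIV W" and card: "CARD('a) * card W = CARD('a) ^ CARD('n)"
  obtains f where "W = common_zeros f 1"
proof -
  have W0: "card W > 0" using subspace_over_zero[OF W] by (auto simp: card_gt_0_iff)
  have "card (perp W) = CARD('a)" using card_perp[OF W] card W0 by (metis mult_cancel2 less_numeral_extra(3))
  hence "\<not> perp W \<subseteq> {0}"
    using card_mono[of "{0}" "perp W"] card_field_ge2[where 'a='a] by (intro notI) simp
  then obtain \<phi> where \<phi>: "\<phi> \<in> perp W" "\<phi> \<noteq> 0" by blast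
  have sub: "W \<subseteq> common_zeros (\<lambda>_. \<phi>) 1" using \<phi>(1) unfolding perp_def common_zeros_def by auto
  have "common_zeros (\<lambda>_. \<phi>) 1 = perp (vec.span {\<phi>})"
    unfolding common_zeros_def perp_def vec.span_singleton by (auto simp: dot_scale_right dot_commute)
  hence "card (common_zeros (\<lambda>_. \<phi>) 1) * CARD('a) = CARD('a) * card W"
    using card_perp[OF subspace_over_span, of "{\<phi>}"] card_span_singleton[OF \<phi>(2)] card by simp
  hence "card (common_zeros (\<lambda>_. \<phi>) 1) = card W" by simp
  hence "W = common_zeros (\<lambda>_. \<phi>) 1" using sub by (intro card_subset_eq) auto
  thus thesis by (rule that)
qed

text \<open>
  The sums \<open>u + w\<close> with \<open>u \<in> U\<close> and \<open>w \<in> W\<close> cannot all be distinct, as there are more pairs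
  than vectors.
\<close>

lemma linear_set_blocks:
  fixes U :: "('a::{field,finite} ^ 'n) set"
  assumes U: "subspace_over K U" and card: "CARD('a) ^ k < card U" and k: "k < CARD('n)"
  shows "blocking_set k (linear_set U)"
  unfolding blocking_set_def
proof (intro conjI allI impI linear_set_proj_points)
  fix W :: "('a ^ 'n) set" assume "proj_subspace (CARD('n) - 1 - k) W"
  moreover have "CARD('n) - 1 - k + 1 = CARD('n) - k" using k by simp
  ultimately have W: "subspace_over UNIV W" "card W = CARD('a) ^ (CARD('n) - k)"
    unfolding proj_subspace_iff by metis+
  have "\<not> inj_on (\<lambda>(u, w). u + w) (U \<times> W)"
  proof
    assume "inj_on (\<lambda>(u, w). u + w) (U \<times> W)"
    from card_image[OF this] have "card U * card W = card ((\<lambda>(u, w). u + w) ` (U \<times> W))"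
      by (simp add: card_cartesian_product)
    also have "\<dots> \<le> CARD('a ^ 'n)" by (rule card_mono) auto
    finally have "card U * card W \<le> CARD('a) ^ CARD('n)" by simp
    moreover have "CARD('a) ^ k * card W < card U * card W" using card W(2) by simp
    moreover have "CARD('a) ^ k * card W = CARD('a) ^ CARD('n)" unfolding W(2) using k by (simp flip: power_add)
    ultimately show False by simp
  qed
  then obtain u w u' w' where uw: "u \<in> U" "w \<in> W" "u' \<in> U" "w' \<in> W" "u + w = u' + w'" "(u, w) \<noteq> (u', w')"
    unfolding inj_on_def by auto
  have eq: "u - u' = w' - w" using uw(5) by (simp add: algebra_simps)
  have "u - u' \<noteq> 0" using uw(5,6) by auto
  moreover have "u - u' \<in> U" using subspace_over_diff[OF U] uw by blast
  moreover have "u - u' \<in> W" unfolding eq using subspace_over_diff[OF W(1)] uw by blast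
  ultimately have "vec.span {u - u'} \<in> points_in (linear_set U) W"
    unfolding points_in_def using linear_setI span_singleton_subset_iff[OF W(1)] by blast
  thus "points_in (linear_set U) W \<noteq> {}" by blast
qed

lemma minimal_blocking_setD:
  assumes "minimal_blocking_set k B" "C \<subseteq> B" "blocking_set k C" shows "C = B"
  using assms unfolding minimal_blocking_set_def by blast

section \<open>Projection from a point\<close>

text \<open>
  If \<open>dot \<theta> v = 1\<close>, this is the projection from the point of \<open>v\<close> onto the hyperplane of \<open>\<theta>\<close>.
  Lines through the point of \<open>v\<close> become points, and their weights are divided by the weight
  of that point.
\<close>

definition project :: "'a::field ^ 'n \<Rightarrow> 'a ^ 'n \<Rightarrow> 'a ^ 'n \<Rightarrow> 'a ^ 'n" where
  "project \<theta> v x = x - dot \<theta> x *s v"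

lemma project_add: "project \<theta> v (x + y) = project \<theta> v x + project \<theta> v y"
  and project_scale: "project \<theta> v (c *s x) = c *s project \<theta> v x"
  by (simp_all add: project_def dot_add_right dot_scale_right vec.scale_left_distrib vec.scale_right_diff_distrib)

lemma project_eq_0_iff:
  assumes "dot \<theta> v = 1" shows "project \<theta> v x = 0 \<longleftrightarrow> x \<in> vec.span {v}"
  using assms unfolding project_def mem_span_singleton by (auto simp: dot_scale_right)

lemma project_diff: "project \<theta> v (x - y) = project \<theta> v x - project \<theta> v y"
  using project_add[of \<theta> v "x - y" y] by (simp add: algebra_simps)

context
  fixes U :: "('a::{field,finite} ^ 'n) set" and K and \<theta> v :: "'a ^ 'n"
  assumes U: "subspace_over K U" and \<theta>: "dot \<theta> v = 1"
begin

lemma subspace_over_project: "subspace_over K (project \<theta> v ` U)"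
  unfolding subspace_over_def
proof (intro conjI ballI)
  have "project \<theta> v 0 = 0" by (simp add: project_def)
  thus "0 \<in> project \<theta> v ` U" using subspace_over_zero[OF U] by (metis image_eqI)
  show "x + y \<in> project \<theta> v ` U" if "x \<in> project \<theta> v ` U" "y \<in> project \<theta> v ` U" for x y
    using that subspace_over_add[OF U] by (auto simp flip: project_add)
  show "c *s x \<in> project \<theta> v ` U" if "c \<in> K" "x \<in> project \<theta> v ` U" for c x
    using that subspace_over_scale[OF U] by (auto simp flip: project_scale)
qed

lemma card_project: "card U = card (project \<theta> v ` U) * card (U \<inter> vec.span {v})"
proof -
  have "card U = card (project \<theta> v ` U) * card {x \<in> U. project \<theta> v x = 0}"
    by (rule card_hom[OF U project_add])
  also have "{x \<in> U. project \<theta> v x = 0} = U \<inter> vec.span {v}" using project_eq_0_iff[OF \<theta>] by blast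
  finally show ?thesis .
qed

lemma card_project_line:
  assumes u: "u \<in> U"
  shows "card (U \<inter> vec.span {v, u}) =
    card (project \<theta> v ` U \<inter> vec.span {project \<theta> v u}) * card (U \<inter> vec.span {v})"
proof -
  let ?X = "U \<inter> vec.span {v, u}"
  have X: "subspace_over K ?X" by (rule subspace_over_Int[OF U subspace_over_mono[OF subspace_over_span subset_UNIV]])
  have v0: "project \<theta> v v = 0" using project_eq_0_iff[OF \<theta>] span_singleton_self by blast
  have "project \<theta> v ` ?X = project \<theta> v ` U \<inter> vec.span {project \<theta> v u}"
  proof (intro equalityI subsetI)
    fix y assume "y \<in> project \<theta> v ` ?X"
    then obtain x where x: "x \<in> U" "x \<in> vec.span {v, u}" "y = project \<theta> v x" by blast
    then obtain a b where "x = a *s v + b *s u" unfolding mem_span_pair by blast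
    hence "y = b *s project \<theta> v u" unfolding x(3) by (simp add: project_add project_scale v0)
    thus "y \<in> project \<theta> v ` U \<inter> vec.span {project \<theta> v u}" using x mem_span_singleton by blast
  next
    fix y assume y: "y \<in> project \<theta> v ` U \<inter> vec.span {project \<theta> v u}"
    then obtain x where x: "x \<in> U" "y = project \<theta> v x" by blast
    obtain b where b: "y = b *s project \<theta> v u" using y mem_span_singleton by blast
    have "project \<theta> v (x - b *s u) = 0" using x b by (simp add: project_diff project_scale)
    then obtain a where "x - b *s u = a *s v" unfolding project_eq_0_iff[OF \<theta>] mem_span_singleton by blast
    hence "x = a *s v + b *s u" by (simp add: diff_eq_eq)
    hence "x \<in> vec.span {v, u}" unfolding mem_span_pair by blast
    thus "y \<in> project \<theta> v ` ?X" using x by blast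
  qed
  moreover have "{x \<in> ?X. project \<theta> v x = 0} = U \<inter> vec.span {v}"
  proof -
    have "vec.span {v} \<subseteq> vec.span {v, u}" by (rule vec.span_mono) simp
    thus ?thesis using project_eq_0_iff[OF \<theta>] by blast
  qed
  ultimately show ?thesis using card_hom[OF X, of "project \<theta> v"] by (simp add: project_add)
qed

lemma card_project_preimage_le:
  "card {u \<in> U. project \<theta> v u \<in> Z} \<le> card (project \<theta> v ` U \<inter> Z) * card (U \<inter> vec.span {v})"
proof -
  let ?Y = "project \<theta> v ` U \<inter> Z"
  have "{u \<in> U. project \<theta> v u \<in> Z} = (\<Union>z\<in>?Y. {u \<in> U. project \<theta> v u = z})" by auto
  hence "card {u \<in> U. project \<theta> v u \<in> Z} \<le> (\<Sum>z\<in>?Y. card {u \<in> U. project \<theta> v u = z})"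
    using card_UN_le[of ?Y "\<lambda>z. {u \<in> U. project \<theta> v u = z}"] by simp
  also have "\<dots> \<le> (\<Sum>z\<in>?Y. card (U \<inter> vec.span {v}))"
  proof (rule sum_mono)
    fix z assume "z \<in> ?Y"
    then obtain a where a: "a \<in> U" "z = project \<theta> v a" by blast
    have "(\<lambda>u. u - a) ` {u \<in> U. project \<theta> v u = z} \<subseteq> U \<inter> vec.span {v}"
      using a subspace_over_diff[OF U] project_eq_0_iff[OF \<theta>] by (auto simp: project_diff simp flip: project_eq_0_iff[OF \<theta>])
    hence "card ((\<lambda>u. u - a) ` {u \<in> U. project \<theta> v u = z}) \<le> card (U \<inter> vec.span {v})"
      by (rule card_mono[rotated]) simp
    thus "card {u \<in> U. project \<theta> v u = z} \<le> card (U \<inter> vec.span {v})"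
      by (subst (asm) card_image) (simp_all add: inj_on_def)
  qed
  finally show ?thesis by simp
qed

end

text \<open>
  Translates a bound for the heavy vectors of the projection into one for the vectors of \<open>U\<close>
  that lie on lines through the point of \<open>v\<close> of exceptional weight.
\<close>

lemma card_exceptional_project_le:
  fixes U :: "('a::{field,finite} ^ 'n) set" and K and \<theta> v :: "'a ^ 'n"
  assumes U: "subspace_over K U" and \<theta>: "dot \<theta> v = 1"
  defines "Y \<equiv> project \<theta> v ` U"
  shows "card {u \<in> U. u \<in> vec.span {v} \<or> card (U \<inter> vec.span {v, u}) \<noteq> M * card (U \<inter> vec.span {v})}
    \<le> card {y \<in> Y. y = 0 \<or> card (Y \<inter> vec.span {y}) \<noteq> M} * card (U \<inter> vec.span {v})"
proof -
  let ?bad = "{y \<in> Y. y = 0 \<or> card (Y \<inter> vec.span {y}) \<noteq> M}"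
  let ?B = "{u \<in> U. u \<in> vec.span {v} \<or> card (U \<inter> vec.span {v, u}) \<noteq> M * card (U \<inter> vec.span {v})}"
  have "?B \<subseteq> {u \<in> U. project \<theta> v u \<in> ?bad}"
  proof
    fix u assume u: "u \<in> ?B"
    hence uU: "u \<in> U" by simp
    have "project \<theta> v u \<in> Y" unfolding Y_def using uU by blast
    moreover have "project \<theta> v u = 0 \<or> card (Y \<inter> vec.span {project \<theta> v u}) \<noteq> M"
      using u project_eq_0_iff[OF \<theta>, of u] card_project_line[OF U \<theta> uU] unfolding Y_def by auto
    ultimately show "u \<in> {u \<in> U. project \<theta> v u \<in> ?bad}" using uU by blast
  qed
  hence "card ?B \<le> card {u \<in> U. project \<theta> v u \<in> ?bad}" by (rule card_mono[rotated]) simp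
  also have "\<dots> \<le> card (Y \<inter> ?bad) * card (U \<inter> vec.span {v})"
    unfolding Y_def by (rule card_project_preimage_le[OF U \<theta>])
  also have "Y \<inter> ?bad = ?bad" by blast
  finally show ?thesis .
qed

section \<open>Small sections are linear over a large subfield\<close>

lemma eleven_tenths_bound:
  fixes x m Q :: real
  assumes "x * (m - 2) \<le> (m - 1) * Q" "m \<ge> 12" "Q \<ge> 0"
  shows "x \<le> 11 / 10 * Q"
proof -
  have "((m - 1) * 10) * Q \<le> (11 * (m - 2)) * Q" using assms by (intro mult_right_mono) auto
  moreover have "10 * (x * (m - 2)) \<le> 10 * ((m - 1) * Q)" using assms(1) by simp
  ultimately have "(10 * x) * (m - 2) \<le> (11 * Q) * (m - 2)" by (simp add: algebra_simps)
  moreover have "m - 2 > 0" using assms(2) by simp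
  ultimately have "10 * x \<le> 11 * Q" by (rule mult_right_le_imp_le)
  thus ?thesis by simp
qed

text \<open>
  A minimal 1-blocking subset of \<open>A\<close> is small, hence linear by hypothesis, and so it meets
  hyperplanes in 1 mod \<open>CHAR('a)\<close> points, as \<open>A\<close> does. If there was a further point in \<open>A\<close>,
  every hyperplane through it would contain at least two further points, and \<open>A\<close> would have
  about twice as many points as is allowed. A subgroup of order \<open>CHAR('a) * CARD('a)\<close> is
  just large enough to give a blocking set.
\<close>

lemma one_blocking_set_small_linear:
  fixes A :: "('a::{field,finite} ^ 'n) set set"
  assumes lin: "\<forall>A :: ('a ^ 'n) set set. small_minimal_blocking_set 1 A \<longrightarrow> linear_point_set A"
    and n: "CARD('n) \<ge> 2" and A: "A \<subseteq> proj_points" and m: "CHAR('a) dvd m" "m \<ge> 12"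
    and mod: "\<And>f. [card (points_in A (common_zeros f 1)) = 1] (mod m)"
    and size: "real (card A) * (real m - 2) \<le> (real m - 1) * real CARD('a)"
  obtains U where "subspace_over prime_field U" "card U = CHAR('a) * CARD('a)" "linear_set U = A"
    "minimal_blocking_set 1 A"
proof -
  let ?p = "CHAR('a)" and ?q = "CARD('a)"
  have p2: "?p \<ge> 2" by (rule prime_ge_2_nat[OF prime_CHAR_finite])
  have size': "real (card A) \<le> 11 / 10 * real ?q" by (rule eleven_tenths_bound[OF size]) (use m(2) in auto)
  have modp: "[card (points_in A (common_zeros f 1)) = 1] (mod ?p)" for f
    using mod[of f] m(1) by (rule cong_dvd_modulus_nat)
  have blocks: "blocking_set 1 A"
    unfolding blocking_set_def
  proof (intro conjI A allI impI)
    fix W :: "('a ^ 'n) set" assume "proj_subspace (CARD('n) - 1 - 1) W"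
    hence W: "subspace_over UNIV W" "card W = ?q ^ (CARD('n) - 1)"
      unfolding proj_subspace_iff using n by (simp_all add: Suc_diff_Suc numeral_2_eq_2)
    have "?q * card W = ?q ^ CARD('n)" unfolding W(2) using n by (simp flip: power_Suc)
    then obtain f where f: "W = common_zeros f 1" using hyperplane_eq_common_zeros[OF W(1)] by blast
    have "card (points_in A W) \<noteq> 0"
      using mod[of f] m(2) unfolding f by (intro notI) (simp add: cong_def)
    thus "points_in A W \<noteq> {}" by auto
  qed
  have "\<exists>A'. (A' \<subseteq> A \<and> blocking_set 1 A') \<and> (\<forall>C. C \<subseteq> A \<and> blocking_set 1 C \<longrightarrow> card A' \<le> card C)"
    using ex_has_least_nat[of "\<lambda>C. C \<subseteq> A \<and> blocking_set 1 C" A card] blocks by blast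
  then obtain A' where A': "A' \<subseteq> A" "blocking_set 1 A'"
    and least: "\<And>C. C \<subseteq> A \<Longrightarrow> blocking_set 1 C \<Longrightarrow> card A' \<le> card C" by blast
  have min: "minimal_blocking_set 1 A'"
    unfolding minimal_blocking_set_def
  proof (intro conjI allI impI notI A'(2))
    fix C assume C: "C \<subset> A'" "blocking_set 1 C"
    have "card A' \<le> card C" using least C A'(1) by blast
    thus False using psubset_card_mono[OF _ C(1)] by simp
  qed
  have cA': "?q \<le> card A'" using card_blocking_set_ge[OF A'(2)] n by simp
  have "card A' \<le> card A" by (rule card_mono[OF _ A'(1)]) simp
  hence "real (card A') < 3 * (real ?q ^ 1 + 1) / 2" using size' by (simp add: field_simps)
  hence "linear_point_set A'" using lin min unfolding small_minimal_blocking_set_def by blast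
  then obtain K U0 where KU0: "subspace_over K U0" "A' = linear_set U0"
    unfolding linear_point_set_def linear_set_def by blast
  note U0 = subspace_over_prime_field[OF KU0(1)]
  have "A' = A"
  proof (rule ccontr)
    assume "A' \<noteq> A"
    then obtain P where P: "P \<in> A - A'" using A'(1) by blast
    let ?D = "A - A'"
    obtain v where v: "v \<noteq> 0" "P = vec.span {v}" using A P proj_pointsE by blast
    have D: "?D \<subseteq> proj_points" using A by blast
    have two: "2 \<le> card (points_in ?D (common_zeros f 1))" if f: "f \<in> forms (vec.span {v}) 1" for f
    proof -
      let ?Z = "common_zeros f 1"
      have "points_in A ?Z = points_in A' ?Z \<union> points_in ?D ?Z" using A'(1) unfolding points_in_def by blast
      hence c: "card (points_in A ?Z) = card (points_in A' ?Z) + card (points_in ?D ?Z)"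
        by (simp add: card_Un_disjoint points_in_def disjoint_iff)
      have "points_in A' ?Z \<noteq> {}" using blocking_common_zeros[OF A'(2)] n by simp
      hence a1: "[card (points_in A' ?Z) = 1] (mod ?p)"
        using linear_set_mod[OF is_subfield_prime_field U0 subspace_over_common_zeros[where f=f and j=1]]
        unfolding KU0(2) card_prime_field by simp
      have "[card (points_in A' ?Z) + card (points_in ?D ?Z) = card (points_in A' ?Z)] (mod ?p)"
        using cong_trans[OF modp[of f, unfolded c] cong_sym[OF a1]] .
      hence "[card (points_in ?D ?Z) = 0] (mod ?p)" by (simp only: cong_add_lcancel_0_nat)
      hence dvd: "?p dvd card (points_in ?D ?Z)" by (simp add: cong_0_iff)
      have "P \<in> points_in ?D ?Z" using P common_zeros_superset[OF f] v(2) unfolding points_in_def by blast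
      hence "card (points_in ?D ?Z) > 0" by (auto simp: card_gt_0_iff)
      hence "?p \<le> card (points_in ?D ?Z)" using dvd by (simp add: dvd_imp_le)
      thus ?thesis using p2 by simp
    qed
    have "card (points_in ?D (vec.span {v})) = 1"
      using points_in_span_singleton[OF D v(1)] P v(2) by simp
    hence "?q * 2 \<le> ?q + (card ?D - 1)"
      using all_many_points[OF subspace_over_span[of "{v}"] D two] by simp
    hence "?q \<le> card ?D" by simp
    moreover have "card ?D = card A - card A'" using A'(1) by (simp add: card_Diff_subset)
    ultimately have "2 * ?q \<le> card A" using cA' card_mono[OF _ A'(1)] by simp
    hence "2 * real ?q \<le> real (card A)" by linarith
    thus False using size' card_field_ge2[where 'a='a] by linarith
  qed
  note A'A = this
  obtain t where t: "?q = ?p ^ t" 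
  proof -
    obtain h where "?q = card (prime_field :: 'a set) ^ h"
      using subfield_exponent[OF is_subfield_prime_field] by blast
    thus thesis using that unfolding card_prime_field by blast
  qed
  obtain r where r: "card U0 = ?p ^ r" using card_subgroup[OF U0] by blast
  have "(\<Sum>P\<in>A'. 1) \<le> (\<Sum>P\<in>A'. card (U0 \<inter> P) - 1)"
  proof (rule sum_mono)
    fix P assume "P \<in> A'"
    then obtain u where u: "u \<in> U0" "u \<noteq> 0" "P = vec.span {u}" unfolding KU0(2) by (rule linear_setE)
    have "card {0, u} \<le> card (U0 \<inter> P)"
      by (rule card_mono) (use u subspace_over_zero[OF U0] span_singleton_self vec.span_zero in auto)
    thus "1 \<le> card (U0 \<inter> P) - 1" using u(2) by simp
  qed
  hence "?q < card U0" using cA' sum_all_weights[OF U0] card_field_ge2[where 'a='a] unfolding KU0(2)[symmetric] by simp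
  hence "?p ^ t < ?p ^ r" using r t by simp
  hence "t < r" using p2 by (simp add: power_strict_increasing_iff)
  hence "?p ^ Suc t \<le> ?p ^ r" using p2 by (intro power_increasing) auto
  moreover have "card {0 :: 'a ^ 'n} \<le> ?p ^ Suc t" using p2 by simp
  ultimately obtain U where U: "subspace_over prime_field U" "U \<subseteq> U0" "card U = ?p ^ Suc t"
    using intermediate_subspace[OF is_subfield_prime_field subspace_over_zero_space U0, of "Suc t"]
      subspace_over_zero[OF U0] r unfolding card_prime_field by auto
  have cU: "card U = ?p * ?q" using U(3) t by simp
  have "?q ^ 1 < card U" unfolding cU using p2 by simp
  hence "blocking_set 1 (linear_set U)" using linear_set_blocks[OF U(1)] n by simp
  moreover have "linear_set U \<subseteq> A'" unfolding KU0(2) by (rule linear_set_mono[OF U(2)])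
  ultimately have "linear_set U = A'" using minimal_blocking_setD[OF min] by blast
  thus thesis using that U(1) cU min A'A by blast
qed

text \<open>
  Hyperplanes meet \<open>A\<close> in 1 mod \<open>m\<close> points. If \<open>L\<close> did not, every hyperplane through \<open>L\<close>
  would contain at least \<open>CHAR('a)\<close> points of \<open>A\<close> outside \<open>L\<close>, since all these numbers agree
  modulo \<open>CHAR('a)\<close>; on average there are fewer than two.
\<close>

lemma lines_one_mod:
  fixes A :: "('a::{field,finite} ^ 'n) set set"
  assumes U: "subspace_over prime_field U" "linear_set U = A" and m: "CHAR('a) dvd m"
    and mod: "\<And>f. [card (points_in A (common_zeros f 1)) = 1] (mod m)"
    and size: "card A < 2 * CARD('a)"
    and L: "subspace_over UNIV L" and ne: "points_in A L \<noteq> {}"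
  shows "[card (points_in A L) = 1] (mod m)"
proof (rule ccontr)
  let ?x = "card (points_in A L)" and ?p = "CHAR('a)"
  assume not: "\<not> [?x = 1] (mod m)"
  have p2: "?p \<ge> 2" by (rule prime_ge_2_nat[OF prime_CHAR_finite])
  have A: "A \<subseteq> proj_points" using U(2) linear_set_proj_points by blast
  have x1: "[?x = 1] (mod ?p)"
    using linear_set_mod[OF is_subfield_prime_field U(1) L] ne unfolding U(2) card_prime_field by blast
  have "?x + 2 \<le> card (points_in A (common_zeros f 1))" if f: "f \<in> forms L 1" for f
  proof -
    let ?X = "card (points_in A (common_zeros f 1))"
    have "?x \<le> ?X" by (rule card_mono[OF _ points_in_mono[OF common_zeros_superset[OF f]]]) simp
    then obtain c where c: "?X = ?x + c" using le_Suc_ex by blast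
    have "[?X = 1] (mod ?p)" using mod[of f] m by (rule cong_dvd_modulus_nat)
    from cong_trans[OF this[unfolded c] cong_sym[OF x1]] have "[?x + c = ?x] (mod ?p)" .
    hence "?p dvd c" by (simp only: cong_add_lcancel_0_nat cong_0_iff)
    moreover have "c \<noteq> 0"
    proof
      assume "c = 0" thus False using mod[of f] not c by simp
    qed
    ultimately have "?p \<le> c" by (simp add: dvd_imp_le)
    thus ?thesis using c p2 by simp
  qed
  from all_many_points[OF L A this]
  have "CARD('a) * (?x + 2) \<le> CARD('a) * ?x + (card A - ?x)" by simp
  thus False using size by (simp add: algebra_simps)
qed

text \<open>
  Every point of a linear set has weight at least \<open>CHAR('a)\<close>.
\<close>

lemma line_weight_ge:
  fixes U :: "('a::{field,finite} ^ 'n) set"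
  assumes U: "subspace_over prime_field U" and Z: "subspace_over UNIV Z"
  shows "card (points_in (linear_set U) Z) * (CHAR('a) - 1) \<le> card (U \<inter> Z) - 1"
proof -
  have "(\<Sum>P\<in>points_in (linear_set U) Z. CHAR('a) - 1) \<le> (\<Sum>P\<in>points_in (linear_set U) Z. card (U \<inter> P) - 1)"
  proof (rule sum_mono)
    fix P assume "P \<in> points_in (linear_set U) Z"
    then obtain u where u: "u \<in> U" "u \<noteq> 0" "P = vec.span {u}"
      unfolding points_in_def by (blast elim: linear_setE)
    have s: "subspace_over prime_field (U \<inter> P)"
      unfolding u(3) by (rule subspace_over_Int[OF U subspace_over_mono[OF subspace_over_span subset_UNIV]])
    have uP: "u \<in> U \<inter> P" using u span_singleton_self by blast
    have "CHAR('a) dvd card (U \<inter> P)"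
      using card_dvd_subspace_over[OF is_subfield_prime_field s uP u(2)] unfolding card_prime_field .
    moreover have "card (U \<inter> P) > 0" using uP by (auto simp: card_gt_0_iff)
    ultimately have "CHAR('a) \<le> card (U \<inter> P)" by (rule dvd_imp_le)
    thus "CHAR('a) - 1 \<le> card (U \<inter> P) - 1" by simp
  qed
  thus ?thesis unfolding sum_weights[OF U Z] by simp
qed

text \<open>
  What the projection from a point of weight \<open>CHAR('a)\<close> tells about \<open>U\<close>. There is a field
  \<open>F\<close> of order \<open>M = CHAR('a) ^ d\<close> such that \<open>U\<close> is closed under \<open>F\<close> modulo \<open>vec.span {v}\<close>.
  The lines through the point of \<open>v\<close> have weight at least \<open>CHAR('a) * M\<close>, with equality for
  at least one line, and the fraction of the vectors of \<open>U\<close> that do not lie on such a line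
  or are multiples of \<open>v\<close> is at most \<open>(1 + M) / M\<^sup>2\<close>.
\<close>

definition light_field_degree :: "('a::{field,finite} ^ 'n) set \<Rightarrow> 'a ^ 'n \<Rightarrow> nat \<Rightarrow> bool" where
  "light_field_degree U v d \<longleftrightarrow> card (frobenius_fixed d :: 'a set) = CHAR('a) ^ d \<and>
    (\<forall>\<kappa>\<in>frobenius_fixed d. \<forall>u\<in>U. \<exists>u'\<in>U. \<kappa> *s u - u' \<in> vec.span {v}) \<and>
    (\<forall>u\<in>U. u \<notin> vec.span {v} \<longrightarrow> CHAR('a) ^ Suc d \<le> card (U \<inter> vec.span {v, u})) \<and>
    (\<exists>u\<in>U. u \<notin> vec.span {v} \<and> card (U \<inter> vec.span {v, u}) = CHAR('a) ^ Suc d) \<and>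
    real (card {u \<in> U. u \<in> vec.span {v} \<or> card (U \<inter> vec.span {v, u}) \<noteq> CHAR('a) ^ Suc d}) * (real CHAR('a) ^ d) ^ 2
      \<le> real CHAR('a) * (real CARD('a) + real CHAR('a) ^ d * real CARD('a))"

text \<open>
  The projection of \<open>U\<close> from the point of \<open>v\<close> has \<open>CARD('a)\<close> elements. A line through this
  point has more than \<open>CHAR('a) ^ e\<close> points, each of weight at least \<open>CHAR('a)\<close>, so its
  weight exceeds \<open>CHAR('a) ^ e * (CHAR('a) - 1)\<close>; as weights are powers of \<open>CHAR('a)\<close>, it is
  at least \<open>CHAR('a) ^ Suc e\<close>. So all weights of the projection are at least \<open>CHAR('a) ^ e\<close>.
\<close>

lemma light_point_field:
  fixes U :: "('a::{field,finite} ^ 'n) set"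
  assumes U: "subspace_over prime_field U" and cU: "card U = CHAR('a) * CARD('a)"
    and v: "v \<in> U" "v \<noteq> 0" and light: "card (U \<inter> vec.span {v}) = CHAR('a)"
    and e: "CHAR('a) ^ e \<ge> 12"
    and lines: "\<And>u. u \<in> U \<Longrightarrow> u \<notin> vec.span {v} \<Longrightarrow>
      CHAR('a) ^ e + 1 \<le> card (points_in (linear_set U) (vec.span {v, u}))"
  obtains d where "d \<ge> e" "light_field_degree U v d"
proof -
  let ?p = "CHAR('a)" and ?q = "CARD('a)"
  have p2: "?p \<ge> 2" by (rule prime_ge_2_nat[OF prime_CHAR_finite])
  obtain \<theta> where \<theta>: "dot \<theta> v = 1" using exists_dot_eq_1[OF v(2)] by blast
  define Y where "Y = project \<theta> v ` U"
  have Y: "subspace_over prime_field Y" unfolding Y_def by (rule subspace_over_project[OF U \<theta>])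
  have "card U = card Y * ?p" using card_project[OF U \<theta>] light unfolding Y_def by simp
  hence cY: "card Y = ?q" using cU p2 by simp
  have line: "card (U \<inter> vec.span {v, u}) = card (Y \<inter> vec.span {project \<theta> v u}) * ?p" if "u \<in> U" for u
    using card_project_line[OF U \<theta> that] light unfolding Y_def by simp
  have wts: "?p ^ e \<le> card (Y \<inter> vec.span {y})" if y: "y \<in> Y" "y \<noteq> 0" for y
  proof -
    obtain u where u: "u \<in> U" "y = project \<theta> v u" using y(1) unfolding Y_def by blast
    have nu: "u \<notin> vec.span {v}" using y(2) u(2) project_eq_0_iff[OF \<theta>] by blast
    have s: "subspace_over prime_field (Y \<inter> vec.span {y})"
      by (rule subspace_over_Int[OF Y subspace_over_mono[OF subspace_over_span subset_UNIV]])
    obtain i where i: "card (Y \<inter> vec.span {y}) = ?p ^ i" using card_subgroup[OF s] by blast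
    have pos: "?p ^ i * ?p > 0" using p2 by simp
    have "(?p ^ e + 1) * (?p - 1) \<le> card (points_in (linear_set U) (vec.span {v, u})) * (?p - 1)"
      using lines[OF u(1) nu] by (rule mult_right_mono) simp
    also have "\<dots> \<le> ?p ^ i * ?p - 1"
      using line_weight_ge[OF U subspace_over_span, of "{v, u}"] line[OF u(1)] i u(2) by simp
    finally have 1: "(?p ^ e + 1) * (?p - 1) < ?p ^ i * ?p" using pos by linarith
    have "(?p ^ e + 1) * 1 \<le> (?p ^ e + 1) * (?p - 1)" using p2 by (intro mult_left_mono) auto
    hence "?p ^ e + 1 \<le> (?p ^ e + 1) * (?p - 1)" by (simp only: mult_1_right)
    hence "?p ^ e < ?p ^ i * ?p" using 1 by linarith
    hence "?p ^ e < ?p ^ Suc i" by (simp add: mult.commute)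
    hence "e < Suc i" by (rule power_less_imp_less_exp[rotated]) (use p2 in simp)
    thus ?thesis unfolding i using p2 by (intro power_increasing) auto
  qed
  obtain d where d: "d \<ge> e" "card (frobenius_fixed d :: 'a set) = ?p ^ d" "subspace_over (frobenius_fixed d) Y"
    "\<And>y. y \<in> Y \<Longrightarrow> y \<noteq> 0 \<Longrightarrow> ?p ^ d \<le> card (Y \<inter> vec.span {y})"
    "\<exists>y\<in>Y. y \<noteq> 0 \<and> card (Y \<inter> vec.span {y}) = ?p ^ d"
    using large_weights_imp_subfield[OF Y cY _ wts] e by auto
  obtain y0 where y0: "y0 \<in> Y" "y0 \<noteq> 0" "card (Y \<inter> vec.span {y0}) = ?p ^ d" using d(5) by blast
  have "e > 0" using e by (intro gr0I) simp
  hence d0: "d > 0" using d(1) by simp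
  have "light_field_degree U v d"
    unfolding light_field_degree_def
  proof (intro conjI)
    show "card (frobenius_fixed d :: 'a set) = ?p ^ d" by (rule d(2))
    show "\<forall>\<kappa>\<in>frobenius_fixed d. \<forall>u\<in>U. \<exists>u'\<in>U. \<kappa> *s u - u' \<in> vec.span {v}"
    proof (intro ballI)
      fix \<kappa> :: 'a and u assume k: "\<kappa> \<in> frobenius_fixed d" and u: "u \<in> U"
      have "\<kappa> *s project \<theta> v u \<in> Y" using subspace_over_scale[OF d(3) k] u unfolding Y_def by blast
      then obtain u' where u': "u' \<in> U" "\<kappa> *s project \<theta> v u = project \<theta> v u'" unfolding Y_def by blast
      have "project \<theta> v (\<kappa> *s u - u') = 0" using u'(2) by (simp add: project_diff project_scale)
      thus "\<exists>u'\<in>U. \<kappa> *s u - u' \<in> vec.span {v}" using u'(1) project_eq_0_iff[OF \<theta>] by blast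
    qed
    show "\<forall>u\<in>U. u \<notin> vec.span {v} \<longrightarrow> ?p ^ Suc d \<le> card (U \<inter> vec.span {v, u})"
    proof (intro ballI impI)
      fix u assume u: "u \<in> U" "u \<notin> vec.span {v}"
      have "project \<theta> v u \<noteq> 0" using u(2) project_eq_0_iff[OF \<theta>] by blast
      moreover have "project \<theta> v u \<in> Y" unfolding Y_def using u(1) by blast
      ultimately have "?p ^ d \<le> card (Y \<inter> vec.span {project \<theta> v u})" using d(4) by blast
      thus "?p ^ Suc d \<le> card (U \<inter> vec.span {v, u})" unfolding line[OF u(1)] by simp
    qed
    show "\<exists>u\<in>U. u \<notin> vec.span {v} \<and> card (U \<inter> vec.span {v, u}) = ?p ^ Suc d"
    proof -
      obtain u where u: "u \<in> U" "y0 = project \<theta> v u" using y0(1) unfolding Y_def by blast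
      have "u \<notin> vec.span {v}" using y0(2) u(2) project_eq_0_iff[OF \<theta>] by blast
      moreover have "card (U \<inter> vec.span {v, u}) = ?p ^ Suc d"
        unfolding line[OF u(1)] using y0(3) u(2) by simp
      ultimately show ?thesis using u(1) by blast
    qed
    let ?bad = "{y \<in> Y. y = 0 \<or> card (Y \<inter> vec.span {y}) \<noteq> ?p ^ d}"
    have bad: "real (card ?bad) * (real ?p ^ d) ^ 2 \<le> real ?q + real ?p ^ d * real ?q"
    proof (cases "?p ^ d < ?q")
      case True
      have "real (card ?bad) * real (?p ^ d) ^ 2 + real (?p ^ d) ^ 3 \<le> real ?q + real (?p ^ d) * real ?q"
        by (rule heavy_vectors_bound[OF d(3) cY d(2) refl d0 True y0])
      moreover have "real (?p ^ d) ^ 3 \<ge> 0" by simp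
      ultimately show ?thesis unfolding of_nat_power by linarith
    next
      case False
      have le: "card (Y \<inter> vec.span {y}) \<le> ?q" for y using card_mono[of Y "Y \<inter> vec.span {y}"] cY by simp
      hence eq: "?p ^ d = ?q" using False y0(3) by (metis antisym_conv3 le_antisym linorder_not_less)
      have "?bad \<subseteq> {0}"
      proof
        fix y assume y: "y \<in> ?bad"
        show "y \<in> {0}"
        proof (rule ccontr)
          assume "y \<notin> {0}"
          hence "?p ^ d \<le> card (Y \<inter> vec.span {y})" "card (Y \<inter> vec.span {y}) \<noteq> ?p ^ d" using d(4) y by auto
          thus False using le[of y] eq by simp
        qed
      qed
      hence "card ?bad \<le> 1" using card_mono[of "{0}" ?bad] by simp
      hence 1: "real (card ?bad) * (real ?q) ^ 2 \<le> 1 * (real ?q) ^ 2" by (intro mult_right_mono) auto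
      have pd: "real ?p ^ d = real ?q" using eq by (metis of_nat_power)
      have "1 * (real ?q) ^ 2 \<le> real ?q + real ?q * real ?q" by (simp add: power2_eq_square)
      thus ?thesis unfolding pd using 1 by linarith
    qed
    have "card {u \<in> U. u \<in> vec.span {v} \<or> card (U \<inter> vec.span {v, u}) \<noteq> ?p ^ Suc d} \<le> card ?bad * ?p"
      using card_exceptional_project_le[OF U \<theta>, of "?p ^ d"] light unfolding Y_def by (simp add: mult.commute)
    hence "real (card {u \<in> U. u \<in> vec.span {v} \<or> card (U \<inter> vec.span {v, u}) \<noteq> ?p ^ Suc d}) \<le> real (card ?bad) * real ?p"
      unfolding of_nat_mult[symmetric] of_nat_le_iff .
    hence "real (card {u \<in> U. u \<in> vec.span {v} \<or> card (U \<inter> vec.span {v, u}) \<noteq> ?p ^ Suc d}) * (real ?p ^ d) ^ 2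
      \<le> (real (card ?bad) * real ?p) * (real ?p ^ d) ^ 2" by (rule mult_right_mono) simp
    also have "\<dots> = real ?p * (real (card ?bad) * (real ?p ^ d) ^ 2)" by simp
    also have "\<dots> \<le> real ?p * (real ?q + real ?p ^ d * real ?q)" using bad by (rule mult_left_mono) simp
    finally show "real (card {u \<in> U. u \<in> vec.span {v} \<or> card (U \<inter> vec.span {v, u}) \<noteq> ?p ^ Suc d}) * (real ?p ^ d) ^ 2
      \<le> real ?p * (real ?q + real ?p ^ d * real ?q)" .
  qed
  thus thesis using that d(1) by blast
qed

text \<open>
  The intersection of the groups \<open>U + vec.span {v}\<close>: each of them is closed under scaling by
  \<open>K\<close>.
\<close>

lemma subspace_over_thicken:
  fixes U :: "('a::{field,finite} ^ 'n) set"
  assumes U: "subspace_over prime_field U" and K: "is_subfield K"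
    and K_closed: "\<And>v \<kappa> u. v \<in> V \<Longrightarrow> \<kappa> \<in> K \<Longrightarrow> u \<in> U \<Longrightarrow> \<exists>u'\<in>U. \<kappa> *s u - u' \<in> vec.span {v}"
  shows "subspace_over K {x. \<forall>v\<in>V. \<exists>u\<in>U. x - u \<in> vec.span {v}}"
  unfolding subspace_over_def
proof (intro conjI ballI)
  show "0 \<in> {x. \<forall>v\<in>V. \<exists>u\<in>U. x - u \<in> vec.span {v}}"
    using subspace_over_zero[OF U] by (auto intro!: bexI[of _ 0] simp: vec.span_zero)
  fix x assume x: "x \<in> {x. \<forall>v\<in>V. \<exists>u\<in>U. x - u \<in> vec.span {v}}"
  show "x + y \<in> {x. \<forall>v\<in>V. \<exists>u\<in>U. x - u \<in> vec.span {v}}"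
    if y: "y \<in> {x. \<forall>v\<in>V. \<exists>u\<in>U. x - u \<in> vec.span {v}}" for y
  proof (rule CollectI, rule ballI)
    fix v assume v: "v \<in> V"
    obtain u where u: "u \<in> U" "x - u \<in> vec.span {v}" using x v by blast
    obtain w where w: "w \<in> U" "y - w \<in> vec.span {v}" using y v by blast
    have "(x - u) + (y - w) \<in> vec.span {v}" by (rule vec.span_add[OF u(2) w(2)])
    hence "(x + y) - (u + w) \<in> vec.span {v}" by (simp add: algebra_simps)
    thus "\<exists>u\<in>U. x + y - u \<in> vec.span {v}" using subspace_over_add[OF U u(1) w(1)] by blast
  qed
  show "\<kappa> *s x \<in> {x. \<forall>v\<in>V. \<exists>u\<in>U. x - u \<in> vec.span {v}}" if \<kappa>: "\<kappa> \<in> K" for \<kappa>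
  proof (rule CollectI, rule ballI)
    fix v assume v: "v \<in> V"
    obtain u where u: "u \<in> U" "x - u \<in> vec.span {v}" using x v by blast
    obtain u' where u': "u' \<in> U" "\<kappa> *s u - u' \<in> vec.span {v}" using K_closed[OF v \<kappa> u(1)] by blast
    have "\<kappa> *s (x - u) + (\<kappa> *s u - u') \<in> vec.span {v}" by (rule vec.span_add[OF vec.span_scale[OF u(2)] u'(2)])
    hence "\<kappa> *s x - u' \<in> vec.span {v}" by (simp add: vec.scale_right_diff_distrib)
    thus "\<exists>u\<in>U. \<kappa> *s x - u \<in> vec.span {v}" using u'(1) by blast
  qed
qed

text \<open>
  As a first step \<open>A\<close> is the linear set of a group \<open>U\<close> of order \<open>CHAR('a) * CARD('a)\<close>. Each
  point of weight \<open>CHAR('a)\<close> comes with a field; let \<open>CHAR('a) ^ d\<close> be the least order of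
  such a field and \<open>v0\<close> a point where it occurs. Most vectors \<open>u\<close> of \<open>U\<close> lie on a line
  through \<open>v0\<close> of weight \<open>CHAR('a) ^ Suc d\<close>, and such a line bounds the field of \<open>u\<close>, so
  that most points of weight \<open>CHAR('a)\<close> have the same field \<open>K\<close>. The intersection of the
  groups \<open>U + vec.span {u}\<close> for these \<open>u\<close> is a \<open>K\<close>-subspace \<open>T\<close> that contains \<open>U\<close>. A vector
  of \<open>T\<close> outside the points of \<open>A\<close> would be joined to each of these many points by a line
  with a second point of \<open>A\<close>, so \<open>T\<close> gives no new points. A subspace of \<open>T\<close> of order
  \<open>CHAR('a) ^ d * CARD('a)\<close> still gives a blocking set, hence all of \<open>A\<close>.
\<close>

theorem linear_section:
  fixes A :: "('a::{field,finite} ^ 'n) set set"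
  assumes lin: "\<forall>A :: ('a ^ 'n) set set. small_minimal_blocking_set 1 A \<longrightarrow> linear_point_set A"
    and n: "CARD('n) \<ge> 2" and A: "A \<subseteq> proj_points" and m: "m = CHAR('a) ^ e" "m \<ge> 12"
    and mod: "\<And>f. [card (points_in A (common_zeros f 1)) = 1] (mod m)"
    and small: "real (card A) < (real m - 2) * real CARD('a)"
  obtains d U v w where "d \<ge> e" "card (frobenius_fixed d :: 'a set) = CHAR('a) ^ d"
    "subspace_over (frobenius_fixed d) U" "card U = CHAR('a) ^ d * CARD('a)" "linear_set U = A"
    "vec.span {v} \<in> A" "vec.span {w} \<in> A" "w \<notin> vec.span {v}"
    "card (points_in A (vec.span {v, w})) = CHAR('a) ^ d + 1"
proof -
  let ?p = "CHAR('a)" and ?q = "CARD('a)"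
  have p2: "?p \<ge> 2" by (rule prime_ge_2_nat[OF prime_CHAR_finite])
  have "e \<noteq> 0" using m by (intro notI) simp
  hence pm: "?p dvd m" unfolding m(1) by (simp add: dvd_power)
  have size: "real (card A) * (real m - 2) \<le> (real m - 1) * real ?q"
    using size_gap[OF A m(2) mod] small by simp
  have size': "real (card A) \<le> 11 / 10 * real ?q" by (rule eleven_tenths_bound[OF size]) (use m(2) in auto)
  obtain U where U: "subspace_over prime_field U" "card U = ?p * ?q" "linear_set U = A" and min: "minimal_blocking_set 1 A"
    using one_blocking_set_small_linear[OF lin n A pm m(2) mod size] by blast
  have block: "blocking_set 1 A" using min unfolding minimal_blocking_set_def by blast
  have cA: "?q \<le> card A" using card_blocking_set_ge[OF block] n by simp
  have cA2: "card A < 2 * ?q"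
  proof -
    have "real (card A) < 2 * real ?q" using size' card_field_ge2[where 'a='a] by linarith
    thus ?thesis by linarith
  qed
  have lines: "m + 1 \<le> card (points_in (linear_set U) (vec.span {v, u}))"
    if "v \<in> U" "v \<noteq> 0" "u \<in> U" "u \<notin> vec.span {v}" for u v
  proof -
    have u0: "u \<noteq> 0" using that(4) vec.span_zero by metis
    have two: "2 \<le> card (points_in A (vec.span {v, u}))"
      using card_two_points_line[of v A u] linear_setI that u0 U(3) by blast
    hence "points_in A (vec.span {v, u}) \<noteq> {}" by auto
    from lines_one_mod[OF U(1,3) pm mod cA2 subspace_over_span this]
    show ?thesis unfolding U(3) using two m(2) by (intro cong_1_ge) auto
  qed
  define Lt where "Lt = {u \<in> U - {0}. card (U \<inter> vec.span {u}) = ?p}"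
  have wts: "card (U \<inter> P) = ?p \<or> ?p * ?p \<le> card (U \<inter> P)" if P: "P \<in> linear_set U" for P
  proof -
    obtain u where u: "u \<in> U" "u \<noteq> 0" "P = vec.span {u}" using P by (rule linear_setE)
    have s: "subspace_over prime_field (U \<inter> P)"
      unfolding u(3) by (rule subspace_over_Int[OF U(1) subspace_over_mono[OF subspace_over_span subset_UNIV]])
    obtain i where i: "card (U \<inter> P) = ?p ^ i" using card_subgroup[OF s] by blast
    have "card {0, u} \<le> card (U \<inter> P)"
      by (rule card_mono) (use u subspace_over_zero[OF U(1)] span_singleton_self vec.span_zero in auto)
    hence "i \<noteq> 0" using i u(2) by (intro notI) simp
    show ?thesis
    proof (cases "i = 1")
      case False
      hence "2 \<le> i" using \<open>i \<noteq> 0\<close> by simp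
      hence "?p ^ 2 \<le> ?p ^ i" using p2 by (intro power_increasing) auto
      thus ?thesis using i by (simp add: power2_eq_square)
    qed (use i in simp)
  qed
  have cLt: "(real ?p - 1) * real ?q \<le> 2 * real (card Lt)"
  proof -
    have "(real ?p - 1) * ((real ?p * real ?p - 1) * real (card A) - (real (card U) - 1)) \<le> (real ?p - 1) * real ?p * real (card Lt)"
      using light_vectors_bound[OF U(1) _ _ wts] p2 unfolding Lt_def U(3) by simp
    hence "(real ?p - 1) * ((real ?p * real ?p - 1) * real (card A) - (real (card U) - 1)) \<le> (real ?p - 1) * (real ?p * real (card Lt))"
      by (simp only: mult.assoc)
    hence "(real ?p * real ?p - 1) * real (card A) - (real (card U) - 1) \<le> real ?p * real (card Lt)"
      using p2 by simp
    moreover have pp: "real ?p * real ?p \<ge> 2 * 2" using p2 by (intro mult_mono) auto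
    hence "(real ?p * real ?p - 1) * real ?q \<le> (real ?p * real ?p - 1) * real (card A)"
      using cA by (intro mult_left_mono) auto
    ultimately have "(real ?p * real ?p - 1) * real ?q - real ?p * real ?q \<le> real ?p * real (card Lt)"
      using U(2) by simp
    hence 1: "(2 * (real ?p * real ?p - real ?p - 1)) * real ?q \<le> real ?p * (2 * real (card Lt))" by (simp add: algebra_simps)
    have "(real ?p - 2) * (real ?p + 1) \<ge> 0" using p2 by (intro mult_nonneg_nonneg) auto
    hence "real ?p * (real ?p - 1) \<le> 2 * (real ?p * real ?p - real ?p - 1)" by (simp add: algebra_simps)
    hence "real ?p * (real ?p - 1) * real ?q \<le> (2 * (real ?p * real ?p - real ?p - 1)) * real ?q" by (rule mult_right_mono) simp
    from order_trans[OF this 1]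
    have "real ?p * ((real ?p - 1) * real ?q) \<le> real ?p * (2 * real (card Lt))" by (simp only: mult.assoc)
    thus ?thesis using p2 by simp
  qed
  have "real (card Lt) > 0"
  proof -
    have "(real ?p - 1) * real ?q > 0" using p2 card_field_ge2[where 'a='a] by (intro mult_pos_pos) auto
    thus ?thesis using cLt by linarith
  qed
  then obtain v1 where v1: "v1 \<in> Lt" by (metis card.empty ex_in_conv less_irrefl of_nat_0)
  have "\<exists>d. d \<ge> e \<and> light_field_degree U v d" if v: "v \<in> Lt" for v
  proof -
    have v': "v \<in> U" "v \<noteq> 0" "card (U \<inter> vec.span {v}) = ?p" using v unfolding Lt_def by blast+
    obtain d where "d \<ge> e" "light_field_degree U v d"
    proof (rule light_point_field[OF U(1,2) v'])
      show "12 \<le> ?p ^ e" using m by simp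
      show "?p ^ e + 1 \<le> card (points_in (linear_set U) (vec.span {v, u}))"
        if "u \<in> U" "u \<notin> vec.span {v}" for u
        using lines[OF v'(1,2) that] unfolding m(1) .
    qed
    thus ?thesis by blast
  qed
  then obtain D where D: "\<And>v. v \<in> Lt \<Longrightarrow> D v \<ge> e \<and> light_field_degree U v (D v)" by metis
  obtain v0 where v0: "v0 \<in> Lt" and v0_least: "\<And>v. v \<in> Lt \<Longrightarrow> D v0 \<le> D v"
    using ex_has_least_nat[of "\<lambda>v. v \<in> Lt" v1 D] v1 by blast
  define d where "d = D v0"
  have de: "d \<ge> e" and ld: "light_field_degree U v0 d" using D[OF v0] unfolding d_def by auto
  have cK: "card (frobenius_fixed d :: 'a set) = ?p ^ d" using ld unfolding light_field_degree_def by blast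
  have M: "real ?p ^ d \<ge> 12"
  proof -
    have "?p ^ e \<le> ?p ^ d" using de p2 by (intro power_increasing) auto
    hence "12 \<le> ?p ^ d" using m by linarith
    thus ?thesis by (metis of_nat_le_iff of_nat_numeral of_nat_power)
  qed
  define Bad where "Bad = {u \<in> U. u \<in> vec.span {v0} \<or> card (U \<inter> vec.span {v0, u}) \<noteq> ?p ^ Suc d}"
  (* (1 + M) / M\<^sup>2 \<le> 13 / 144 for M \<ge> 12 *)
  have cBad: "144 * real (card Bad) \<le> 13 * real ?p * real ?q"
  proof -
    let ?M = "real ?p ^ d"
    have "real (card Bad) * ?M ^ 2 \<le> real ?p * (real ?q + ?M * real ?q)"
      using ld unfolding light_field_degree_def Bad_def by blast
    hence "144 * (real (card Bad) * ?M ^ 2) \<le> (144 * (1 + ?M)) * (real ?p * real ?q)" by (simp add: algebra_simps)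
    also have "\<dots> \<le> (13 * ?M ^ 2) * (real ?p * real ?q)"
    proof (rule mult_right_mono)
      have "(?M - 12) * (13 * ?M + 12) \<ge> 0" using M by (intro mult_nonneg_nonneg) auto
      thus "144 * (1 + ?M) \<le> 13 * ?M ^ 2" by (simp add: algebra_simps power2_eq_square)
    qed simp
    finally have "(144 * real (card Bad)) * ?M ^ 2 \<le> (13 * real ?p * real ?q) * ?M ^ 2" by (simp only: mult_ac)
    moreover have "?M ^ 2 > 0" by (rule zero_less_power) (use M in linarith)
    ultimately show ?thesis by (rule mult_right_le_imp_le)
  qed
  define V where "V = Lt - Bad"
  have VU: "V \<subseteq> U - {0}" unfolding V_def Lt_def by blast
  (* Lt has at least (p - 1) * q / 2 elements, of which at most 26 / 144 * (p - 1) * q are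
     bad, as p \<le> 2 * (p - 1) *)
  have cV: "46 * ((real ?p - 1) * real ?q) \<le> 144 * real (card V)"
  proof -
    have "card Lt - card Bad \<le> card V" unfolding V_def by (rule diff_card_le_card_Diff) simp
    hence "real (card Lt) - real (card Bad) \<le> real (card V)" by linarith
    moreover have "real ?p * real ?q \<le> (2 * (real ?p - 1)) * real ?q" using p2 by (intro mult_right_mono) auto
    ultimately show ?thesis using cLt cBad by linarith
  qed
  (* the line through u and v0 has weight CHAR('a) ^ Suc d, and weights of lines through u
     are at least CHAR('a) ^ Suc (D u); so D u \<le> d, and equality holds because d is least *)
  have degV: "light_field_degree U u d" if u: "u \<in> V" for u
  proof -
    have uL: "u \<in> Lt" using u unfolding V_def by blast
    have uU: "u \<in> U" "u \<notin> vec.span {v0}" "card (U \<inter> vec.span {v0, u}) = ?p ^ Suc d"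
      using u unfolding V_def Bad_def Lt_def by blast+
    have v0U: "v0 \<in> U" "v0 \<noteq> 0" using v0 unfolding Lt_def by blast+
    have "v0 \<notin> vec.span {u}" using span_singleton_eq[of v0 u] v0U(2) uU(2) span_singleton_self by blast
    hence "?p ^ Suc (D u) \<le> card (U \<inter> vec.span {u, v0})"
      using D[OF uL] v0U(1) unfolding light_field_degree_def by blast
    hence "?p ^ Suc (D u) \<le> ?p ^ Suc d" using uU(3) by (simp only: insert_commute)
    hence "Suc (D u) \<le> Suc d" by (rule power_le_imp_le_exp[rotated]) (use p2 in simp)
    moreover have "d \<le> D u" using v0_least[OF uL] unfolding d_def .
    ultimately have "D u = d" by simp
    thus ?thesis using D[OF uL] by simp
  qed
  define P where "P = (\<lambda>u. vec.span {u}) ` V"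
  have PA: "P \<subseteq> A" unfolding P_def U(3)[symmetric] using VU linear_setI by blast
  have cP: "46 * real ?q \<le> 144 * real (card P)"
  proof -
    have "V \<subseteq> {u \<in> U - {0}. vec.span {u} \<in> P}" using VU unfolding P_def by blast
    hence "card V \<le> card {u \<in> U - {0}. vec.span {u} \<in> P}" by (rule card_mono[rotated]) simp
    also have "\<dots> = (\<Sum>Q\<in>P. card (U \<inter> Q) - 1)"
      using card_vectors_on_points[OF U(1)] PA U(3) by blast
    also have "\<dots> = (\<Sum>Q\<in>P. ?p - 1)"
      by (rule sum.cong[OF refl]) (auto simp: P_def V_def Lt_def)
    also have "\<dots> = card P * (?p - 1)" by simp
    finally have "real (card V) \<le> real (card P * (?p - 1))" by (rule of_nat_mono)
    hence "real (card V) \<le> real (card P) * (real ?p - 1)" using p2 by (simp add: of_nat_diff)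
    hence "(46 * real ?q) * (real ?p - 1) \<le> (144 * real (card P)) * (real ?p - 1)" using cV by (simp add: algebra_simps)
    moreover have "real ?p - 1 > 0" using p2 by simp
    ultimately show ?thesis by (rule mult_right_le_imp_le)
  qed
  let ?K = "frobenius_fixed d :: 'a set"
  have sK: "is_subfield ?K" by (rule is_subfield_frobenius_fixed)
  define T where "T = {x. \<forall>v\<in>V. \<exists>u\<in>U. x - u \<in> vec.span {v}}"
  have T: "subspace_over ?K T"
    unfolding T_def using degV unfolding light_field_degree_def
    by (intro subspace_over_thicken[OF U(1) sK]) blast
  have UT: "U \<subseteq> T" unfolding T_def using vec.span_zero by (auto intro!: bexI)
  have "linear_set T \<subseteq> A"
  proof
    fix X assume "X \<in> linear_set T"
    then obtain x where x: "x \<in> T" "x \<noteq> 0" "X = vec.span {x}" by (rule linear_setE)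
    show "X \<in> A"
    proof (rule ccontr)
      assume XA: "X \<notin> A"
      (* write x = u' + a *s u with u' in U: the second point on the line through x and u is
         that of the vector u' *)
      have partner: "\<exists>Q'\<in>A. Q' \<noteq> Q \<and> vec.span (insert x Q') = vec.span (insert x Q)" if Q: "Q \<in> P" for Q
      proof -
        obtain u where u: "u \<in> V" "Q = vec.span {u}" using Q unfolding P_def by blast
        have QA: "Q \<in> A" using Q PA by blast
        obtain u' where u': "u' \<in> U" "x - u' \<in> vec.span {u}" using x(1) u(1) unfolding T_def by blast
        obtain a where a: "x - u' = a *s u" using u'(2) mem_span_singleton by blast
        have xu: "x \<notin> vec.span {u}" using span_singleton_eq[of x u] x(2,3) XA QA u(2) by metis
        have "u' \<notin> vec.span {u}"
        proof
          assume "u' \<in> vec.span {u}"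
          from vec.span_add[OF u'(2) this] show False using xu by simp
        qed
        hence u'0: "u' \<noteq> 0" using vec.span_zero by metis
        have Q'A: "vec.span {u'} \<in> A" using linear_setI[OF u'(1) u'0] U(3) by blast
        have "u' \<in> vec.span {x, u}"
        proof -
          have "u' = 1 *s x + (- a) *s u" using a by (simp add: diff_eq_eq)
          thus ?thesis unfolding mem_span_pair by blast
        qed
        moreover have "u' \<notin> vec.span {x}" using span_singleton_eq[of u' x] u'0 Q'A XA x(3) by metis
        ultimately have "vec.span {x, u'} = vec.span {x, u}" by (rule span_pair_eq)
        hence "vec.span (insert x (vec.span {u'})) = vec.span (insert x Q)"
          unfolding u(2) span_insert_span_singleton .
        moreover have "vec.span {u'} \<noteq> Q" using \<open>u' \<notin> vec.span {u}\<close> span_singleton_self u(2) by blast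
        ultimately show ?thesis using Q'A by blast
      qed
      have "2 * ?q ^ 1 + card P \<le> 2 * card A"
      proof (rule few_lines_contradiction[OF A x(2) _ _ PA partner])
        show "vec.span {x} \<notin> A" using XA x(3) by simp
        show "points_in A (common_zeros f 1) \<noteq> {}" for f
          using blocking_common_zeros[OF block] n by simp
      qed
      hence "2 * real ?q + real (card P) \<le> 2 * real (card A)" by simp
      thus False using cP size' card_field_ge2[where 'a='a] by linarith
    qed
  qed
  moreover have "A \<subseteq> linear_set T" using linear_set_mono[OF UT] U(3) by simp
  ultimately have TA: "linear_set T = A" by blast
  obtain h where h: "?q = card ?K ^ h" using subfield_exponent[OF sK] by blast
  obtain r where r: "card T = card ?K ^ r" using card_subspace_over[OF sK T] by blast
  have k1: "1 < card ?K" using card_subfield_ge2[OF sK] by simp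
  have "?q < card T"
  proof -
    have "?q < ?p * ?q" using p2 by simp
    also have "\<dots> \<le> card T" using card_mono[OF _ UT] U(2) by simp
    finally show ?thesis .
  qed
  hence "h < r" unfolding h r using k1 by (simp only: power_strict_increasing_iff)
  hence "card ?K ^ Suc h \<le> card T" unfolding r using k1 by (intro power_increasing) auto
  moreover have "card {0 :: 'a ^ 'n} \<le> card ?K ^ Suc h" using k1 by simp
  ultimately obtain U' where U': "subspace_over ?K U'" "U' \<subseteq> T" "card U' = card ?K ^ Suc h"
    using intermediate_subspace[OF sK subspace_over_zero_space T, of "Suc h"] subspace_over_zero[OF T] by auto
  have cU': "card U' = ?p ^ d * ?q" using U'(3) h cK by simp
  have "?q ^ 1 < card U'" unfolding cU' using k1 cK by simp
  hence "blocking_set 1 (linear_set U')" using linear_set_blocks[OF U'(1)] n by simp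
  moreover have "linear_set U' \<subseteq> A" using linear_set_mono[OF U'(2)] TA by simp
  ultimately have U'A: "linear_set U' = A" using minimal_blocking_setD[OF min] by blast
  obtain w where w: "w \<in> U" "w \<notin> vec.span {v0}" "card (U \<inter> vec.span {v0, w}) = ?p ^ Suc d"
    using ld unfolding light_field_degree_def by blast
  have v0U: "v0 \<in> U" "v0 \<noteq> 0" using v0 unfolding Lt_def by blast+
  have w0: "w \<noteq> 0" using w(2) vec.span_zero by metis
  have vA: "vec.span {v0} \<in> A" "vec.span {w} \<in> A" using linear_setI v0U w(1) w0 U(3) by blast+
  let ?L = "vec.span {v0, w}"
  have two: "2 \<le> card (points_in A ?L)" by (rule card_two_points_line[OF vA w(2)])
  hence ne: "points_in (linear_set U') ?L \<noteq> {}" unfolding U'A by auto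
  have mod1: "[card (points_in A ?L) = 1] (mod ?p ^ d)"
    using linear_set_mod[OF sK U'(1) subspace_over_span ne] unfolding U'A cK .
  have up: "card (points_in A ?L) * (?p - 1) \<le> ?p ^ Suc d - 1"
    using line_weight_ge[OF U(1) subspace_over_span, of "{v0, w}"] unfolding U(3) w(3) .
  have "card (points_in A ?L) = ?p ^ d + 1"
  proof -
    let ?x = "card (points_in A ?L)"
    have M1: "?p ^ d > 1" using k1 cK by simp
    have "?x mod ?p ^ d = 1 mod ?p ^ d" using mod1 unfolding cong_def .
    also have "\<dots> = 1" by (rule mod_less[OF M1])
    finally have "?x mod ?p ^ d = 1" .
    hence xe: "?x = ?p ^ d * (?x div ?p ^ d) + 1" by (metis div_mult_mod_eq mult.commute)
    have c0: "?x div ?p ^ d \<noteq> 0"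
    proof
      assume "?x div ?p ^ d = 0" thus False using xe two by simp
    qed
    (* more than 2 * p ^ d points, each with at least p - 1 vectors, do not fit into p ^ Suc
       d - 1 vectors *)
    have c2: "?x div ?p ^ d < 2"
    proof (rule ccontr)
      assume "\<not> ?thesis"
      hence "?p ^ d * 2 \<le> ?p ^ d * (?x div ?p ^ d)" by (intro mult_left_mono) auto
      hence "?p ^ d * 2 + 1 \<le> ?x" using xe by linarith
      hence "(?p ^ d * 2 + 1) * (?p - 1) \<le> ?x * (?p - 1)" by (rule mult_right_mono) simp
      also have "\<dots> \<le> ?p ^ Suc d - 1" by (rule up)
      finally have le: "(?p ^ d * 2 + 1) * (?p - 1) \<le> ?p * ?p ^ d - 1" by simp
      obtain s where s: "?p = Suc (Suc s)" using p2 by (metis Suc_1 Suc_le_D Suc_le_mono le_Suc_ex add_2_eq_Suc)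
      have "(?p ^ d * 2 + 1) * (?p - 1) = ?p ^ d * 2 + 1 + (?p ^ d * 2 + 1) * s" using s by simp
      moreover have "?p * ?p ^ d = 2 * ?p ^ d + s * ?p ^ d" by (subst (1) s) simp
      moreover have "s * ?p ^ d \<le> (?p ^ d * 2 + 1) * s" by simp
      ultimately show False using le M1 by linarith
    qed
    have "?x div ?p ^ d = 1" using c0 c2 by linarith
    thus ?thesis using xe by simp
  qed
  thus thesis using that[OF de cK U'(1) cU' U'A vA w(2)] by blast
qed

section \<open>From codimension k to larger subspaces\<close>

definition hyperplane :: "'a::field ^ 'n \<Rightarrow> ('a ^ 'n) set" where
  "hyperplane \<phi> = {x. dot \<phi> x = 0}"

lemma subspace_over_hyperplane: "subspace_over K (hyperplane \<phi>)"
  unfolding subspace_over_def hyperplane_def by (auto simp: dot_add_right dot_scale_right)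

text \<open>
  By the size of \<open>perp L\<close>, not all forms that vanish on \<open>L\<close> vanish at \<open>b\<close>.
\<close>

lemma separating_form:
  fixes L :: "('a::{field,finite} ^ 'n) set"
  assumes L: "subspace_over UNIV L" and b: "b \<notin> L"
  obtains \<phi> where "\<And>x. x \<in> L \<Longrightarrow> dot \<phi> x = 0" "dot \<phi> b \<noteq> 0"
proof -
  have "perp (adjoin UNIV b L) \<noteq> perp L"
  proof
    assume eq: "perp (adjoin UNIV b L) = perp L"
    have "card (perp L) > 0" using subspace_over_zero[OF subspace_over_perp, of L] by (auto simp: card_gt_0_iff)
    thus False using card_perp_adjoin[OF L b] card_field_ge2[where 'a='a] unfolding eq by simp
  qed
  then obtain \<phi> where "\<phi> \<in> perp L" "dot b \<phi> \<noteq> 0" unfolding perp_adjoin[OF L] by blast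
  thus thesis using that[of \<phi>] unfolding perp_def by (simp add: dot_commute)
qed

lemma card_Int_hyperplane:
  fixes Z :: "('a::{field,finite} ^ 'n) set"
  assumes Z: "subspace_over UNIV Z" and z: "z \<in> Z" "dot \<phi> z \<noteq> 0"
  shows "card Z = CARD('a) * card (Z \<inter> hyperplane \<phi>)"
proof -
  have "c \<in> dot \<phi> ` Z" for c
  proof -
    have "c = dot \<phi> ((c / dot \<phi> z) *s z)" using z(2) by (simp add: dot_scale_right)
    thus ?thesis using subspace_over_scale[OF Z UNIV_I z(1)] by blast
  qed
  hence "dot \<phi> ` Z = UNIV" by blast
  moreover have "{x \<in> Z. dot \<phi> x = 0} = Z \<inter> hyperplane \<phi>" unfolding hyperplane_def by blast
  ultimately show ?thesis using card_hom[OF Z dot_add_right[of \<phi>]] by simp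
qed

lemma card_points_in_eq_sum:
  fixes B :: "('a::{field,finite} ^ 'n) set set"
  shows "card (points_in B X) = (\<Sum>P\<in>B. if P \<subseteq> X then 1 else 0)"
  by (simp add: points_in_def sum.If_cases Int_def)

text \<open>
  The hyperplanes of a pencil cover the common zeros of \<open>\<phi>\<close> and \<open>\<psi>\<close> exactly \<open>CARD('a) + 1\<close>
  times and all other points exactly once.
\<close>

lemma pencil_count:
  fixes B :: "('a::{field,finite} ^ 'n) set set"
  assumes B: "B \<subseteq> proj_points" and Z: "subspace_over UNIV Z"
  shows "(\<Sum>c\<in>UNIV. card (points_in B (Z \<inter> hyperplane (\<phi> + c *s \<psi>)))) + card (points_in B (Z \<inter> hyperplane \<psi>))
    = card (points_in B Z) + CARD('a) * card (points_in B (Z \<inter> hyperplane \<phi> \<inter> hyperplane \<psi>))"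
proof -
  have "(\<Sum>c\<in>UNIV. if P \<subseteq> Z \<inter> hyperplane (\<phi> + c *s \<psi>) then 1 else 0) + (if P \<subseteq> Z \<inter> hyperplane \<psi> then 1 else 0)
    = (if P \<subseteq> Z then 1 else 0) + CARD('a) * (if P \<subseteq> Z \<inter> hyperplane \<phi> \<inter> hyperplane \<psi> then 1 else (0::nat))"
    if P: "P \<in> B" for P
  proof -
    obtain v where v: "v \<noteq> 0" "P = vec.span {v}" using B P proj_pointsE by blast
    have iff: "P \<subseteq> X \<longleftrightarrow> v \<in> X" if "subspace_over UNIV X" for X
      unfolding v(2) by (rule span_singleton_subset_iff[OF that])
    have i1: "P \<subseteq> Z \<inter> hyperplane \<phi>' \<longleftrightarrow> v \<in> Z \<and> dot \<phi>' v = 0" for \<phi>'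
      using iff[OF subspace_over_Int[OF Z subspace_over_hyperplane]] by (simp add: hyperplane_def)
    have i2: "P \<subseteq> Z \<inter> hyperplane \<phi> \<inter> hyperplane \<psi> \<longleftrightarrow> v \<in> Z \<and> dot \<phi> v = 0 \<and> dot \<psi> v = 0"
      using iff[OF subspace_over_Int[OF subspace_over_Int[OF Z subspace_over_hyperplane] subspace_over_hyperplane]]
      by (simp add: hyperplane_def)
    show ?thesis
    proof (cases "v \<in> Z")
      case False thus ?thesis unfolding i1 i2 iff[OF Z] by simp
    next
      case True
      show ?thesis
      proof (cases "dot \<psi> v = 0")
        case psi: True
        show ?thesis unfolding i1 i2 iff[OF Z] using True psi by (simp add: dot_add_left dot_scale_left)
      next
        case False
        have "dot (\<phi> + c *s \<psi>) v = 0 \<longleftrightarrow> c = - dot \<phi> v / dot \<psi> v" for c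
          using False by (simp add: dot_add_left dot_scale_left field_simps eq_neg_iff_add_eq_0)
        thus ?thesis unfolding i1 i2 iff[OF Z] using True False by simp
      qed
    qed
  qed
  hence "(\<Sum>P\<in>B. (\<Sum>c\<in>UNIV. if P \<subseteq> Z \<inter> hyperplane (\<phi> + c *s \<psi>) then 1 else 0) + (if P \<subseteq> Z \<inter> hyperplane \<psi> then 1 else 0))
    = (\<Sum>P\<in>B. (if P \<subseteq> Z then 1 else 0) + CARD('a) * (if P \<subseteq> Z \<inter> hyperplane \<phi> \<inter> hyperplane \<psi> then 1 else (0::nat)))"
    by (rule sum.cong[OF refl])
  thus ?thesis
    unfolding card_points_in_eq_sum sum.distrib sum_distrib_left by (subst sum.swap)
qed

lemma pencil_mod:
  fixes B :: "('a::{field,finite} ^ 'n) set set"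
  assumes B: "B \<subseteq> proj_points" and Z: "subspace_over UNIV Z"
    and 1: "\<And>c. [card (points_in B (Z \<inter> hyperplane (\<phi> + c *s \<psi>))) = 1] (mod m)"
    and 2: "[card (points_in B (Z \<inter> hyperplane \<psi>)) = 1] (mod m)"
  shows "[card (points_in B Z) + CARD('a) * card (points_in B (Z \<inter> hyperplane \<phi> \<inter> hyperplane \<psi>)) = CARD('a) + 1] (mod m)"
proof -
  have "[(\<Sum>c\<in>UNIV. card (points_in B (Z \<inter> hyperplane (\<phi> + c *s \<psi>)))) = (\<Sum>c\<in>(UNIV :: 'a set). 1)] (mod m)"
    by (rule cong_sum) (rule 1)
  from cong_add[OF this 2] show ?thesis unfolding pencil_count[OF B Z] by simp
qed

text \<open>
  Let \<open>Z\<close> contain \<open>W\<close> with index \<open>CARD('a)\<close>. A pencil of hyperplanes of \<open>Z\<close> that contains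
  \<open>W\<close> has its axis in \<open>W\<close>, so the axis has one point of \<open>B\<close> or none. An axis that avoids the
  point of \<open>v\<close> gives \<open>CARD('a) + 1\<close> for the number of points in \<open>Z\<close> modulo \<open>m\<close>, an axis
  through this point gives \<open>1\<close>.
\<close>

lemma one_mod_modulus_dvd:
  fixes B :: "('a::{field,finite} ^ 'n) set set"
  assumes B: "B \<subseteq> proj_points" and k: "1 \<le> k" "k + 2 \<le> CARD('n)"
    and mod: "\<And>W. subspace_over UNIV W \<Longrightarrow> card W = CARD('a) ^ (CARD('n) - k) \<Longrightarrow> [card (points_in B W) = 1] (mod m)"
    and W: "subspace_over UNIV W" "card W = CARD('a) ^ (CARD('n) - k)" "points_in B W = {vec.span {v}}" and v: "v \<noteq> 0"
  shows "m dvd CARD('a)"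
proof -
  let ?q = "CARD('a)"
  have q2: "?q \<ge> 2" by (rule card_field_ge2)
  have "card W < ?q ^ CARD('n)" unfolding W(2) using q2 k by (intro power_strict_increasing) auto
  hence "W \<noteq> UNIV" by auto
  then obtain b where b: "b \<notin> W" by blast
  define Z where "Z = adjoin UNIV b W"
  have Z: "subspace_over UNIV Z" unfolding Z_def by (rule subspace_over_adjoin[OF is_subfield_UNIV W(1)])
  have bZ: "b \<in> Z" and WZ: "W \<subseteq> Z" unfolding Z_def using subspace_over_zero[OF W(1)]
    by (auto intro: adjoin_mem adjoin_superset[THEN subsetD])
  have cZ: "card Z = ?q * card W" unfolding Z_def by (rule card_adjoin[OF is_subfield_UNIV W(1) b])
  obtain \<psi> where \<psi>: "\<And>x. x \<in> W \<Longrightarrow> dot \<psi> x = 0" "dot \<psi> b \<noteq> 0" using separating_form[OF W(1) b] by blast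
  have hyp: "card (Z \<inter> hyperplane \<phi>) = ?q ^ (CARD('n) - k)" if "z \<in> Z" "dot \<phi> z \<noteq> 0" for \<phi> z
    using card_Int_hyperplane[OF Z that] cZ W(2) q2 by simp
  have mh: "[card (points_in B (Z \<inter> hyperplane \<phi>)) = 1] (mod m)" if "z \<in> Z" "dot \<phi> z \<noteq> 0" for \<phi> z
    by (rule mod[OF subspace_over_Int[OF Z subspace_over_hyperplane] hyp[OF that]])
  have WZe: "Z \<inter> hyperplane \<psi> = W"
  proof (rule sym, rule card_subset_eq)
    show "W \<subseteq> Z \<inter> hyperplane \<psi>" using WZ \<psi>(1) unfolding hyperplane_def by blast
    show "card W = card (Z \<inter> hyperplane \<psi>)" using hyp[OF bZ \<psi>(2)] W(2) by simp
  qed simp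
  have pen: "[card (points_in B Z) + ?q * card (points_in B (W \<inter> hyperplane \<phi>)) = ?q + 1] (mod m)"
    if w: "w \<in> W" "dot \<phi> w \<noteq> 0" for \<phi> w
  proof -
    have "dot (\<phi> + c *s \<psi>) w \<noteq> 0" for c using w \<psi>(1) by (simp add: dot_add_left dot_scale_left)
    hence "[card (points_in B (Z \<inter> hyperplane (\<phi> + c *s \<psi>))) = 1] (mod m)" for c
      using mh w(1) WZ by blast
    from pencil_mod[OF B Z this mh[OF bZ \<psi>(2)]]
    have "[card (points_in B Z) + ?q * card (points_in B (Z \<inter> hyperplane \<phi> \<inter> hyperplane \<psi>)) = ?q + 1] (mod m)" .
    moreover have "Z \<inter> hyperplane \<phi> \<inter> hyperplane \<psi> = W \<inter> hyperplane \<phi>" using WZe by blast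
    ultimately show ?thesis by simp
  qed
  have vW: "v \<in> W" using W(3) span_singleton_self unfolding points_in_def by blast
  have pW: "points_in B (W \<inter> X) = {P \<in> {vec.span {v}}. P \<subseteq> X}" for X
    using W(3) unfolding points_in_def by blast
  obtain \<phi>1 where \<phi>1: "dot \<phi>1 v = 1" using exists_dot_eq_1[OF v] by blast
  have "\<not> vec.span {v} \<subseteq> hyperplane \<phi>1"
    unfolding span_singleton_subset_iff[OF subspace_over_hyperplane] using \<phi>1 by (simp add: hyperplane_def)
  hence "points_in B (W \<inter> hyperplane \<phi>1) = {}" unfolding pW by blast
  hence 1: "[card (points_in B Z) = ?q + 1] (mod m)" using pen[OF vW, of \<phi>1] \<phi>1 by simp
  have "card (vec.span {v}) < card W"
  proof -
    have "?q ^ 1 < ?q ^ (CARD('n) - k)" using q2 k by (intro power_strict_increasing) auto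
    thus ?thesis unfolding W(2) card_span_singleton[OF v] by simp
  qed
  hence "\<not> W \<subseteq> vec.span {v}" using card_mono[of "vec.span {v}" W] by auto
  then obtain w where w: "w \<in> W" "w \<notin> vec.span {v}" by blast
  obtain \<phi>2 where \<phi>2: "\<And>x. x \<in> vec.span {v} \<Longrightarrow> dot \<phi>2 x = 0" "dot \<phi>2 w \<noteq> 0"
    using separating_form[OF subspace_over_span w(2)] by blast
  have "points_in B (W \<inter> hyperplane \<phi>2) = {vec.span {v}}"
    unfolding pW using \<phi>2(1) by (auto simp: hyperplane_def)
  hence 2: "[card (points_in B Z) + ?q = ?q + 1] (mod m)" using pen[OF w(1) \<phi>2(2)] by simp
  from cong_trans[OF 2 cong_sym[OF 1]] have "[card (points_in B Z) + ?q = card (points_in B Z)] (mod m)" .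
  thus ?thesis by (simp only: cong_add_lcancel_0_nat cong_0_iff)
qed

text \<open>
  Since \<open>m\<close> divides \<open>CARD('a)\<close>, the axis of a pencil drops out of the count modulo \<open>m\<close>.
\<close>

lemma one_mod_larger_subspaces:
  fixes B :: "('a::{field,finite} ^ 'n) set set"
  assumes B: "B \<subseteq> proj_points" and r: "1 \<le> r" and dvd: "m dvd CARD('a)"
    and mod: "\<And>W. subspace_over UNIV W \<Longrightarrow> card W = CARD('a) ^ r \<Longrightarrow> [card (points_in B W) = 1] (mod m)"
    and Z: "subspace_over UNIV Z" and cZ: "CARD('a) ^ r \<le> card Z"
  shows "[card (points_in B Z) = 1] (mod m)"
proof -
  let ?q = "CARD('a)"
  have q2: "?q \<ge> 2" by (rule card_field_ge2)
  have "subspace_over UNIV Z \<Longrightarrow> card Z = ?q ^ (r + i) \<Longrightarrow> [card (points_in B Z) = 1] (mod m)" for i and Z :: "('a ^ 'n) set"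
  proof (induction i arbitrary: Z)
    case 0 thus ?case using mod by simp
  next
    case (Suc i)
    note Z = Suc.prems(1)
    have nonzero: "\<exists>z\<in>X. z \<noteq> 0" if X: "?q ^ j \<le> card X" "j \<ge> 1" for X :: "('a ^ 'n) set" and j
    proof (rule ccontr)
      assume "\<not> ?thesis"
      hence "X \<subseteq> {0}" by blast
      hence "card X \<le> 1" using card_mono[of "{0}" X] by simp
      moreover have "?q ^ 1 \<le> ?q ^ j" using q2 X(2) by (intro power_increasing) auto
      ultimately show False using X(1) q2 by simp
    qed
    obtain z where z: "z \<in> Z" "z \<noteq> 0" using nonzero[of "r + Suc i" Z] Suc.prems(2) r by auto
    obtain \<psi> where \<psi>: "dot \<psi> z = 1" using exists_dot_eq_1[OF z(2)] by blast
    have hyp: "card (Z \<inter> hyperplane \<phi>) = ?q ^ (r + i)" if "z \<in> Z" "dot \<phi> z \<noteq> 0" for \<phi> z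
      using card_Int_hyperplane[OF Z that] Suc.prems(2) q2 by simp
    have mh: "[card (points_in B (Z \<inter> hyperplane \<phi>)) = 1] (mod m)" if "z \<in> Z" "dot \<phi> z \<noteq> 0" for \<phi> z
      by (rule Suc.IH[OF subspace_over_Int[OF Z subspace_over_hyperplane] hyp[OF that]])
    have \<psi>z: "dot \<psi> z \<noteq> 0" using \<psi> by simp
    have "\<exists>w\<in>Z \<inter> hyperplane \<psi>. w \<noteq> 0"
      by (rule nonzero[of "r + i"]) (use hyp[OF z(1) \<psi>z] r in simp_all)
    then obtain w where w: "w \<in> Z \<inter> hyperplane \<psi>" "w \<noteq> 0" by blast
    obtain \<phi> where \<phi>: "dot \<phi> w = 1" using exists_dot_eq_1[OF w(2)] by blast
    have "dot (\<phi> + c *s \<psi>) w \<noteq> 0" for c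
      using w(1) \<phi> by (simp add: dot_add_left dot_scale_left hyperplane_def)
    hence "[card (points_in B (Z \<inter> hyperplane (\<phi> + c *s \<psi>))) = 1] (mod m)" for c using mh w(1) by blast
    from pencil_mod[OF B Z this mh[OF z(1) \<psi>z]]
    have *: "[card (points_in B Z) + ?q * card (points_in B (Z \<inter> hyperplane \<phi> \<inter> hyperplane \<psi>)) = ?q + 1] (mod m)" .
    obtain a where a: "?q = m * a" using dvd by (rule dvdE)
    have "[card (points_in B Z) + m * (a * card (points_in B (Z \<inter> hyperplane \<phi> \<inter> hyperplane \<psi>))) = m * a + 1] (mod m)"
      using * unfolding a by (simp only: mult.assoc)
    thus ?case unfolding cong_def by (simp only: mod_mult_self2 mod_mult_self4)
  qed
  moreover obtain j where j: "card Z = ?q ^ j" using card_subspace_over[OF is_subfield_UNIV Z] by blast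
  have "r \<le> j" using cZ unfolding j by (rule power_le_imp_le_exp[rotated]) (use q2 in simp)
  hence "j = r + (j - r)" by simp
  ultimately show ?thesis using Z j by metis
qed

section \<open>Lines of a small blocking set\<close>

lemma card_points_line_le:
  fixes B :: "('a::{field,finite} ^ 'n) set set"
  assumes B: "B \<subseteq> proj_points" and L: "subspace_over UNIV L" "card L \<le> CARD('a) ^ 2"
  shows "card (points_in B L) \<le> CARD('a) + 1"
proof -
  let ?q = "CARD('a)"
  have q2: "?q \<ge> 2" by (rule card_field_ge2)
  have "points_in B L \<subseteq> linear_set L"
  proof
    fix P assume P: "P \<in> points_in B L"
    then obtain v where v: "v \<noteq> 0" "P = vec.span {v}" using B proj_pointsE unfolding points_in_def by blast
    have "v \<in> L" using P v(2) span_singleton_self unfolding points_in_def by blast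
    thus "P \<in> linear_set L" using linear_setI v by blast
  qed
  hence 1: "card (points_in B L) \<le> card (linear_set L)" by (rule card_mono[rotated]) simp
  have "(\<Sum>P\<in>linear_set L. ?q - 1) = (\<Sum>P\<in>linear_set L. card (L \<inter> P) - 1)"
  proof (rule sum.cong[OF refl])
    fix P assume "P \<in> linear_set L"
    then obtain u where u: "u \<in> L" "u \<noteq> 0" "P = vec.span {u}" by (rule linear_setE)
    have "L \<inter> P = P" using u span_singleton_subset_iff[OF L(1)] by blast
    thus "?q - 1 = card (L \<inter> P) - 1" using card_span_singleton[OF u(2)] u(3) by simp
  qed
  also have "\<dots> = card L - 1" by (rule sum_all_weights[OF L(1)])
  also have "\<dots> \<le> ?q ^ 2 - 1" using L(2) by simp
  also have "?q ^ 2 - 1 = (?q + 1) * (?q - 1)" using q2 by (cases "?q") (simp_all add: power2_eq_square)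
  finally have "card (linear_set L) * (?q - 1) \<le> (?q + 1) * (?q - 1)" by simp
  hence "card (linear_set L) \<le> ?q + 1" by (rule mult_right_le_imp_le) (use q2 in simp)
  thus ?thesis using 1 by simp
qed

text \<open>
  The lines through one point of \<open>B\<close> in \<open>W\<close> partition the other points, and each carries a
  multiple of \<open>M\<close> of them.
\<close>

lemma one_mod_of_lines:
  fixes B :: "('a::{field,finite} ^ 'n) set set"
  assumes B: "B \<subseteq> proj_points" and W: "subspace_over UNIV W" and ne: "points_in B W \<noteq> {}"
    and lines: "\<And>v w. vec.span {v} \<in> B \<Longrightarrow> vec.span {w} \<in> B \<Longrightarrow> w \<notin> vec.span {v} \<Longrightarrow>
      [card (points_in B (vec.span {v, w})) = 1] (mod M)"
  shows "[card (points_in B W) = 1] (mod M)"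
proof -
  obtain P where P: "P \<in> points_in B W" using ne by blast
  then obtain v where v: "v \<noteq> 0" "P = vec.span {v}" using B proj_pointsE unfolding points_in_def by blast
  have PB: "P \<in> B" "P \<subseteq> W" using P unfolding points_in_def by blast+
  have vW: "v \<in> W" using PB(2) v(2) span_singleton_self by blast
  define S where "S = points_in B W - {P}"
  define line where "line = (\<lambda>Q. vec.span (insert v Q))"
  have fibre: "{Q \<in> S. line Q = l} = points_in B l - {P}" and dvd_fibre: "M dvd card (points_in B l - {P})" if l: "l \<in> line ` S" for l
  proof -
    obtain R where R: "R \<in> S" "l = line R" using l by blast
    obtain w where w: "w \<noteq> 0" "R = vec.span {w}" using B R(1) proj_pointsE unfolding S_def points_in_def by blast
    have RB: "R \<in> B" "R \<subseteq> W" "R \<noteq> P" using R(1) unfolding S_def points_in_def by blast+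
    have wW: "w \<in> W" using RB(2) w(2) span_singleton_self by blast
    have wv: "w \<notin> vec.span {v}" using span_singleton_eq[of w v] w v RB(3) by metis
    have le: "l = vec.span {v, w}" unfolding R(2) line_def w(2) by (rule span_insert_span_singleton)
    have lW: "l \<subseteq> W" unfolding le span_subset_iff[OF W] using vW wW by simp
    show "{Q \<in> S. line Q = l} = points_in B l - {P}"
    proof (intro equalityI subsetI)
      fix Q assume Q: "Q \<in> {Q \<in> S. line Q = l}"
      hence "Q \<subseteq> l" unfolding line_def using vec.span_superset[of "insert v Q"] by blast
      thus "Q \<in> points_in B l - {P}" using Q unfolding S_def points_in_def by blast
    next
      fix Q assume Q: "Q \<in> points_in B l - {P}"
      hence QB: "Q \<in> B" "Q \<subseteq> l" "Q \<noteq> P" unfolding points_in_def by blast+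
      obtain u where u: "u \<noteq> 0" "Q = vec.span {u}" using B QB(1) proj_pointsE by blast
      have "u \<in> vec.span {v, w}" using QB(2) u(2) span_singleton_self le by blast
      moreover have "u \<notin> vec.span {v}" using span_singleton_eq[of u v] u v QB(3) by metis
      ultimately have "vec.span {v, u} = vec.span {v, w}" by (rule span_pair_eq)
      hence "line Q = l" unfolding le line_def u(2) span_insert_span_singleton .
      thus "Q \<in> {Q \<in> S. line Q = l}" using QB lW unfolding S_def points_in_def by blast
    qed
    have Pl: "P \<in> points_in B l" unfolding points_in_def le v(2) using PB(1) v(2) vec.span_mono[of "{v}" "{v, w}"] by simp
    have "[card (points_in B l) = 1] (mod M)" unfolding le using lines PB(1) RB(1) v(2) w(2) wv by blast
    moreover have "card (points_in B l) = card (points_in B l - {P}) + 1"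
      using Pl by (metis Suc_eq_plus1 card_Suc_Diff1 finite)
    ultimately have "[card (points_in B l - {P}) + 1 = 0 + 1] (mod M)" by simp
    hence "[card (points_in B l - {P}) = 0] (mod M)" by (simp only: cong_add_rcancel_nat)
    thus "M dvd card (points_in B l - {P})" by (simp only: cong_0_iff)
  qed
  have "S = (\<Union>l\<in>line ` S. {Q \<in> S. line Q = l})" by blast
  hence "card S = card (\<Union>l\<in>line ` S. {Q \<in> S. line Q = l})" by simp
  also have "\<dots> = (\<Sum>l\<in>line ` S. card {Q \<in> S. line Q = l})"
    by (rule card_UN_disjoint) auto
  also have "M dvd \<dots>" by (rule dvd_sum) (simp add: fibre dvd_fibre)
  finally have "M dvd card S" .
  moreover have "card (points_in B W) = card S + 1"
    using P unfolding S_def by (metis Suc_eq_plus1 card_Suc_Diff1 finite)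
  moreover obtain c where "card S = M * c" using \<open>M dvd card S\<close> by (rule dvdE)
  ultimately show ?thesis unfolding cong_def by (simp only: mod_mult_self4)
qed

text \<open>
  The situation after the congruence has been extended to all subspaces of codimension at
  most \<open>k\<close>. The bound on the size is the one below which the gap of the second moment
  applies.
\<close>

locale small_one_mod_set =
  fixes B :: "('a::{field,finite} ^ 'n) set set" and k e m :: nat
  assumes linear_sections: "\<forall>A :: ('a ^ 'n) set set. small_minimal_blocking_set 1 A \<longrightarrow> linear_point_set A"
    and points: "B \<subseteq> proj_points" and k: "1 \<le> k" "k + 2 \<le> CARD('n)"
    and m: "m = CHAR('a) ^ e" "m \<ge> 12" and m_dvd: "m dvd CARD('a)"
    and one_mod: "\<And>Z. subspace_over UNIV Z \<Longrightarrow> CARD('a) ^ (CARD('n) - k) \<le> card Z \<Longrightarrow> [card (points_in B Z) = 1] (mod m)"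
    and small: "real (card B) < (real m - 2) * real CARD('a) ^ k"
begin

lemma q_gt_1: "1 < CARD('a)" using card_field_ge2[where 'a='a] by simp

lemma one_mod_common_zeros:
  assumes "j \<le> k" shows "[card (points_in B (common_zeros f j)) = 1] (mod m)"
proof (rule one_mod[OF subspace_over_common_zeros])
  have "CARD('a) ^ j * CARD('a) ^ (CARD('n) - j) \<le> CARD('a) ^ j * card (common_zeros f j)"
    using card_common_zeros[of j f] assms k by (simp flip: power_add)
  hence "CARD('a) ^ (CARD('n) - j) \<le> card (common_zeros f j)" using q_gt_1 by simp
  moreover have "CARD('a) ^ (CARD('n) - k) \<le> CARD('a) ^ (CARD('n) - j)" using assms q_gt_1 by (intro power_increasing) auto
  ultimately show "CARD('a) ^ (CARD('n) - k) \<le> card (common_zeros f j)" by linarith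
qed

lemma size_B: "real (card B) * (real m - 2) \<le> (real m - 1) * real CARD('a) ^ k"
  by (rule size_gap[OF points m(2) one_mod_common_zeros small]) simp

lemma size_B': "real (card B) \<le> 11 / 10 * real CARD('a) ^ k"
  by (rule eleven_tenths_bound[OF size_B]) (use m(2) in auto)

text \<open>
  Subspaces of projective dimension \<open>n - k + 1\<close>. The \<open>(n - k)\<close>-spaces are the hyperplanes of
  a section, so \<open>B\<close> cuts out a set that behaves like a 1-blocking set.
\<close>

definition is_section :: "('a ^ 'n) set \<Rightarrow> bool" where
  "is_section X \<longleftrightarrow> subspace_over UNIV X \<and> card X = CARD('a) ^ Suc (CARD('n) - k)"

text \<open>
  Below this threshold the gap in the possible sizes applies to the points of \<open>B\<close> in \<open>X\<close>.
\<close>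

definition small_section :: "('a ^ 'n) set \<Rightarrow> bool" where
  "small_section X \<longleftrightarrow> is_section X \<and> real (card (points_in B X)) < (real m - 2) * real CARD('a)"

lemma section_one_mod:
  assumes "is_section X"
  shows "[card (points_in (points_in B X) (common_zeros f 1)) = 1] (mod m)"
  unfolding points_in_points_in
proof (rule one_mod)
  have X: "subspace_over UNIV X" "card X = CARD('a) ^ Suc (CARD('n) - k)" using assms unfolding is_section_def by auto
  show "subspace_over UNIV (X \<inter> common_zeros f 1)" by (rule subspace_over_Int[OF X(1) subspace_over_common_zeros])
  have "X \<inter> common_zeros f 1 = {x \<in> X. dot (f 0) x = 0}" unfolding common_zeros_def by auto
  hence "card X \<le> CARD('a) * card (X \<inter> common_zeros f 1)" using card_kernel_le[OF X(1), of "f 0"] by simp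
  thus "CARD('a) ^ (CARD('n) - k) \<le> card (X \<inter> common_zeros f 1)" unfolding X(2) using q_gt_1 by simp
qed

lemma points_in_B: "points_in B X \<subseteq> proj_points" using points unfolding points_in_def by blast

lemma small_section_linear:
  assumes X: "small_section X"
  obtains d U v w where "d \<ge> e" "card (frobenius_fixed d :: 'a set) = CHAR('a) ^ d"
    "subspace_over (frobenius_fixed d) U" "card U = CHAR('a) ^ d * CARD('a)" "linear_set U = points_in B X"
    "vec.span {v} \<in> points_in B X" "vec.span {w} \<in> points_in B X" "w \<notin> vec.span {v}"
    "card (points_in (points_in B X) (vec.span {v, w})) = CHAR('a) ^ d + 1"
proof -
  have X': "is_section X" "real (card (points_in B X)) < (real m - 2) * real CARD('a)"
    using X unfolding small_section_def by auto
  have n: "2 \<le> CARD('n)" using k by simp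
  show thesis
    by (rule linear_section[OF linear_sections n points_in_B m section_one_mod[OF X'(1)] X'(2)]) (rule that)
qed

lemma section_size:
  assumes "is_section X"
  shows "CARD('a) \<le> card (points_in B X)"
proof -
  have "1 \<le> card (points_in (points_in B X) (common_zeros f 1))" for f
  proof (rule ccontr)
    assume "\<not> ?thesis"
    hence "card (points_in (points_in B X) (common_zeros f 1)) = 0" by linarith
    thus False using section_one_mod[OF assms, of f] m(2) by (simp add: cong_def)
  qed
  from all_many_points[OF subspace_over_zero_space points_in_B this]
  show ?thesis using points_in_zero[OF points_in_B] by simp
qed

text \<open>
  On average a section through \<open>L\<close> has at most \<open>q + 1 + 11 / 10 * q\<close> points of \<open>B\<close>, where
  \<open>q\<close> is \<open>CARD('a)\<close>: a line has at most \<open>q + 1\<close> points, and a point outside \<open>L\<close> lies in the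
  fraction \<open>1 / q ^ (k - 1)\<close> of the sections.
\<close>

lemma line_in_small_section:
  assumes L: "subspace_over UNIV L" "card L \<le> CARD('a) ^ 2"
  obtains X where "small_section X" "L \<subseteq> X"
proof -
  let ?x = "card (points_in B L)"
  obtain f where f: "f \<in> forms L (k - 1)" and le:
    "CARD('a) ^ (k - 1) * card (points_in B (common_zeros f (k - 1))) \<le> CARD('a) ^ (k - 1) * ?x + (card B - ?x)"
    using exists_few_points[OF L(1) points] by blast
  let ?Z = "common_zeros f (k - 1)"
  have LZ: "L \<subseteq> ?Z" by (rule common_zeros_superset[OF f])
  have "CARD('a) ^ (k - 1) * CARD('a) ^ (CARD('n) - (k - 1)) \<le> CARD('a) ^ (k - 1) * card ?Z"
    using card_common_zeros[of "k - 1" f] k by (simp flip: power_add)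
  hence "CARD('a) ^ (CARD('n) - (k - 1)) \<le> card ?Z" using q_gt_1 by simp
  moreover have "CARD('n) - (k - 1) = Suc (CARD('n) - k)" using k by simp
  ultimately have cZ: "CARD('a) ^ Suc (CARD('n) - k) \<le> card ?Z" by (simp only:)
  have "CARD('a) ^ 2 \<le> CARD('a) ^ Suc (CARD('n) - k)" using k q_gt_1 by (intro power_increasing) auto
  hence "card L \<le> CARD('a) ^ Suc (CARD('n) - k)" using L(2) by linarith
  then obtain X where X: "subspace_over UNIV X" "L \<subseteq> X" "X \<subseteq> ?Z" "card X = CARD('a) ^ Suc (CARD('n) - k)"
    using intermediate_subspace[OF is_subfield_UNIV L(1) subspace_over_common_zeros LZ _ cZ] by blast
  have "?x \<le> CARD('a) + 1" by (rule card_points_line_le[OF points L])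
  hence "CARD('a) ^ (k - 1) * card (points_in B ?Z) \<le> CARD('a) ^ (k - 1) * (CARD('a) + 1) + card B"
    using le mult_le_mono2[of ?x "CARD('a) + 1" "CARD('a) ^ (k - 1)"] by linarith
  hence "real (CARD('a) ^ (k - 1) * card (points_in B ?Z)) \<le> real (CARD('a) ^ (k - 1) * (CARD('a) + 1) + card B)" by (rule of_nat_mono)
  hence "real CARD('a) ^ (k - 1) * real (card (points_in B ?Z)) \<le> real CARD('a) ^ (k - 1) * (real CARD('a) + 1) + real (card B)"
    by (simp add: algebra_simps)
  also have "\<dots> \<le> real CARD('a) ^ (k - 1) * (real CARD('a) + 1) + 11 / 10 * real CARD('a) ^ k" using size_B' by simp
  also have "real CARD('a) ^ k = real CARD('a) ^ (k - 1) * real CARD('a)" by (rule power_minus_mult[symmetric]) (use k in simp)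
  finally have "real CARD('a) ^ (k - 1) * real (card (points_in B ?Z)) \<le> real CARD('a) ^ (k - 1) * (real CARD('a) + 1 + 11 / 10 * real CARD('a))"
    by (simp add: algebra_simps)
  hence "real (card (points_in B ?Z)) \<le> real CARD('a) + 1 + 11 / 10 * real CARD('a)" using q_gt_1 by simp
  moreover have "card (points_in B X) \<le> card (points_in B ?Z)" by (rule card_mono[OF _ points_in_mono[OF X(3)]]) simp
  moreover have "10 * real CARD('a) \<le> (real m - 2) * real CARD('a)" using m(2) by (intro mult_right_mono) auto
  ultimately have "real (card (points_in B X)) < (real m - 2) * real CARD('a)" using q_gt_1 by linarith
  thus thesis using that X unfolding small_section_def is_section_def by blast
qed

lemma line_one_mod:
  assumes "points_in B (vec.span {v, w}) \<noteq> {}" "v \<noteq> 0" "w \<notin> vec.span {v}"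
  shows "[card (points_in B (vec.span {v, w})) = 1] (mod m)"
proof -
  let ?L = "vec.span {v, w}"
  obtain X where X: "small_section X" "?L \<subseteq> X"
    using line_in_small_section[OF subspace_over_span] card_span_pair[OF assms(2,3)] by (metis order_refl)
  obtain d U where U: "d \<ge> e" "card (frobenius_fixed d :: 'a set) = CHAR('a) ^ d"
    "subspace_over (frobenius_fixed d) U" "linear_set U = points_in B X"
    using small_section_linear[OF X(1)] by metis
  have eq: "points_in (linear_set U) ?L = points_in B ?L"
    unfolding U(4) points_in_points_in using X(2) by (simp add: Int_absorb1)
  have "[card (points_in B ?L) = 1] (mod CHAR('a) ^ d)"
    using linear_set_mod[OF is_subfield_frobenius_fixed U(3) subspace_over_span, of "{v, w}"] assms(1)
    unfolding eq U(2) by blast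
  moreover have "m dvd CHAR('a) ^ d" unfolding m(1) using U(1) by (rule le_imp_power_dvd)
  ultimately show ?thesis by (rule cong_dvd_modulus_nat)
qed

end

section \<open>Secants and weights\<close>

text \<open>
  The parts of \<open>U\<close> in two distinct points form a direct sum.
\<close>

lemma card_two_points_weights_le:
  fixes U :: "('a::{field,finite} ^ 'n) set"
  assumes U: "subspace_over K U" and Z: "subspace_over UNIV Z"
    and P: "P \<in> points_in (linear_set U) Z" and Q: "Q \<in> points_in (linear_set U) Z" and ne: "P \<noteq> Q"
  shows "card (U \<inter> P) * card (U \<inter> Q) \<le> card (U \<inter> Z)"
proof -
  obtain u v where u: "P = vec.span {u}" and v: "Q = vec.span {v}" and u0: "u \<noteq> 0" and v0: "v \<noteq> 0"
    using P Q unfolding points_in_def by (auto elim!: linear_setE)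
  have sub: "P \<subseteq> Z" "Q \<subseteq> Z" using P Q unfolding points_in_def by blast+
  have PQ: "x = 0" if "x \<in> P" "x \<in> Q" for x using that ne span_singleton_eq u v by metis
  have inj: "inj_on (\<lambda>(x, y). x + y) ((U \<inter> P) \<times> (U \<inter> Q))"
  proof (rule inj_onI, clarify)
    fix a b a' b' assume *: "a \<in> P" "b \<in> Q" "a' \<in> P" "b' \<in> Q" "a + b = a' + b'"
    have "a - a' = b' - b" using *(5) by (simp add: algebra_simps)
    moreover have "a - a' \<in> P" using * unfolding u by (simp add: vec.span_diff)
    moreover have "b' - b \<in> Q" using * unfolding v by (simp add: vec.span_diff)
    ultimately have "a - a' = 0" "b' - b = 0" using PQ by metis+
    thus "a = a' \<and> b = b'" by simp
  qed
  have "card (U \<inter> P) * card (U \<inter> Q) = card ((\<lambda>(x, y). x + y) ` ((U \<inter> P) \<times> (U \<inter> Q)))"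
    unfolding card_image[OF inj] by (simp add: card_cartesian_product)
  also have "\<dots> \<le> card (U \<inter> Z)"
  proof (rule card_mono)
    show "(\<lambda>(x, y). x + y) ` ((U \<inter> P) \<times> (U \<inter> Q)) \<subseteq> U \<inter> Z"
    proof clarify
      fix a b assume ab: "a \<in> U" "a \<in> P" "b \<in> U" "b \<in> Q"
      have "a \<in> Z" "b \<in> Z" using ab sub by blast+
      thus "a + b \<in> U \<inter> Z" using subspace_over_add[OF U ab(1,3)] subspace_over_add[OF Z] by blast
    qed
  qed simp
  finally show ?thesis .
qed

text \<open>
  The \<open>m + 1\<close> weights are powers of \<open>m\<close>. If one of them was \<open>m ^ a\<close> with \<open>a \<ge> 2\<close> and
  \<open>card (U \<inter> Z) = m ^ (a + c)\<close>, each of the other \<open>m\<close> weights would be at most \<open>m ^ c\<close>, and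
  \<open>m ^ a + m * m ^ c\<close> is too little for all vectors of \<open>U \<inter> Z\<close>.
\<close>

lemma secant_weights:
  fixes U :: "('a::{field,finite} ^ 'n) set"
  assumes K: "is_subfield K" "card K = m" and U: "subspace_over K U" and Z: "subspace_over UNIV Z"
    and card: "card (points_in (linear_set U) Z) = m + 1"
  shows "card (U \<inter> Z) = m ^ 2" and "\<And>P. P \<in> points_in (linear_set U) Z \<Longrightarrow> card (U \<inter> P) = m"
proof -
  let ?A = "points_in (linear_set U) Z"
  have m2: "m \<ge> 2" using card_subfield_ge2[OF K(1)] K(2) by simp
  obtain r where r: "card (U \<inter> Z) = m ^ r"
    using card_subspace_over[OF K(1) subspace_over_Int[OF U subspace_over_mono[OF Z subset_UNIV]]] K(2) by blast
  have wt: "\<exists>a\<ge>1. card (U \<inter> P) = m ^ a" if P: "P \<in> ?A" for P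
  proof -
    have PA: "P \<in> linear_set U" using P unfolding points_in_def by blast
    have s: "subspace_over K (U \<inter> P)" using U subspace_over_linear_set_point[OF PA] by (rule subspace_over_Int)
    obtain a where a: "card (U \<inter> P) = m ^ a" using card_subspace_over[OF K(1) s] K(2) by blast
    obtain u where u: "u \<in> U" "u \<noteq> 0" "P = vec.span {u}" using PA by (rule linear_setE)
    have "u \<in> U \<inter> P" using u span_singleton_self by blast
    from card_dvd_subspace_over[OF K(1) s this u(2)] have "m dvd m ^ a" using a K(2) by simp
    hence "a \<noteq> 0" using m2 by (intro notI) simp
    thus ?thesis using a by (intro exI[of _ a]) simp
  qed
  have sumw: "(\<Sum>P\<in>?A. card (U \<inter> P) - 1) = m ^ r - 1" using sum_weights[OF U Z] r by simp
  have light: "card (U \<inter> P) = m" if P: "P \<in> ?A" for P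
  proof (rule ccontr)
    assume not: "card (U \<inter> P) \<noteq> m"
    obtain a where a: "a \<ge> 1" "card (U \<inter> P) = m ^ a" using wt[OF P] by blast
    have a2: "a \<ge> 2" using not a by (cases "a = 1") auto
    have others: "card (?A - {P}) = m" using P card by simp
    then obtain Q where Q: "Q \<in> ?A - {P}" using m2 by (metis card.empty ex_in_conv not_numeral_le_zero)
    obtain b where b: "b \<ge> 1" "card (U \<inter> Q) = m ^ b" using wt[of Q] Q by blast
    have prod: "m ^ a * card (U \<inter> R) \<le> m ^ r" if "R \<in> ?A - {P}" for R
      using card_two_points_weights_le[OF U Z P, of R] that unfolding a(2) r by blast
    have "m ^ (a + b) \<le> m ^ r" using prod[OF Q] b(2) by (simp add: power_add)
    hence "a + b \<le> r" by (rule power_le_imp_le_exp[rotated]) (use m2 in simp)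
    hence ar: "a + 1 \<le> r" using b by simp
    then obtain c where c: "r = a + c" "c \<ge> 1" by (metis add_le_cancel_left le_Suc_ex add.assoc le_add1)
    have le: "card (U \<inter> R) \<le> m ^ c" if "R \<in> ?A - {P}" for R
    proof -
      have "m ^ a * card (U \<inter> R) \<le> m ^ a * m ^ c" using prod[OF that] unfolding c(1) power_add .
      thus ?thesis using m2 by simp
    qed
    have "m ^ r - 1 = (card (U \<inter> P) - 1) + (\<Sum>R\<in>?A - {P}. card (U \<inter> R) - 1)"
      unfolding sumw[symmetric] by (rule sum.remove[OF _ P]) simp
    also have "(\<Sum>R\<in>?A - {P}. card (U \<inter> R) - 1) \<le> (\<Sum>R\<in>?A - {P}. m ^ c - 1)"
    proof (rule sum_mono)
      fix R assume "R \<in> ?A - {P}"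
      from le[OF this] show "card (U \<inter> R) - 1 \<le> m ^ c - 1" by simp
    qed
    also have "(\<Sum>R\<in>?A - {P}. m ^ c - 1) = m * (m ^ c - 1)" using others by simp
    finally have "m ^ r - 1 \<le> (m ^ a - 1) + m * (m ^ c - 1)" using a(2) by simp
    moreover have "m * (m ^ c - 1) = m ^ Suc c - m" by (simp add: right_diff_distrib')
    moreover have "m ^ Suc c \<ge> m" using m2 by simp
    moreover have "m ^ a \<ge> 1" "m ^ r \<ge> 1" using m2 by simp_all
    ultimately have 1: "m ^ r + m \<le> m ^ a + m ^ Suc c" by linarith
    have "m ^ a \<le> m ^ (r - 1)" using m2 ar by (intro power_increasing) auto
    moreover have "m ^ Suc c \<le> m ^ (r - 1)" using m2 a2 c by (intro power_increasing) auto
    moreover have "2 * m ^ (r - 1) \<le> m ^ r"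
    proof -
      have "m ^ r = m * m ^ (r - 1)" using ar by (metis Suc_eq_plus1 add_eq_if le_zero_eq add_is_0 one_neq_zero power_Suc diff_Suc_1 not0_implies_Suc)
      thus ?thesis using m2 by simp
    qed
    ultimately show False using 1 m2 by linarith
  qed
  thus "\<And>P. P \<in> ?A \<Longrightarrow> card (U \<inter> P) = m" .
  have "(\<Sum>P\<in>?A. card (U \<inter> P) - 1) = (\<Sum>P\<in>?A. m - 1)" by (rule sum.cong[OF refl]) (simp add: light)
  also have "\<dots> = (m + 1) * (m - 1)" using card by simp
  also have "\<dots> = m ^ 2 - 1" using m2 by (cases m) (simp_all add: power2_eq_square)
  finally have "m ^ r - 1 = m ^ 2 - 1" unfolding sumw .
  moreover have "m ^ r \<ge> 1" "m ^ 2 \<ge> 1" using m2 by simp_all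
  ultimately show "card (U \<inter> Z) = m ^ 2" unfolding r by linarith
qed

text \<open>
  Next to a point of weight \<open>m\<close> every other point has weight at most \<open>m\<close>, hence exactly \<open>m\<close>.
\<close>

lemma light_line_is_secant:
  fixes U :: "('a::{field,finite} ^ 'n) set"
  assumes K: "is_subfield K" "card K = m" and U: "subspace_over K U" and Z: "subspace_over UNIV Z"
    and P: "P \<in> points_in (linear_set U) Z" "card (U \<inter> P) = m" and card: "card (U \<inter> Z) = m ^ 2"
  shows "card (points_in (linear_set U) Z) = m + 1"
proof -
  let ?A = "points_in (linear_set U) Z"
  have m2: "m \<ge> 2" using card_subfield_ge2[OF K(1)] K(2) by simp
  have wt: "card (U \<inter> Q) = m" if Q: "Q \<in> ?A" for Q
  proof (cases "Q = P")
    case False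
    have QA: "Q \<in> linear_set U" using Q unfolding points_in_def by blast
    have s: "subspace_over K (U \<inter> Q)" using U subspace_over_linear_set_point[OF QA] by (rule subspace_over_Int)
    obtain u where u: "u \<in> U" "u \<noteq> 0" "Q = vec.span {u}" using QA by (rule linear_setE)
    have uQ: "u \<in> U \<inter> Q" using u span_singleton_self by blast
    have "m dvd card (U \<inter> Q)" using card_dvd_subspace_over[OF K(1) s uQ u(2)] K(2) by simp
    moreover have "card (U \<inter> Q) > 0" using uQ by (auto simp: card_gt_0_iff)
    ultimately have "m \<le> card (U \<inter> Q)" by (rule dvd_imp_le)
    moreover have "m * card (U \<inter> Q) \<le> m * m"
      using card_two_points_weights_le[OF U Z P(1) Q] False P(2) card by (simp add: power2_eq_square)
    ultimately show ?thesis using m2 by simp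
  qed (use P in simp)
  have "(\<Sum>Q\<in>?A. card (U \<inter> Q) - 1) = (\<Sum>Q\<in>?A. m - 1)" by (rule sum.cong[OF refl]) (simp add: wt)
  hence "card ?A * (m - 1) = m ^ 2 - 1" using sum_weights[OF U Z] card by simp
  also have "\<dots> = (m + 1) * (m - 1)" using m2 by (cases m) (simp_all add: power2_eq_square)
  finally have "card ?A = m + 1 \<or> m - 1 = 0" by (simp only: mult_cancel2)
  thus ?thesis using m2 by simp
qed

context small_one_mod_set
begin

text \<open>
  By the congruence modulo \<open>m\<close> these are the lines with the least possible number of points
  of \<open>B\<close> above \<open>1\<close>. They are the lines that determine the field and the group of a section.
\<close>

definition secant :: "'a ^ 'n \<Rightarrow> 'a ^ 'n \<Rightarrow> bool" where
  "secant v w \<longleftrightarrow> w \<notin> vec.span {v} \<and> card (points_in B (vec.span {v, w})) = m + 1"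

text \<open>
  A line that violates the congruence for the next power of the characteristic lies in a
  small section. This section cannot be linear over a larger field than the one of order
  \<open>m\<close>, and every small section contains a line with one point more than the order of its
  field.
\<close>

lemma exists_secant:
  assumes vw: "vec.span {v} \<in> B" "v \<noteq> 0" "w \<notin> vec.span {v}"
    and not: "\<not> [card (points_in B (vec.span {v, w})) = 1] (mod CHAR('a) ^ Suc e)"
  obtains v' w' where "vec.span {v'} \<in> B" "vec.span {w'} \<in> B" "secant v' w'"
proof -
  let ?L = "vec.span {v, w}"
  obtain X where X: "small_section X" "?L \<subseteq> X"
    using line_in_small_section[OF subspace_over_span] card_span_pair[OF vw(2,3)] by (metis order_refl)
  obtain d U v' w' where U: "d \<ge> e" "card (frobenius_fixed d :: 'a set) = CHAR('a) ^ d"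
    "subspace_over (frobenius_fixed d) U" "linear_set U = points_in B X"
    and v': "vec.span {v'} \<in> points_in B X" "vec.span {w'} \<in> points_in B X" "w' \<notin> vec.span {v'}"
    "card (points_in (points_in B X) (vec.span {v', w'})) = CHAR('a) ^ d + 1"
    using small_section_linear[OF X(1)] by metis
  have eq: "points_in (linear_set U) ?L = points_in B ?L"
    unfolding U(4) points_in_points_in using X(2) by (simp add: Int_absorb1)
  have "vec.span {v} \<in> points_in B ?L" unfolding points_in_def using vw(1) vec.span_mono[of "{v}" "{v, w}"] by simp
  hence 1: "[card (points_in B ?L) = 1] (mod CHAR('a) ^ d)"
    using linear_set_mod[OF is_subfield_frobenius_fixed U(3) subspace_over_span, of "{v, w}"]
    unfolding eq U(2) by blast
  have "d = e"
  proof (rule ccontr)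
    assume "d \<noteq> e"
    hence "Suc e \<le> d" using U(1) by simp
    hence "CHAR('a) ^ Suc e dvd CHAR('a) ^ d" by (rule le_imp_power_dvd)
    thus False using cong_dvd_modulus_nat[OF 1] not by blast
  qed
  have "subspace_over UNIV X" using X(1) unfolding small_section_def is_section_def by blast
  hence "vec.span {v', w'} \<subseteq> X" using v'(1,2) span_singleton_self
    unfolding span_subset_iff[OF \<open>subspace_over UNIV X\<close>] points_in_def by blast
  hence "points_in (points_in B X) (vec.span {v', w'}) = points_in B (vec.span {v', w'})"
    unfolding points_in_points_in by (simp add: Int_absorb1)
  hence "secant v' w'" unfolding secant_def using v'(3,4) m(1) \<open>d = e\<close> by simp
  thus thesis using that v'(1,2) unfolding points_in_def by blast
qed

text \<open>
  Multiplying \<open>U\<close> by a scalar does not change its linear set; requiring \<open>v \<in> U\<close> makes the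
  groups of different sections comparable.
\<close>

definition section_group :: "'a ^ 'n \<Rightarrow> ('a ^ 'n) set \<Rightarrow> ('a ^ 'n) set \<Rightarrow> bool" where
  "section_group v X U \<longleftrightarrow> card (frobenius_fixed e :: 'a set) = m \<and> subspace_over (frobenius_fixed e) U \<and>
    card U = m * CARD('a) \<and> linear_set U = points_in B X \<and> v \<in> U"

text \<open>
  The secant forces the field of the section to have order \<open>m\<close>, as \<open>m + 1\<close> is congruent to
  \<open>1\<close> modulo this order.
\<close>

lemma exists_section_group:
  assumes X: "small_section X" and v: "vec.span {v} \<in> B" "v \<in> X" and w: "w \<in> X" and sec: "secant v w"
  obtains U where "section_group v X U"
proof -
  have sX: "subspace_over UNIV X" using X unfolding small_section_def is_section_def by blast
  obtain d U where U: "d \<ge> e" "card (frobenius_fixed d :: 'a set) = CHAR('a) ^ d"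
    "subspace_over (frobenius_fixed d) U" "card U = CHAR('a) ^ d * CARD('a)" "linear_set U = points_in B X"
    using small_section_linear[OF X] by metis
  let ?L = "vec.span {v, w}"
  have LX: "?L \<subseteq> X" unfolding span_subset_iff[OF sX] using v w by simp
  have eq: "points_in (linear_set U) ?L = points_in B ?L"
    unfolding U(5) points_in_points_in using LX by (simp add: Int_absorb1)
  have c: "card (points_in B ?L) = m + 1" using sec unfolding secant_def by blast
  hence "points_in B ?L \<noteq> {}" by auto
  hence "[m + 1 = 0 + 1] (mod CHAR('a) ^ d)"
    using linear_set_mod[OF is_subfield_frobenius_fixed U(3) subspace_over_span, of "{v, w}"] c
    unfolding eq U(2) by simp
  hence "[m = 0] (mod CHAR('a) ^ d)" by (simp only: cong_add_rcancel_nat)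
  hence "CHAR('a) ^ d dvd CHAR('a) ^ e" unfolding m(1) by (simp only: cong_0_iff)
  hence "CHAR('a) ^ d \<le> CHAR('a) ^ e" using prime_gt_0_nat[OF prime_CHAR_finite[where 'a='a]] by (intro dvd_imp_le) auto
  hence "d \<le> e" by (rule power_le_imp_le_exp[rotated]) (rule prime_gt_1_nat[OF prime_CHAR_finite])
  hence de: "d = e" using U(1) by simp
  have "vec.span {v} \<in> linear_set U"
    unfolding U(5) points_in_def using v span_singleton_subset_iff[OF sX] by blast
  then obtain u where u: "u \<in> U" "u \<noteq> 0" "vec.span {v} = vec.span {u}" by (rule linear_setE)
  then obtain c where c: "v = c *s u" using span_singleton_self[of v] mem_span_singleton by blast
  have v0: "v \<noteq> 0" using sec u unfolding secant_def by (metis span_singleton_self mem_span_singleton vec.scale_zero_right)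
  hence c0: "c \<noteq> 0" using c by auto
  define U' where "U' = (\<lambda>x. c *s x) ` U"
  have "subspace_over (frobenius_fixed d) U'"
    unfolding subspace_over_def U'_def
  proof (intro conjI ballI)
    show "0 \<in> (\<lambda>x. c *s x) ` U" using subspace_over_zero[OF U(3)] by (auto intro!: image_eqI[of _ _ 0])
    show "x + y \<in> (\<lambda>x. c *s x) ` U" if "x \<in> (\<lambda>x. c *s x) ` U" "y \<in> (\<lambda>x. c *s x) ` U" for x y
      using that subspace_over_add[OF U(3)] by (auto simp flip: vec.scale_right_distrib)
    show "a *s x \<in> (\<lambda>x. c *s x) ` U" if a: "a \<in> frobenius_fixed d" and x: "x \<in> (\<lambda>x. c *s x) ` U" for a x
    proof -
      obtain y where y: "y \<in> U" "x = c *s y" using x by blast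
      have "a *s x = c *s (a *s y)" unfolding y(2) by (simp add: mult.commute)
      thus ?thesis using subspace_over_scale[OF U(3) a y(1)] by blast
    qed
  qed
  moreover have "card U' = card U" unfolding U'_def using c0 by (intro card_image) (simp add: inj_on_def)
  moreover have "linear_set U' = linear_set U"
  proof (intro equalityI subsetI)
    fix P assume "P \<in> linear_set U'"
    then obtain x where x: "x \<in> U'" "x \<noteq> 0" "P = vec.span {x}" by (rule linear_setE)
    then obtain y where y: "y \<in> U" "x = c *s y" unfolding U'_def by blast
    have "y \<noteq> 0" using x(2) y(2) by auto
    thus "P \<in> linear_set U" unfolding x(3) y(2) span_singleton_scale[OF c0] by (rule linear_setI[OF y(1)])
  next
    fix P assume "P \<in> linear_set U"
    then obtain x where x: "x \<in> U" "x \<noteq> 0" "P = vec.span {x}" by (rule linear_setE)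
    have "c *s x \<in> U'" "c *s x \<noteq> 0" using x c0 unfolding U'_def by auto
    from linear_setI[OF this] show "P \<in> linear_set U'" unfolding x(3) span_singleton_scale[OF c0] .
  qed
  moreover have "v \<in> U'" unfolding U'_def c using u(1) by blast
  ultimately have "section_group v X U'" unfolding section_group_def using U de m(1) by simp
  thus thesis by (rule that)
qed

lemma section_group_secant:
  assumes g: "section_group v X U" and X: "subspace_over UNIV X" and v: "v \<noteq> 0" "v \<in> X"
    and w: "w \<in> X" and sec: "secant v w"
  shows "card (U \<inter> vec.span {v, w}) = m ^ 2" and "card (U \<inter> vec.span {v}) = m"
proof -
  have U: "card (frobenius_fixed e :: 'a set) = m" "subspace_over (frobenius_fixed e) U"
    "linear_set U = points_in B X" "v \<in> U" using g unfolding section_group_def by auto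
  let ?L = "vec.span {v, w}"
  have LX: "?L \<subseteq> X" unfolding span_subset_iff[OF X] using v w by simp
  have "points_in (linear_set U) ?L = points_in B ?L"
    unfolding U(3) points_in_points_in using LX by (simp add: Int_absorb1)
  hence c: "card (points_in (linear_set U) ?L) = m + 1" using sec unfolding secant_def by simp
  show "card (U \<inter> ?L) = m ^ 2"
    by (rule secant_weights(1)[OF is_subfield_frobenius_fixed U(1,2) subspace_over_span c])
  have "vec.span {v} \<in> points_in (linear_set U) ?L"
    unfolding points_in_def using linear_setI[OF U(4) v(1)] vec.span_mono[of "{v}" "{v, w}"] by simp
  thus "card (U \<inter> vec.span {v}) = m"
    by (rule secant_weights(2)[OF is_subfield_frobenius_fixed U(1,2) subspace_over_span c])
qed

lemma section_group_secant_vector: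
  assumes g: "section_group v X U" and X: "subspace_over UNIV X" and v: "v \<noteq> 0" "v \<in> X"
    and w: "w \<in> X" and sec: "secant v w"
  obtains u where "u \<in> U" "u \<notin> vec.span {v}" "card (U \<inter> vec.span {v, u}) = m ^ 2"
proof -
  note wts = section_group_secant[OF assms]
  have "\<not> U \<inter> vec.span {v, w} \<subseteq> U \<inter> vec.span {v}"
  proof
    assume "U \<inter> vec.span {v, w} \<subseteq> U \<inter> vec.span {v}"
    hence "card (U \<inter> vec.span {v, w}) \<le> card (U \<inter> vec.span {v})" by (rule card_mono[rotated]) simp
    hence "m ^ 2 \<le> m" unfolding wts .
    thus False using m(2) by (simp add: power2_eq_square)
  qed
  then obtain u where u: "u \<in> U" "u \<in> vec.span {v, w}" "u \<notin> vec.span {v}" by blast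
  have "card (U \<inter> vec.span {v, u}) = m ^ 2" unfolding span_pair_eq[OF u(2,3)] by (rule wts(1))
  thus thesis using that u(1,3) by blast
qed

text \<open>
  The membership test does not mention \<open>X\<close> or \<open>U\<close>; this is what allows the groups of
  different sections to be glued. Only the direction from right to left needs an argument.
  On the secant, \<open>U\<close> is spanned over the field of order \<open>m\<close> by \<open>v\<close> and a multiple \<open>l *s w\<close>.
  It also contains a multiple \<open>k *s (v + w)\<close>, and comparing coefficients shows that \<open>k\<close> and
  \<open>k / l\<close> belong to the field.
\<close>

lemma section_group_mem_iff:
  assumes g: "section_group v X U" and X: "subspace_over UNIV X" and v: "v \<noteq> 0" "v \<in> X"
    and w: "w \<in> X" and sec: "secant v w"
  shows "w \<in> U \<longleftrightarrow> vec.span {w} \<in> B \<and> vec.span {v + w} \<in> B"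
proof
  have U: "card (frobenius_fixed e :: 'a set) = m" "subspace_over (frobenius_fixed e) U"
    "linear_set U = points_in B X" "v \<in> U" using g unfolding section_group_def by auto
  have wv: "w \<notin> vec.span {v}" using sec unfolding secant_def by blast
  have w0: "w \<noteq> 0" using wv vec.span_zero by metis
  have vw0: "v + w \<noteq> 0"
  proof
    assume "v + w = 0"
    hence "w = (- 1) *s v" by (metis add.inverse_unique add.commute vector_sneg_minus1)
    thus False using wv mem_span_singleton by blast
  qed
  {
    assume wU: "w \<in> U"
    have "vec.span {w} \<in> linear_set U" "vec.span {v + w} \<in> linear_set U"
      using linear_setI[OF wU w0] linear_setI[OF subspace_over_add[OF U(2,4) wU] vw0] by blast+
    thus "vec.span {w} \<in> B \<and> vec.span {v + w} \<in> B" unfolding U(3) points_in_def by blast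
  next
    assume Bs: "vec.span {w} \<in> B \<and> vec.span {v + w} \<in> B"
    let ?K = "frobenius_fixed e :: 'a set"
    have sK: "is_subfield ?K" by (rule is_subfield_frobenius_fixed)
    have vwX: "v + w \<in> X" by (rule subspace_over_add[OF X v(2) w])
    have ex: "\<exists>c. c \<noteq> 0 \<and> c *s x \<in> U" if x: "vec.span {x} \<in> B" "x \<in> X" for x
    proof -
      have "vec.span {x} \<in> linear_set U" unfolding U(3) points_in_def using x span_singleton_subset_iff[OF X] by blast
      then obtain u where u: "u \<in> U" "u \<noteq> 0" "vec.span {x} = vec.span {u}" by (rule linear_setE)
      then obtain c where "u = c *s x" using span_singleton_self[of u] mem_span_singleton by blast
      thus ?thesis using u by auto
    qed
    obtain l where l: "l \<noteq> 0" "l *s w \<in> U" using ex Bs w by blast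
    obtain k where k: "k \<noteq> 0" "k *s (v + w) \<in> U" using ex Bs vwX by blast
    let ?W1 = "adjoin ?K v {0}"
    let ?W = "adjoin ?K (l *s w) ?W1"
    have s1: "subspace_over ?K ?W1" by (rule subspace_over_adjoin[OF sK subspace_over_zero_space])
    have c1: "card ?W1 = m" using card_adjoin[OF sK subspace_over_zero_space, of v] v(1) U(1) by simp
    have sub1: "?W1 \<subseteq> vec.span {v}" unfolding adjoin_def using mem_span_singleton by auto
    have "l *s w \<notin> vec.span {v}"
    proof
      assume "l *s w \<in> vec.span {v}"
      hence "inverse l *s (l *s w) \<in> vec.span {v}" by (rule vec.span_scale)
      thus False using wv l(1) by simp
    qed
    hence "l *s w \<notin> ?W1" using sub1 by blast
    hence c2: "card ?W = m ^ 2" using card_adjoin[OF sK s1] c1 U(1) by (simp add: power2_eq_square)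
    have "?W1 \<subseteq> U" using adjoin_subset[OF U(2) _ U(4)] subspace_over_zero[OF U(2)] by simp
    hence WU: "?W \<subseteq> U" by (rule adjoin_subset[OF U(2) _ l(2)])
    have "?W \<subseteq> vec.span {v, w}"
    proof
      fix x assume "x \<in> ?W"
      then obtain y b where y: "y \<in> ?W1" "x = y + b *s (l *s w)" unfolding adjoin_def[of _ _ ?W1] by blast
      obtain a where "y = a *s v" using y(1) sub1 mem_span_singleton by blast
      hence "x = a *s v + (b * l) *s w" using y(2) by simp
      thus "x \<in> vec.span {v, w}" unfolding mem_span_pair by blast
    qed
    (* U meets the secant in m ^ 2 vectors, as many as the span of v and l *s w over the
       field has *)
    hence W: "?W = U \<inter> vec.span {v, w}"
      using WU section_group_secant(1)[OF g X v w sec] c2 by (intro card_subset_eq) auto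
    have "k *s (v + w) = k *s v + k *s w" by (simp add: vec.scale_right_distrib)
    hence "k *s (v + w) \<in> vec.span {v, w}" unfolding mem_span_pair by blast
    hence "k *s (v + w) \<in> ?W" unfolding W using k(2) by blast
    then obtain y b where y: "y \<in> ?W1" "b \<in> ?K" "k *s (v + w) = y + b *s (l *s w)" unfolding adjoin_def[of _ _ ?W1] by blast
    then obtain a where a: "a \<in> ?K" "y = a *s v" unfolding adjoin_def by auto
    have e1: "(k - a) *s v = (b * l - k) *s w"
      using y(3) unfolding a(2) by (simp add: vec.scale_right_distrib vec.scale_left_diff_distrib algebra_simps)
    have bl: "b * l = k"
    proof (rule ccontr)
      assume ne: "b * l \<noteq> k"
      have "w = (inverse (b * l - k) * (k - a)) *s v"
        using arg_cong[OF e1, of "\<lambda>x. inverse (b * l - k) *s x"] ne by simp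
      thus False using wv mem_span_singleton by blast
    qed
    hence "(k - a) *s v = 0" using e1 by simp
    hence ka: "k = a" using v(1) by simp
    have b0: "b \<noteq> 0" using bl k(1) by auto
    have "inverse a \<in> ?K" using sK a(1) k(1) ka unfolding is_subfield_def by blast
    hence "inverse a * b \<in> ?K" using sK y(2) unfolding is_subfield_def by blast
    hence "(inverse a * b) *s (l *s w) \<in> U" using subspace_over_scale[OF U(2)] l(2) by blast
    moreover have "(inverse a * b) *s (l *s w) = w"
      using bl ka k(1) by (simp add: mult.assoc)
    ultimately show "w \<in> U" by simp
  }
qed

end

section \<open>The subspaces through a fixed subspace\<close>

definition extensions :: "('a::field ^ 'n) set \<Rightarrow> ('a ^ 'n) set set" where
  "extensions M = {adjoin UNIV x M | x. x \<notin> M}"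

lemma extensionsD:
  fixes M :: "('a::{field,finite} ^ 'n) set"
  assumes M: "subspace_over UNIV M" and X: "X \<in> extensions M"
  shows "subspace_over UNIV X" "M \<subseteq> X" "card X = CARD('a) * card M"
  using X subspace_over_adjoin[OF is_subfield_UNIV M] adjoin_superset[of UNIV M] card_adjoin[OF is_subfield_UNIV M]
  unfolding extensions_def by auto

lemma adjoin_eq_extension:
  fixes M :: "('a::{field,finite} ^ 'n) set"
  assumes M: "subspace_over UNIV M" and X: "X \<in> extensions M" and y: "y \<in> X" "y \<notin> M"
  shows "adjoin UNIV y M = X"
proof (rule card_subset_eq)
  show "adjoin UNIV y M \<subseteq> X" by (rule adjoin_subset[OF extensionsD(1,2)[OF M X] y(1)])
  show "card (adjoin UNIV y M) = card X"
    using card_adjoin[OF is_subfield_UNIV M y(2)] extensionsD(3)[OF M X] by simp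
qed simp

lemma extensions_Int:
  fixes M :: "('a::{field,finite} ^ 'n) set"
  assumes M: "subspace_over UNIV M" and "X \<in> extensions M" "Y \<in> extensions M" "X \<noteq> Y"
  shows "X \<inter> Y = M"
  using adjoin_eq_extension[OF M] extensionsD(2)[OF M] assms(2-4) by blast

text \<open>
  The extensions cover the vectors outside \<open>M\<close>, and each covers \<open>(CARD('a) - 1) * card M\<close> of
  them.
\<close>

lemma card_extensions:
  fixes M :: "('a::{field,finite} ^ 'n) set"
  assumes M: "subspace_over UNIV M" and card: "CARD('a) ^ k * card M = CARD('a) ^ CARD('n)" and k: "1 \<le> k"
  shows "CARD('a) ^ (k - 1) \<le> card (extensions M)"
proof -
  let ?q = "CARD('a)" and ?t = "card (extensions M)"
  have q2: "?q \<ge> 2" by (rule card_field_ge2)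
  have M0: "card M > 0" using subspace_over_zero[OF M] by (auto simp: card_gt_0_iff)
  have "UNIV - M \<subseteq> (\<Union>X\<in>extensions M. X - M)"
  proof
    fix x assume "x \<in> UNIV - M"
    hence x: "x \<notin> M" by simp
    have "adjoin UNIV x M \<in> extensions M" unfolding extensions_def using x by blast
    moreover have "x \<in> adjoin UNIV x M" using subspace_over_zero[OF M] by (intro adjoin_mem) auto
    ultimately show "x \<in> (\<Union>X\<in>extensions M. X - M)" using x by blast
  qed
  hence "card (UNIV - M) \<le> card (\<Union>X\<in>extensions M. X - M)" by (rule card_mono[rotated]) simp
  also have "\<dots> \<le> (\<Sum>X\<in>extensions M. card (X - M))" by (rule card_UN_le) simp
  also have "\<dots> = (\<Sum>X\<in>extensions M. (?q - 1) * card M)"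
  proof (rule sum.cong[OF refl])
    fix X assume "X \<in> extensions M"
    thus "card (X - M) = (?q - 1) * card M"
      using extensionsD[OF M] by (subst card_Diff_subset) (auto simp: diff_mult_distrib)
  qed
  also have "\<dots> = ?t * (?q - 1) * card M" by simp
  finally have "card (UNIV :: ('a ^ 'n) set) - card M \<le> ?t * (?q - 1) * card M"
    by (subst (asm) card_Diff_subset) auto
  hence "?q ^ k * card M \<le> (?t * (?q - 1) + 1) * card M" using card by simp
  hence le: "?q ^ k \<le> ?t * (?q - 1) + 1" by (rule mult_right_le_imp_le) (rule M0)
  show ?thesis
  proof (rule ccontr)
    assume "\<not> ?thesis"
    hence "?t + 1 \<le> ?q ^ (k - 1)" by simp
    hence "(?t + 1) * (?q - 1) \<le> ?q ^ (k - 1) * (?q - 1)" by (rule mult_right_mono) simp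
    also have "\<dots> = ?q ^ (k - 1) * ?q - ?q ^ (k - 1)" by (simp add: diff_mult_distrib2)
    also have "?q ^ (k - 1) * ?q = ?q ^ k" by (rule power_minus_mult) (use k in simp)
    finally have "?t * (?q - 1) + (?q - 1) + ?q ^ (k - 1) \<le> ?q ^ k"
      using q2 by (simp add: le_diff_conv2 power_increasing)
    moreover have "?q ^ (k - 1) \<ge> 1" using q2 by simp
    ultimately show False using le q2 by linarith
  qed
qed

section \<open>Gluing the groups of the sections\<close>

context small_one_mod_set
begin

text \<open>
  By the membership test these vectors are all vectors on secants through \<open>v\<close> that belong to
  the groups of the small sections containing \<open>v\<close>, normalised by \<open>v\<close>.
\<close>

definition secant_vectors :: "'a ^ 'n \<Rightarrow> ('a ^ 'n) set" where
  "secant_vectors v = {w. vec.span {w} \<in> B \<and> vec.span {v + w} \<in> B \<and> secant v w}"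

lemma section_group_subset:
  assumes g: "section_group v X U" and X: "subspace_over UNIV X" shows "U \<subseteq> X"
proof
  fix u assume u: "u \<in> U"
  show "u \<in> X"
  proof (cases "u = 0")
    case False
    have "vec.span {u} \<in> points_in B X" using linear_setI[OF u False] g unfolding section_group_def by blast
    thus ?thesis using span_singleton_self unfolding points_in_def by blast
  qed (use subspace_over_zero[OF X] in simp)
qed

lemma exponent_pos: "e > 0"
  using m by (intro gr0I) simp

text \<open>
  The field of order \<open>m\<close> of a small section is a proper subfield.
\<close>

lemma square_le_order:
  assumes v: "vec.span {v} \<in> B" "v \<noteq> 0" and sec: "secant v w" and mq: "m < CARD('a)"
  shows "m ^ 2 \<le> CARD('a)"
proof -
  have wv: "w \<notin> vec.span {v}" using sec unfolding secant_def by blast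
  obtain X where X: "small_section X" "vec.span {v, w} \<subseteq> X"
    using line_in_small_section[OF subspace_over_span] card_span_pair[OF v(2) wv] by (metis order_refl)
  have vw: "v \<in> vec.span {v, w}" "w \<in> vec.span {v, w}" by (rule vec.span_base, simp)+
  obtain U where "section_group v X U"
    by (rule exists_section_group[OF X(1) v(1) _ _ sec]) (use X(2) vw in blast)+
  hence c: "card (frobenius_fixed e :: 'a set) = m" unfolding section_group_def by blast
  obtain h where h: "CARD('a) = m ^ h"
    using subfield_exponent[OF is_subfield_frobenius_fixed[of e, where 'a='a]] c by metis
  have "h \<noteq> 0"
  proof
    assume "h = 0" thus False using h q_gt_1 by simp
  qed
  moreover have "h \<noteq> 1"
  proof
    assume "h = 1" thus False using h mq by simp
  qed
  ultimately have "2 \<le> h" by simp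
  thus ?thesis unfolding h using m(2) by (intro power_increasing) auto
qed

text \<open>
  In the projection from \<open>v\<close> the lines of weight \<open>m ^ 2\<close> are the points of weight \<open>m\<close>, so
  the bound for heavy vectors applies.
\<close>

lemma section_group_exceptions:
  assumes g: "section_group v X U" and X: "subspace_over UNIV X" and v: "v \<noteq> 0" "v \<in> X"
    and w: "w \<in> X" and sec: "secant v w" and mq: "m < CARD('a)"
  shows "real (card {u \<in> U. u \<in> vec.span {v} \<or> card (U \<inter> vec.span {v, u}) \<noteq> m ^ 2}) * real m
    \<le> real CARD('a) + real m * real CARD('a) - real m ^ 3"
proof -
  let ?q = "CARD('a)"
  have U: "card (frobenius_fixed e :: 'a set) = m" "subspace_over (frobenius_fixed e) U"
    "card U = m * ?q" using g unfolding section_group_def by auto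
  note wts = section_group_secant[OF g X v w sec]
  obtain \<theta> where \<theta>: "dot \<theta> v = 1" using exists_dot_eq_1[OF v(1)] by blast
  define Y where "Y = project \<theta> v ` U"
  have Y: "subspace_over (frobenius_fixed e) Y" unfolding Y_def by (rule subspace_over_project[OF U(2) \<theta>])
  have "card U = card Y * m" using card_project[OF U(2) \<theta>] wts(2) unfolding Y_def by simp
  hence cY: "card Y = ?q" using U(3) m(2) by simp
  obtain u where u: "u \<in> U" "u \<notin> vec.span {v}" "card (U \<inter> vec.span {v, u}) = m ^ 2"
    using section_group_secant_vector[OF g X v w sec] by blast
  have "card (Y \<inter> vec.span {project \<theta> v u}) * m = m ^ 2"
    using card_project_line[OF U(2) \<theta> u(1)] wts(2) u(3) unfolding Y_def by simp
  hence wt: "card (Y \<inter> vec.span {project \<theta> v u}) = m" using m(2) by (simp add: power2_eq_square)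
  have uY: "project \<theta> v u \<in> Y" "project \<theta> v u \<noteq> 0"
    unfolding Y_def using u project_eq_0_iff[OF \<theta>] by blast+
  let ?b = "card {y \<in> Y. y = 0 \<or> card (Y \<inter> vec.span {y}) \<noteq> m}"
  have "real ?b * real m ^ 2 + real m ^ 3 \<le> real ?q + real m * real ?q"
    by (rule heavy_vectors_bound[OF Y cY U(1) m(1) exponent_pos mq uY wt])
  moreover have "card {u \<in> U. u \<in> vec.span {v} \<or> card (U \<inter> vec.span {v, u}) \<noteq> m ^ 2} \<le> ?b * m"
    using card_exceptional_project_le[OF U(2) \<theta>, of m] wts(2) unfolding Y_def by (simp add: power2_eq_square)
  hence "real (card {u \<in> U. u \<in> vec.span {v} \<or> card (U \<inter> vec.span {v, u}) \<noteq> m ^ 2}) \<le> real (?b * m)" by (rule of_nat_mono)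
  hence "real (card {u \<in> U. u \<in> vec.span {v} \<or> card (U \<inter> vec.span {v, u}) \<noteq> m ^ 2}) * real m \<le> real (?b * m) * real m"
    by (rule mult_right_mono) simp
  ultimately show ?thesis by (simp add: power2_eq_square mult.assoc)
qed

lemma secant_vectorsI:
  assumes g: "section_group v X U" and X: "subspace_over UNIV X" and v: "v \<noteq> 0" "v \<in> X"
    and light: "card (U \<inter> vec.span {v}) = m"
    and u: "u \<in> U" "u \<notin> vec.span {v}" "card (U \<inter> vec.span {v, u}) = m ^ 2"
  shows "u \<in> secant_vectors v"
proof -
  have U: "card (frobenius_fixed e :: 'a set) = m" "subspace_over (frobenius_fixed e) U"
    "linear_set U = points_in B X" "v \<in> U" using g unfolding section_group_def by auto
  have uX: "u \<in> X" using section_group_subset[OF g X] u(1) by blast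
  let ?L = "vec.span {v, u}"
  have LX: "?L \<subseteq> X" unfolding span_subset_iff[OF X] using v uX by simp
  have eq: "points_in (linear_set U) ?L = points_in B ?L"
    unfolding U(3) points_in_points_in using LX by (simp add: Int_absorb1)
  have "vec.span {v} \<in> points_in (linear_set U) ?L"
    unfolding points_in_def using linear_setI[OF U(4) v(1)] vec.span_mono[of "{v}" "{v, u}"] by simp
  from light_line_is_secant[OF is_subfield_frobenius_fixed U(1,2) subspace_over_span this light u(3)]
  have "secant v u" unfolding secant_def using u(2) eq by simp
  thus ?thesis unfolding secant_vectors_def
    using section_group_mem_iff[OF g X v uX] u(1) by blast
qed

text \<open>
  On average an \<open>(n - k)\<close>-space through the secant has at most \<open>m + 1 + 11 / 10\<close> points of
  \<open>B\<close>. By the congruence modulo \<open>m\<close> the best one has exactly \<open>m + 1\<close>, all of which lie on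
  the secant.
\<close>

lemma minimal_axis:
  assumes v: "vec.span {v} \<in> B" "v \<noteq> 0" and sec: "secant v w"
  obtains M where "subspace_over UNIV M" "card M = CARD('a) ^ (CARD('n) - k)" "vec.span {v, w} \<subseteq> M"
    "points_in B M = points_in B (vec.span {v, w})"
proof -
  let ?q = "CARD('a)" and ?L = "vec.span {v, w}"
  have wv: "w \<notin> vec.span {v}" and c: "card (points_in B ?L) = m + 1" using sec unfolding secant_def by auto
  obtain f where f: "f \<in> forms ?L k" and le:
    "?q ^ k * card (points_in B (common_zeros f k)) \<le> ?q ^ k * (m + 1) + (card B - (m + 1))"
    using exists_few_points[OF subspace_over_span points, of "{v, w}" k] c by metis
  let ?Z = "common_zeros f k"
  have LZ: "?L \<subseteq> ?Z" by (rule common_zeros_superset[OF f])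
  have "real (?q ^ k * card (points_in B ?Z)) \<le> real (?q ^ k * (m + 1) + card B)"
    using le by (intro of_nat_mono) linarith
  hence "real ?q ^ k * real (card (points_in B ?Z)) \<le> real ?q ^ k * (real m + 1) + 11 / 10 * real ?q ^ k"
    using size_B' by (simp add: algebra_simps)
  hence "real ?q ^ k * real (card (points_in B ?Z)) \<le> real ?q ^ k * (real m + 1 + 11 / 10)" by (simp add: algebra_simps)
  hence "real (card (points_in B ?Z)) \<le> real m + 1 + 11 / 10" using q_gt_1 by simp
  hence up: "card (points_in B ?Z) < 2 * m" using m(2) by linarith
  have "card (points_in B ?L) \<le> card (points_in B ?Z)" by (rule card_mono[OF _ points_in_mono[OF LZ]]) simp
  hence ge: "m + 1 \<le> card (points_in B ?Z)" using c by simp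
  have "[card (points_in B ?Z) = 1] (mod m)" by (rule one_mod_common_zeros) simp
  hence "card (points_in B ?Z) mod m = 1 mod m" unfolding cong_def .
  also have "1 mod m = 1" using m(2) by simp
  finally have "card (points_in B ?Z) = m * (card (points_in B ?Z) div m) + 1" by (metis div_mult_mod_eq mult.commute)
  moreover have "card (points_in B ?Z) div m = 1" using up ge m(2) by (intro div_nat_eqI) auto
  ultimately have cZ: "card (points_in B ?Z) = m + 1" by simp
  have "?q ^ k * ?q ^ (CARD('n) - k) \<le> ?q ^ k * card ?Z"
    using card_common_zeros[of k f] k by (simp flip: power_add)
  hence "?q ^ (CARD('n) - k) \<le> card ?Z" using q_gt_1 by simp
  moreover have "card ?L \<le> ?q ^ (CARD('n) - k)"
    unfolding card_span_pair[OF v(2) wv] using k q_gt_1 by (intro power_increasing) auto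
  ultimately obtain M where M: "subspace_over UNIV M" "?L \<subseteq> M" "M \<subseteq> ?Z" "card M = ?q ^ (CARD('n) - k)"
    using intermediate_subspace[OF is_subfield_UNIV subspace_over_span subspace_over_common_zeros LZ] by blast
  have "points_in B ?L = points_in B ?Z"
    using points_in_mono[OF LZ] c cZ by (intro card_subset_eq) auto
  hence "points_in B M = points_in B ?L" using points_in_mono[OF M(2)] points_in_mono[OF M(3)] by blast
  thus thesis using that M by blast
qed

text \<open>
  Choose an axis \<open>M\<close> through \<open>v\<close> and \<open>w\<close> that meets \<open>B\<close> only on their line. The sections
  through \<open>M\<close> partition the remaining points of \<open>B\<close>; there are at least \<open>CARD('a) ^ (k - 1)\<close>
  of them and nearly all are small. The group of a small section contains \<open>w\<close> and has
  \<open>m * CARD('a)\<close> elements, of which about \<open>CARD('a)\<close> do not belong to \<open>secant_vectors v\<close>. So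
  \<open>u\<close> and \<open>w + u\<close> both belong to this set for all but about \<open>2 * CARD('a)\<close> elements \<open>u\<close> of
  the group.
\<close>

lemma many_sums:
  assumes v: "vec.span {v} \<in> B" "v \<noteq> 0" and w: "w \<in> secant_vectors v" and mq: "m < CARD('a)"
  shows "39 / 40 * (real m - 2 - 1 / 6) * real CARD('a) ^ k \<le>
    real (card {u \<in> secant_vectors v. w + u \<in> secant_vectors v})"
proof -
  let ?q = "CARD('a)" and ?L = "vec.span {v, w}" and ?G = "secant_vectors v"
  have sec: "secant v w" and wB: "vec.span {w} \<in> B" "vec.span {v + w} \<in> B" using w unfolding secant_vectors_def by auto
  obtain M where M: "subspace_over UNIV M" "card M = ?q ^ (CARD('n) - k)" "?L \<subseteq> M" "points_in B M = points_in B ?L"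
    using minimal_axis[OF v sec] by blast
  have cL: "card (points_in B ?L) = m + 1" using sec unfolding secant_def by blast
  have vL: "v \<in> ?L" "w \<in> ?L" by (rule vec.span_base, simp)+
  hence vM: "v \<in> M" "w \<in> M" using M(3) by blast+
  define t where "t = card (extensions M)"
  have "?q ^ k * card M = ?q ^ CARD('n)" unfolding M(2) using k by (simp flip: power_add)
  from card_extensions[OF M(1) this k(1)] have t: "?q ^ (k - 1) \<le> t" unfolding t_def .
  have qk: "real ?q ^ k = real ?q * real ?q ^ (k - 1)" using power_minus_mult[of k "real ?q"] k by (simp add: mult.commute)
  have tq: "real ?q ^ k \<le> real ?q * real t"
  proof -
    have "real (?q ^ (k - 1)) \<le> real t" using t by (rule of_nat_mono)
    thus ?thesis unfolding qk by simp
  qed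
  have is_sec: "is_section X" if "X \<in> extensions M" for X
    using extensionsD[OF M(1) that] M(2) unfolding is_section_def by simp
  define Sm where "Sm = {X \<in> extensions M. small_section X}"
  define g where "g = card (extensions M - Sm)"
  have cSm: "real (card Sm) = real t - real g"
  proof -
    have "card (extensions M - Sm) = card (extensions M) - card Sm" "card Sm \<le> card (extensions M)"
      unfolding Sm_def by (intro card_Diff_subset card_mono, auto)+
    thus ?thesis unfolding t_def g_def by simp
  qed
  have big: "(real m - 2) * real ?q \<le> real (card (points_in B X))" if "X \<in> extensions M - Sm" for X
    using that is_sec[of X] unfolding Sm_def small_section_def by auto
  have MX: "points_in B ?L \<subseteq> points_in B X" if "X \<in> extensions M" for X
    using points_in_mono[of ?L X B] M(3) extensionsD(2)[OF M(1) that] by blast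
  have sumB: "(\<Sum>X\<in>extensions M. real (card (points_in B X)) - (real m + 1)) \<le> real (card B)"
  proof -
    have "(\<Sum>X\<in>extensions M. card (points_in B X - points_in B ?L)) = card (\<Union>X\<in>extensions M. points_in B X - points_in B ?L)"
    proof (rule card_UN_disjoint[symmetric], simp, simp, intro ballI impI)
      fix X Y assume XY: "X \<in> extensions M" "Y \<in> extensions M" "X \<noteq> Y"
      have "points_in B X \<inter> points_in B Y \<subseteq> points_in B (X \<inter> Y)" unfolding points_in_def by blast
      also have "\<dots> = points_in B ?L" unfolding extensions_Int[OF M(1) XY] M(4) ..
      finally show "(points_in B X - points_in B ?L) \<inter> (points_in B Y - points_in B ?L) = {}" by blast
    qed
    also have "\<dots> \<le> card B" by (rule card_mono) (auto simp: points_in_def)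
    finally have "real (\<Sum>X\<in>extensions M. card (points_in B X - points_in B ?L)) \<le> real (card B)" by (rule of_nat_mono)
    moreover have "real (card (points_in B X - points_in B ?L)) = real (card (points_in B X)) - (real m + 1)"
      if "X \<in> extensions M" for X
      using MX[OF that] card_mono[OF _ MX[OF that]] cL by (subst card_Diff_subset) (auto simp: of_nat_diff)
    ultimately show ?thesis by simp
  qed
  (* each of the g large sections has about (m - 2) * q points instead of q, and the total
     is at most 11 / 10 * q * t; with q \<ge> 12 * m \<ge> 144 and m - 3 \<ge> 9 this leaves 9 * g \<le> 9 /
     40 * t *)
  have gt: "40 * real g \<le> real t"
  proof -
    have m2q: "12 * real m \<le> real ?q"
    proof -
      have "12 * m \<le> m ^ 2" using mult_le_mono1[OF m(2), of m] by (simp add: power2_eq_square)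
      hence "12 * m \<le> ?q" using square_le_order[OF v sec mq] by linarith
      thus ?thesis by linarith
    qed
    have q144: "144 \<le> real ?q" using m2q m(2) by simp
    have "(\<Sum>X\<in>extensions M. real (card (points_in B X)) - (real m + 1)) =
      (\<Sum>X\<in>Sm. real (card (points_in B X)) - (real m + 1)) + (\<Sum>X\<in>extensions M - Sm. real (card (points_in B X)) - (real m + 1))"
      by (rule sum.subset_diff[THEN trans, OF _ _ add.commute]) (auto simp: Sm_def)
    moreover have "(\<Sum>X\<in>Sm. real ?q - (real m + 1)) \<le> (\<Sum>X\<in>Sm. real (card (points_in B X)) - (real m + 1))"
    proof (rule sum_mono)
      fix X assume "X \<in> Sm"
      hence "?q \<le> card (points_in B X)" using section_size is_sec unfolding Sm_def by blast
      thus "real ?q - (real m + 1) \<le> real (card (points_in B X)) - (real m + 1)" by simp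
    qed
    moreover have "(\<Sum>X\<in>extensions M - Sm. (real m - 2) * real ?q - (real m + 1)) \<le> (\<Sum>X\<in>extensions M - Sm. real (card (points_in B X)) - (real m + 1))"
    proof (rule sum_mono)
      fix X assume "X \<in> extensions M - Sm"
      from big[OF this] show "(real m - 2) * real ?q - (real m + 1) \<le> real (card (points_in B X)) - (real m + 1)" by simp
    qed
    ultimately have "real (card Sm) * (real ?q - (real m + 1)) + real g * ((real m - 2) * real ?q - (real m + 1)) \<le> real (card B)"
      using sumB unfolding g_def by simp
    hence "(real t - real g) * (real ?q - (real m + 1)) + real g * ((real m - 2) * real ?q - (real m + 1)) \<le> 11 / 10 * (real ?q * real t)"
      unfolding cSm using size_B' tq by linarith
    hence 1: "real g * ((real m - 3) * real ?q) \<le> real t * (1 / 10 * real ?q + real m + 1)" by (simp add: algebra_simps)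
    have "9 * real ?q \<le> (real m - 3) * real ?q" using m(2) by (intro mult_right_mono) auto
    hence "real g * (9 * real ?q) \<le> real g * ((real m - 3) * real ?q)" by (rule mult_left_mono) simp
    also note 1
    also have "real t * (1 / 10 * real ?q + real m + 1) \<le> real t * (9 / 40 * real ?q)"
    proof (rule mult_left_mono)
      show "1 / 10 * real ?q + real m + 1 \<le> 9 / 40 * real ?q" using m2q q144 by linarith
    qed simp
    finally have "real ?q * (40 * real g) \<le> real ?q * real t" by (simp add: algebra_simps)
    thus ?thesis using q_gt_1 by simp
  qed
  let ?S = "{u \<in> ?G. w + u \<in> ?G}"
  have each: "(real m - 2 - 1 / 6) * real ?q \<le> real (card (?S \<inter> (X - M)))" if X: "X \<in> Sm" for X
  proof -
    have XE: "X \<in> extensions M" "small_section X" using X unfolding Sm_def by auto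
    note X' = extensionsD[OF M(1) XE(1)]
    have vX: "v \<in> X" "w \<in> X" using vM X'(2) by blast+
    obtain U where g: "section_group v X U" using exists_section_group[OF XE(2) v(1) vX sec] by blast
    have U: "subspace_over (frobenius_fixed e) U" "card U = m * ?q" "linear_set U = points_in B X"
      using g unfolding section_group_def by auto
    note wts = section_group_secant[OF g X'(1) v(2) vX sec]
    define Ex where "Ex = {u \<in> U. u \<in> vec.span {v} \<or> card (U \<inter> vec.span {v, u}) \<noteq> m ^ 2}"
    have cEx: "real (card Ex) * real m \<le> real ?q + real m * real ?q - real m ^ 3"
      unfolding Ex_def by (rule section_group_exceptions[OF g X'(1) v(2) vX sec mq])
    have good: "u \<in> ?G" if "u \<in> U - Ex" for u
      using secant_vectorsI[OF g X'(1) v(2) vX(1) wts(2)] that unfolding Ex_def by blast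
    have wU: "w \<in> U" using section_group_mem_iff[OF g X'(1) v(2) vX sec] wB by blast
    have UM: "U \<inter> M = U \<inter> ?L"
    proof (intro equalityI subsetI)
      fix u assume u: "u \<in> U \<inter> M"
      show "u \<in> U \<inter> ?L"
      proof (cases "u = 0")
        case True thus ?thesis using u vec.span_zero by simp
      next
        case False
        have "vec.span {u} \<in> points_in B X" using linear_setI[of u U] u False U(3) by blast
        hence "vec.span {u} \<in> points_in B M" unfolding points_in_def using u span_singleton_subset_iff[OF M(1)] by blast
        hence "vec.span {u} \<in> points_in B ?L" unfolding M(4) .
        hence "vec.span {u} \<subseteq> ?L" by (simp add: points_in_def)
        hence "u \<in> ?L" using span_singleton_self by blast
        thus ?thesis using u by simp
      qed
    qed (use M(3) in blast)
    (* u is good if neither u nor w + u is exceptional and u is outside the axis, so that no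
       u is counted in two sections *)
    let ?T = "U - (M \<union> Ex \<union> (\<lambda>x. x - w) ` Ex)"
    have "?T \<subseteq> ?S \<inter> (X - M)"
    proof
      fix u assume u: "u \<in> ?T"
      hence uU: "u \<in> U" "u \<notin> M" "u \<notin> Ex" "u \<notin> (\<lambda>x. x - w) ` Ex" by blast+
      have "w + u \<notin> Ex"
      proof
        assume "w + u \<in> Ex"
        hence "(w + u) - w \<in> (\<lambda>x. x - w) ` Ex" by (rule imageI)
        thus False using uU(4) by simp
      qed
      hence "w + u \<in> ?G" using good subspace_over_add[OF U(1) wU uU(1)] by blast
      moreover have "u \<in> ?G" using good uU by blast
      moreover have "u \<in> X" using section_group_subset[OF g X'(1)] uU(1) by blast
      ultimately show "u \<in> ?S \<inter> (X - M)" using uU(2) by blast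
    qed
    hence 1: "card ?T \<le> card (?S \<inter> (X - M))" by (rule card_mono[rotated]) simp
    have "card U - card (U \<inter> (M \<union> Ex \<union> (\<lambda>x. x - w) ` Ex)) \<le> card ?T"
      using card_Diff_subset_Int[of U "M \<union> Ex \<union> (\<lambda>x. x - w) ` Ex"] by simp
    moreover have "card (U \<inter> (M \<union> Ex \<union> (\<lambda>x. x - w) ` Ex)) \<le> m ^ 2 + card Ex + card Ex"
    proof -
      have "card (U \<inter> (M \<union> Ex \<union> (\<lambda>x. x - w) ` Ex)) \<le> card ((U \<inter> M) \<union> Ex \<union> (\<lambda>x. x - w) ` Ex)"
        by (rule card_mono) auto
      also have "\<dots> \<le> card (U \<inter> M) + card Ex + card ((\<lambda>x. x - w) ` Ex)"
        using card_Un_le[of "(U \<inter> M) \<union> Ex" "(\<lambda>x. x - w) ` Ex"] card_Un_le[of "U \<inter> M" Ex] by linarith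
      also have "card ((\<lambda>x. x - w) ` Ex) \<le> card Ex" by (rule card_image_le) simp
      finally show ?thesis unfolding UM wts(1) by simp
    qed
    ultimately have "m * ?q \<le> card (?S \<inter> (X - M)) + m ^ 2 + 2 * card Ex" using 1 U(2) by linarith
    hence "real (m * ?q) \<le> real (card (?S \<inter> (X - M)) + m ^ 2 + 2 * card Ex)" by (rule of_nat_mono)
    hence "real m * (real m * real ?q) \<le> real m * (real (card (?S \<inter> (X - M))) + real m ^ 2 + 2 * real (card Ex))"
      by (intro mult_left_mono) simp_all
    hence "real m * (real m * real ?q) \<le> real m * real (card (?S \<inter> (X - M))) + real m ^ 3 + 2 * (real (card Ex) * real m)"
      by (simp add: algebra_simps power2_eq_square power3_eq_cube)
    hence 2: "real m * (real m * real ?q) \<le> real m * real (card (?S \<inter> (X - M))) + 2 * real ?q + 2 * (real m * real ?q) - real m ^ 3"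
      using cEx by linarith
    have "2 * real ?q \<le> (real m / 6) * real ?q" using m(2) by (intro mult_right_mono) auto
    moreover have "real m ^ 3 \<ge> 0" by simp
    ultimately have "real m * (real m * real ?q) \<le> real m * real (card (?S \<inter> (X - M))) + (real m / 6) * real ?q + 2 * (real m * real ?q)"
      using 2 by linarith
    hence "real m * ((real m - 2 - 1 / 6) * real ?q) \<le> real m * real (card (?S \<inter> (X - M)))"
      by (simp add: algebra_simps)
    thus ?thesis using m(2) by simp
  qed
  have "(\<Sum>X\<in>Sm. card (?S \<inter> (X - M))) = card (\<Union>X\<in>Sm. ?S \<inter> (X - M))"
  proof (rule card_UN_disjoint[symmetric], simp, simp, intro ballI impI)
    fix X Y assume XY: "X \<in> Sm" "Y \<in> Sm" "X \<noteq> Y"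
    have "X \<inter> Y = M" using extensions_Int[OF M(1)] XY unfolding Sm_def by blast
    thus "?S \<inter> (X - M) \<inter> (?S \<inter> (Y - M)) = {}" by blast
  qed
  also have "\<dots> \<le> card ?S" by (rule card_mono) auto
  finally have "real (\<Sum>X\<in>Sm. card (?S \<inter> (X - M))) \<le> real (card ?S)" by (rule of_nat_mono)
  moreover have "(\<Sum>X\<in>Sm. (real m - 2 - 1 / 6) * real ?q) \<le> (\<Sum>X\<in>Sm. real (card (?S \<inter> (X - M))))"
    by (rule sum_mono[OF each])
  ultimately have S: "(real t - real g) * ((real m - 2 - 1 / 6) * real ?q) \<le> real (card ?S)"
    using cSm by simp
  have pos: "(real m - 2 - 1 / 6) \<ge> 0" using m(2) by simp
  have "39 / 40 * (real m - 2 - 1 / 6) * real ?q ^ k \<le> 39 / 40 * (real m - 2 - 1 / 6) * (real ?q * real t)"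
    using tq pos by (intro mult_left_mono) auto
  also have "\<dots> = (39 / 40 * real t) * ((real m - 2 - 1 / 6) * real ?q)" by simp
  also have "\<dots> \<le> (real t - real g) * ((real m - 2 - 1 / 6) * real ?q)"
    using gt pos by (intro mult_right_mono) auto
  also note S
  finally show ?thesis .
qed

text \<open>
  A secant vector \<open>w\<close> of the point \<open>Q\<close> is determined by the point of \<open>v + w\<close>, which is one
  of the other \<open>m - 1\<close> points of the secant through \<open>v\<close> and \<open>Q\<close>.
\<close>

lemma card_secant_vectors_le:
  assumes "C \<subseteq> secant_vectors v" and P: "(\<lambda>w. vec.span {w}) ` C \<subseteq> P" and v: "vec.span {v} \<in> B" "v \<noteq> 0"
  shows "card C \<le> card P * (m - 1)"
proof -
  have fibre: "card {w \<in> C. vec.span {w} = Q} \<le> m - 1" for Q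
  proof (cases "{w \<in> C. vec.span {w} = Q} = {}")
    case False
    then obtain w0 where w0: "w0 \<in> C" "vec.span {w0} = Q" by blast
    have sec0: "secant v w0" using w0(1) assms(1) unfolding secant_vectors_def by blast
    let ?L = "vec.span {v, w0}"
    have cL: "card (points_in B ?L) = m + 1" using sec0 unfolding secant_def by blast
    have "(\<lambda>w. vec.span {v + w}) ` {w \<in> C. vec.span {w} = Q} \<subseteq> points_in B ?L - {vec.span {v}, Q}"
    proof
      fix R assume "R \<in> (\<lambda>w. vec.span {v + w}) ` {w \<in> C. vec.span {w} = Q}"
      then obtain w where w: "w \<in> C" "vec.span {w} = Q" "R = vec.span {v + w}" by blast
      have wG: "vec.span {v + w} \<in> B" "secant v w" using w(1) assms(1) unfolding secant_vectors_def by blast+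
      have wv: "w \<notin> vec.span {v}" using wG(2) unfolding secant_def by blast
      obtain c where c: "w = c *s w0" using w(2) w0(2) span_singleton_self[of w] mem_span_singleton by blast
      have "v + w = 1 *s v + c *s w0" using c by simp
      hence "v + w \<in> ?L" unfolding mem_span_pair by blast
      hence "R \<subseteq> ?L" unfolding w(3) span_singleton_subset_iff[OF subspace_over_span] .
      hence RL: "R \<in> points_in B ?L" unfolding points_in_def using wG(1) w(3) by blast
      have "R \<noteq> vec.span {v}"
      proof
        assume "R = vec.span {v}"
        hence "v + w \<in> vec.span {v}" using w(3) span_singleton_self by blast
        from vec.span_diff[OF this span_singleton_self[of v]] show False using wv by simp
      qed
      moreover have "R \<noteq> Q"
      proof
        assume "R = Q"
        hence "v + w \<in> vec.span {w}" using w(2,3) span_singleton_self by blast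
        from vec.span_diff[OF this span_singleton_self[of w]] have "v \<in> vec.span {w}" by simp
        from span_singleton_eq[OF this v(2)] show False using wv span_singleton_self by blast
      qed
      ultimately show "R \<in> points_in B ?L - {vec.span {v}, Q}" using RL by blast
    qed
    hence "card ((\<lambda>w. vec.span {v + w}) ` {w \<in> C. vec.span {w} = Q}) \<le> card (points_in B ?L - {vec.span {v}, Q})"
      by (rule card_mono[rotated]) simp
    also have "\<dots> = m - 1"
    proof -
      have "w0 \<notin> vec.span {v}" using sec0 unfolding secant_def by blast
      hence ne: "vec.span {v} \<noteq> Q" using w0(2) span_singleton_self by blast
      have "vec.span {w0} \<in> B" using w0(1) assms(1) unfolding secant_vectors_def by blast
      hence "{vec.span {v}, Q} \<subseteq> points_in B ?L"
        unfolding points_in_def using v(1) w0(2) vec.span_mono[of "{v}" "{v, w0}"] vec.span_mono[of "{w0}" "{v, w0}"] by blast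
      thus ?thesis using cL ne by (subst card_Diff_subset) auto
    qed
    finally have "card ((\<lambda>w. vec.span {v + w}) ` {w \<in> C. vec.span {w} = Q}) \<le> m - 1" .
    moreover have "inj_on (\<lambda>w. vec.span {v + w}) {w \<in> C. vec.span {w} = Q}"
    proof (rule inj_onI)
      fix x y assume xy: "x \<in> {w \<in> C. vec.span {w} = Q}" "y \<in> {w \<in> C. vec.span {w} = Q}" "vec.span {v + x} = vec.span {v + y}"
      have yv: "y \<notin> vec.span {v}" using xy(2) assms(1) unfolding secant_vectors_def secant_def by blast
      have "x \<in> vec.span {y}" using xy(1,2) span_singleton_self by blast
      then obtain c where c: "x = c *s y" using mem_span_singleton by blast
      have "v + x \<in> vec.span {v + y}" using xy(3) span_singleton_self by blast
      then obtain b where b: "v + x = b *s (v + y)" using mem_span_singleton by blast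
      have e: "(1 - b) *s v = (b - c) *s y"
        using b unfolding c by (simp add: vec.scale_right_distrib vec.scale_left_diff_distrib algebra_simps)
      have bc: "b = c"
      proof (rule ccontr)
        assume "b \<noteq> c"
        hence "y = (inverse (b - c) * (1 - b)) *s v"
          using arg_cong[OF e, of "\<lambda>x. inverse (b - c) *s x"] by simp
        thus False using yv mem_span_singleton by blast
      qed
      hence "(1 - b) *s v = 0" using e by simp
      hence "b = 1" using v(2) by simp
      thus "x = y" using bc c by simp
    qed
    ultimately show ?thesis by (simp add: card_image)
  next
    case True
    show ?thesis unfolding True by simp
  qed
  have "C = (\<Union>Q\<in>P. {w \<in> C. vec.span {w} = Q})" using P by blast
  hence "card C = card (\<Union>Q\<in>P. {w \<in> C. vec.span {w} = Q})" by simp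
  also have "\<dots> \<le> (\<Sum>Q\<in>P. card {w \<in> C. vec.span {w} = Q})" by (rule card_UN_le) simp
  also have "\<dots> \<le> (\<Sum>Q\<in>P. m - 1)" by (rule sum_mono[OF fibre])
  finally show ?thesis by simp
qed

end

section \<open>Sets of vectors that are almost closed under addition\<close>

definition differences :: "('a::ab_group_add) set \<Rightarrow> 'a set" where
  "differences G = {a - b | a b. a \<in> G \<and> b \<in> G}"

text \<open>
  Write \<open>x = a - b\<close>. More than half of the elements \<open>u\<close> of \<open>G\<close> satisfy both \<open>a + u \<in> G\<close> and
  \<open>b + u \<in> G\<close>, and then \<open>g = b + u\<close> has \<open>x + g = a + u\<close>.
\<close>

lemma popular_differences:
  fixes G :: "('a::ab_group_add) set"
  assumes fin: "finite G" and sums: "\<And>w. w \<in> G \<Longrightarrow> 3 * card G < 4 * card {u \<in> G. w + u \<in> G}"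
    and x: "x \<in> differences G"
  shows "card G < 2 * card {g \<in> G. x + g \<in> G}"
proof -
  obtain a b where ab: "x = a - b" "a \<in> G" "b \<in> G" using x unfolding differences_def by blast
  define S where "S = (\<lambda>w. {u \<in> G. w + u \<in> G})"
  have SG: "S w \<subseteq> G" "finite (S w)" for w unfolding S_def using fin by auto
  have "card (S a) + card (S b) = card (S a \<union> S b) + card (S a \<inter> S b)"
    using SG by (intro card_Un_Int) auto
  moreover have "card (S a \<union> S b) \<le> card G" using SG by (intro card_mono[OF fin]) auto
  moreover have "3 * card G < 4 * card (S a)" "3 * card G < 4 * card (S b)"
    unfolding S_def by (rule sums[OF ab(2)], rule sums[OF ab(3)])
  ultimately have "card G < 2 * card (S a \<inter> S b)" by linarith
  also have "card (S a \<inter> S b) = card ((\<lambda>u. b + u) ` (S a \<inter> S b))"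
    by (rule card_image[symmetric]) (simp add: inj_on_def)
  also have "\<dots> \<le> card {g \<in> G. x + g \<in> G}"
    using fin unfolding ab(1) S_def by (intro card_mono) auto
  finally show ?thesis by simp
qed

text \<open>
  Two sets that both contain more than half of \<open>G\<close> have a common element \<open>g\<close>, and
  \<open>x - y = (x + g) - (y + g)\<close>.
\<close>

lemma differences_closed:
  fixes G :: "('a::ab_group_add) set"
  assumes fin: "finite G" and sums: "\<And>w. w \<in> G \<Longrightarrow> 3 * card G < 4 * card {u \<in> G. w + u \<in> G}"
    and x: "x \<in> differences G" and y: "y \<in> differences G"
  shows "x - y \<in> differences G"
proof -
  let ?X = "{g \<in> G. x + g \<in> G}" and ?Y = "{g \<in> G. y + g \<in> G}"
  have "?X \<inter> ?Y \<noteq> {}"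
  proof
    assume "?X \<inter> ?Y = {}"
    hence "card ?X + card ?Y = card (?X \<union> ?Y)" using fin by (intro card_Un_disjoint[symmetric]) auto
    also have "\<dots> \<le> card G" by (rule card_mono[OF fin]) auto
    finally show False
      using popular_differences[OF fin sums x] popular_differences[OF fin sums y] by linarith
  qed
  then obtain g where g: "x + g \<in> G" "y + g \<in> G" by blast
  have "x - y = (x + g) - (y + g)" by simp
  thus ?thesis unfolding differences_def using g by blast
qed

section \<open>Linearity of small minimal blocking sets\<close>

context small_one_mod_set
begin

lemma blocks: "points_in B (common_zeros f k) \<noteq> {}"
proof
  assume "points_in B (common_zeros f k) = {}"
  hence "[0 = 1] (mod m)" using one_mod_common_zeros[of k f] by simp
  thus False using m(2) by (simp add: cong_def)
qed

text \<open>
  The set \<open>G\<close> of secant vectors has between \<open>c * CARD('a) ^ k\<close> and about \<open>m * CARD('a) ^ k\<close>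
  elements, with \<open>c\<close> close to \<open>m - 2\<close>. For \<open>m \<ge> 12\<close> this makes \<open>G\<close> closed under addition in
  more than three quarters of all cases, so that its differences form a group. An element
  \<open>x\<close> of this group is a difference in more than \<open>card G / 2\<close> ways. If its point was outside
  \<open>B\<close>, each representation \<open>x = (x + g) - g\<close> would give a line through \<open>x\<close> with two points
  of \<open>B\<close>, and there would be too many such lines.
\<close>

lemma linear_set_subset_via_secants:
  assumes v: "vec.span {v} \<in> B" "v \<noteq> 0" and w: "w \<in> secant_vectors v" and mq: "m < CARD('a)"
  obtains U where "subspace_over prime_field U" "CARD('a) ^ k < card U" "linear_set U \<subseteq> B"
proof -
  let ?G = "secant_vectors v" and ?q = "CARD('a)"
  (* a fraction 39 / 40 of the sections is small, and each loses two sets of exceptional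
     vectors; the term 1 / 6 is a bound for 2 / m *)
  define c where "c = 39 / 40 * (real m - 2 - 1 / 6)"
  have qk: "real ?q ^ k > 0" using q_gt_1 by simp
  have sums': "c * real ?q ^ k \<le> real (card {u \<in> ?G. w + u \<in> ?G})" if "w \<in> ?G" for w
    using many_sums[OF v that mq] unfolding c_def .
  have GB: "real (card ?G) * (real m - 2) \<le> (real m - 1)\<^sup>2 * real ?q ^ k"
  proof -
    have "card ?G \<le> card B * (m - 1)"
      by (rule card_secant_vectors_le[OF order_refl _ v]) (auto simp: secant_vectors_def)
    hence "real (card ?G) \<le> real (card B * (m - 1))" by (rule of_nat_mono)
    hence "real (card ?G) \<le> real (card B) * (real m - 1)" using m(2) by (simp add: of_nat_diff)
    hence "real (card ?G) * (real m - 2) \<le> (real (card B) * (real m - 1)) * (real m - 2)"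
      using m(2) by (intro mult_right_mono) auto
    also have "\<dots> = (real (card B) * (real m - 2)) * (real m - 1)" by simp
    also have "\<dots> \<le> ((real m - 1) * real ?q ^ k) * (real m - 1)"
      using size_B m(2) by (intro mult_right_mono) auto
    finally show ?thesis by (simp add: power2_eq_square mult_ac)
  qed
  have sums: "3 * card ?G < 4 * card {u \<in> ?G. w + u \<in> ?G}" if w: "w \<in> ?G" for w
  proof -
    have m12: "real m \<ge> 12" using m(2) by simp
    hence "12 * real m \<le> real m * real m" by (rule mult_right_mono) simp
    moreover have "4 * c * (real m - 2) - 3 * (real m - 1)\<^sup>2
        = 9 / 10 * (real m * real m) - (1025 / 100) * real m + 139 / 10"
      unfolding c_def power2_eq_square by (simp add: field_simps)
    ultimately have poly: "3 * (real m - 1)\<^sup>2 < 4 * c * (real m - 2)" using m12 by linarith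
    have "(3 * real (card ?G)) * (real m - 2) \<le> 3 * ((real m - 1)\<^sup>2 * real ?q ^ k)" using GB by simp
    also have "\<dots> < (4 * c * (real m - 2)) * real ?q ^ k"
      using mult_strict_right_mono[OF poly qk] by (simp add: mult_ac)
    also have "\<dots> = (4 * (c * real ?q ^ k)) * (real m - 2)" by simp
    also have "\<dots> \<le> (4 * real (card {u \<in> ?G. w + u \<in> ?G})) * (real m - 2)"
      using sums'[OF w] m(2) by (intro mult_right_mono) auto
    finally have "3 * real (card ?G) < 4 * real (card {u \<in> ?G. w + u \<in> ?G})"
      using m(2) by (simp add: mult_less_cancel_right_pos)
    thus ?thesis by linarith
  qed
  have "card {u \<in> ?G. w + u \<in> ?G} \<le> card ?G" by (rule card_mono) auto
  hence cG: "c * real ?q ^ k \<le> real (card ?G)" using sums'[OF w] by linarith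
  define U where "U = differences ?G"
  have closed: "x - y \<in> U" if "x \<in> U" "y \<in> U" for x y
    unfolding U_def by (rule differences_closed[OF finite sums]) (use that U_def in auto)
  have "w - w \<in> U" unfolding U_def differences_def using w by blast
  hence U0: "0 \<in> U" by simp
  have "x + y \<in> U" if "x \<in> U" "y \<in> U" for x y
    using closed[OF that(1) closed[OF U0 that(2)]] by simp
  hence U: "subspace_over prime_field U" using U0 by (intro additive_closed_scale)
  have "(\<lambda>g. g - w) ` ?G \<subseteq> U" unfolding U_def differences_def using w by blast
  hence "card ((\<lambda>g. g - w) ` ?G) \<le> card U" by (rule card_mono[rotated]) simp
  moreover have "card ((\<lambda>g. g - w) ` ?G) = card ?G" by (rule card_image) (simp add: inj_on_def)
  ultimately have "real (card ?G) \<le> real (card U)" by simp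
  moreover have "real ?q ^ k < c * real ?q ^ k" using qk m(2) unfolding c_def by simp
  ultimately have "real ?q ^ k < real (card U)" using cG by linarith
  hence card: "?q ^ k < card U" by (metis of_nat_less_iff of_nat_power)
  have "linear_set U \<subseteq> B"
  proof
    fix X assume "X \<in> linear_set U"
    then obtain x where x: "x \<in> U" "x \<noteq> 0" "X = vec.span {x}" by (rule linear_setE)
    show "X \<in> B"
    proof (rule ccontr)
      assume XB: "X \<notin> B"
      define C where "C = {g \<in> ?G. x + g \<in> ?G}"
      define D where "D = (\<lambda>g. vec.span {g}) ` C"
      have "card ?G < 2 * card C"
        unfolding C_def by (rule popular_differences[OF finite sums]) (use x(1) U_def in auto)
      moreover have "card C \<le> card D * (m - 1)"
        by (rule card_secant_vectors_le[OF _ _ v]) (auto simp: C_def D_def)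
      hence "real (card C) \<le> real (card D * (m - 1))" by (rule of_nat_mono)
      hence "real (card C) \<le> real (card D) * (real m - 1)" using m(2) by (simp add: of_nat_diff)
      ultimately have "real (card ?G) \<le> 2 * (real (card D) * (real m - 1))" by linarith
      hence lower: "c * real ?q ^ k \<le> 2 * (real (card D) * (real m - 1))" using cG by linarith
      have DB: "D \<subseteq> B" unfolding D_def C_def secant_vectors_def by blast
      (* card D is at least card C / (m - 1), which is about q ^ k / 2; the lines through x
         allow only q ^ k / 5 *)
      have "2 * ?q ^ k + card D \<le> 2 * card B"
      proof (rule few_lines_contradiction[OF points x(2) _ blocks DB])
        show "vec.span {x} \<notin> B" using XB x(3) by simp
        fix P assume "P \<in> D"
        then obtain g where g: "g \<in> ?G" "x + g \<in> ?G" "P = vec.span {g}" unfolding D_def C_def by blast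
        have gB: "vec.span {g} \<in> B" "vec.span {x + g} \<in> B" using g unfolding secant_vectors_def by blast+
        have ne: "vec.span {x + g} \<noteq> vec.span {g}"
        proof
          assume "vec.span {x + g} = vec.span {g}"
          hence "x + g \<in> vec.span {g}" using span_singleton_self by blast
          from vec.span_diff[OF this span_singleton_self[of g]] have "x \<in> vec.span {g}" by simp
          from span_singleton_eq[OF this x(2)] show False using XB x(3) gB(1) by simp
        qed
        have "x + g \<notin> vec.span {x}"
        proof
          assume "x + g \<in> vec.span {x}"
          from vec.span_diff[OF this span_singleton_self[of x]] have "g \<in> vec.span {x}" by simp
          moreover have "g \<noteq> 0" using gB(1) points by (intro point_span_nonzero) blast
          ultimately have "vec.span {g} = vec.span {x}" by (rule span_singleton_eq)
          thus False using XB x(3) gB(1) by simp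
        qed
        moreover have "x + g \<in> vec.span {x, g}"
        proof -
          have "x + g = 1 *s x + 1 *s g" by simp
          thus ?thesis unfolding mem_span_pair by blast
        qed
        ultimately have "vec.span {x, x + g} = vec.span {x, g}" by (intro span_pair_eq)
        hence "vec.span (insert x (vec.span {x + g})) = vec.span (insert x P)"
          unfolding g(3) span_insert_span_singleton .
        thus "\<exists>P'\<in>B. P' \<noteq> P \<and> vec.span (insert x P') = vec.span (insert x P)"
          using gB(2) ne g(3) by blast
      qed
      hence "real (2 * ?q ^ k + card D) \<le> real (2 * card B)" by (rule of_nat_mono)
      hence "2 * real ?q ^ k + real (card D) \<le> 2 * real (card B)" by simp
      hence "real (card D) \<le> 1 / 5 * real ?q ^ k" using size_B' by linarith
      hence "real (card D) * (real m - 1) \<le> (1 / 5 * real ?q ^ k) * (real m - 1)"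
        using m(2) by (intro mult_right_mono) auto
      hence "c * real ?q ^ k \<le> (2 / 5 * (real m - 1)) * real ?q ^ k" using lower by (simp add: algebra_simps)
      hence "c \<le> 2 / 5 * (real m - 1)" using qk by (rule mult_right_le_imp_le)
      thus False unfolding c_def using m(2) by simp
    qed
  qed
  thus thesis using that U card by blast
qed

text \<open>
  A line with two points of \<open>B\<close> has at least \<open>m + 1\<close> of them, that is, it is contained in
  \<open>B\<close>. So \<open>B\<close> consists of the points of a subspace.
\<close>

lemma linear_if_lines_contained:
  assumes mq: "m = CARD('a)"
  obtains U where "subspace_over prime_field U" "linear_set U = B"
proof -
  define U where "U = {x. x = 0 \<or> vec.span {x} \<in> B}"
  have add: "x + y \<in> U" if x: "x \<in> U" and y: "y \<in> U" for x y
  proof (cases "x = 0 \<or> y = 0 \<or> x + y = 0")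
    case True thus ?thesis using x y unfolding U_def by auto
  next
    case False
    hence B: "vec.span {x} \<in> B" "vec.span {y} \<in> B" using x y unfolding U_def by auto
    have xy: "x + y \<in> vec.span {x, y}"
    proof -
      have "x + y = 1 *s x + 1 *s y" by simp
      thus ?thesis unfolding mem_span_pair by blast
    qed
    show ?thesis
    proof (cases "y \<in> vec.span {x}")
      case True
      hence "x + y \<in> vec.span {x}" by (intro vec.span_add span_singleton_self)
      hence "vec.span {x + y} = vec.span {x}" using False by (intro span_singleton_eq) auto
      thus ?thesis using B(1) unfolding U_def by simp
    next
      case not: False
      let ?L = "vec.span {x, y}"
      have two: "2 \<le> card (points_in B ?L)" by (rule card_two_points_line[OF B not])
      hence "[card (points_in B ?L) = 1] (mod m)" using False not by (intro line_one_mod) auto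
      hence ge: "m + 1 \<le> card (points_in B ?L)" using two m(2) by (intro cong_1_ge) auto
      have "card (points_in proj_points ?L) \<le> CARD('a) + 1"
        using card_span_pair[of x y] False not by (intro card_points_line_le subspace_over_span) auto
      moreover have "points_in B ?L \<subseteq> points_in proj_points ?L" using points unfolding points_in_def by blast
      ultimately have eq: "points_in B ?L = points_in proj_points ?L"
        using ge mq by (intro card_seteq) auto
      have "vec.span {x + y} \<in> points_in proj_points ?L"
        unfolding points_in_def using xy False span_singleton_subset_iff[OF subspace_over_span]
        by (auto simp: proj_points_iff)
      hence "vec.span {x + y} \<in> points_in B ?L" using eq by simp
      thus ?thesis unfolding U_def points_in_def by simp
    qed
  qed
  have "subspace_over prime_field U" by (rule additive_closed_scale) (use add in \<open>auto simp: U_def\<close>)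
  moreover have "linear_set U = B"
  proof (intro equalityI subsetI)
    fix P assume "P \<in> linear_set U" thus "P \<in> B" unfolding U_def by (auto elim!: linear_setE)
  next
    fix P assume P: "P \<in> B"
    then obtain x where x: "x \<noteq> 0" "P = vec.span {x}" using points proj_pointsE by blast
    thus "P \<in> linear_set U" using P linear_setI[of x U] unfolding U_def by simp
  qed
  ultimately show thesis by (rule that)
qed

text \<open>
  If \<open>m\<close> is less than the order of the field, a secant gives a group with more than
  \<open>CARD('a) ^ k\<close> elements whose points belong to \<open>B\<close>. These points form a blocking set, so
  they are all of \<open>B\<close>.
\<close>

lemma linear_if_minimal:
  assumes min: "minimal_blocking_set k B"
    and vw: "vec.span {v} \<in> B" "v \<noteq> 0" "w \<notin> vec.span {v}"
    and not: "\<not> [card (points_in B (vec.span {v, w})) = 1] (mod CHAR('a) ^ Suc e)"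
  shows "linear_point_set B"
proof -
  have "\<exists>U. subspace_over prime_field U \<and> linear_set U = B"
  proof (cases "m = CARD('a)")
    case True
    thus ?thesis using linear_if_lines_contained by blast
  next
    case False
    hence mq: "m < CARD('a)" using m_dvd by (simp add: dvd_imp_le order_less_le)
    obtain v' w' where v': "vec.span {v'} \<in> B" "vec.span {w'} \<in> B" "secant v' w'"
      using exists_secant[OF vw not] by blast
    have v'0: "v' \<noteq> 0" using points v'(1) by (intro point_span_nonzero) blast
    obtain X where X: "small_section X" "vec.span {v', w'} \<subseteq> X"
      using line_in_small_section[OF subspace_over_span] card_span_pair[OF v'0] v'(3)
      unfolding secant_def by (metis order_refl)
    have sX: "subspace_over UNIV X" using X(1) unfolding small_section_def is_section_def by blast
    have vX: "v' \<in> X" "w' \<in> X" using X(2) vec.span_superset[of "{v', w'}"] by blast+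
    obtain U where g: "section_group v' X U" using exists_section_group[OF X(1) v'(1) vX v'(3)] by blast
    note wts = section_group_secant[OF g sX v'0 vX v'(3)]
    obtain u where u: "u \<in> U" "u \<notin> vec.span {v'}" "card (U \<inter> vec.span {v', u}) = m ^ 2"
      using section_group_secant_vector[OF g sX v'0 vX v'(3)] by blast
    have "u \<in> secant_vectors v'" by (rule secant_vectorsI[OF g sX v'0 vX(1) wts(2) u])
    then obtain T where T: "subspace_over prime_field T" "CARD('a) ^ k < card T" "linear_set T \<subseteq> B"
      using linear_set_subset_via_secants[OF v'(1) v'0 _ mq] by blast
    have "blocking_set k (linear_set T)" by (rule linear_set_blocks[OF T(1,2)]) (use k in simp)
    hence "linear_set T = B" by (rule minimal_blocking_setD[OF min T(3)])
    thus ?thesis using T(1) by blast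
  qed
  then obtain U where "subspace_over prime_field U" "linear_set U = B" by blast
  thus ?thesis unfolding linear_point_set_def linear_set_def using is_subfield_prime_field by blast
qed

end

theorem theorem2:
  fixes p t n k e :: nat and B :: "('a::{field,finite} ^ 'n) set set"
  assumes "prime p" and "t \<ge> 1"
    and "CARD('a) = p ^ t" and "CARD('n) = n + 1"
    and one_blocking_linear:
      "\<forall>A :: ('a ^ 'n) set set. small_minimal_blocking_set 1 A \<longrightarrow> linear_point_set A"
    and "1 \<le> k" and "k < n"
    and "small_minimal_blocking_set k B" and "has_exponent p k B e"
    and "real (p ^ e) \<ge> real t / real e + 11"
  shows "linear_point_set B"
proof -
  let ?q = "CARD('a)" and ?N = "CARD('n)"
  define m where "m = p ^ e"
  have p: "p = CHAR('a)"
  proof -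
    obtain h where h: "?q = CHAR('a) ^ h" "h > 0"
      using subfield_exponent[OF is_subfield_prime_field[where 'a='a]] unfolding card_prime_field by blast
    have "CHAR('a) dvd p ^ t" using h assms(3) by (metis dvd_power)
    hence dvd: "CHAR('a) dvd p" using prime_dvd_power prime_CHAR_finite by blast
    show ?thesis by (rule primes_dvd_imp_eq[OF prime_CHAR_finite assms(1) dvd, symmetric])
  qed
  (* division by zero yields zero, so e = 0 would mean 1 \<ge> 11; hence t / e > 0 and m > 11 *)
  have "real t / real e \<ge> 0" by simp
  hence m11: "m \<ge> 11" using assms(10) unfolding m_def by linarith
  have e: "e \<noteq> 0" using m11 unfolding m_def by (intro notI) simp
  have m12: "m \<ge> 12"
  proof -
    have "real t / real e > 0" using assms(2) e by simp
    thus ?thesis using assms(10) unfolding m_def by linarith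
  qed
  have k: "1 \<le> k" "k + 2 \<le> ?N" using assms by auto
  have q2: "?q \<ge> 2" by (rule card_field_ge2)
  have min: "minimal_blocking_set k B" and size: "real (card B) < 3 * (real ?q ^ k + 1) / 2"
    using assms(8) unfolding small_minimal_blocking_set_def by auto
  have block: "blocking_set k B" using min unfolding minimal_blocking_set_def by blast
  have B: "B \<subseteq> proj_points" using block unfolding blocking_set_def by blast
  have proj: "proj_subspace (?N - 1 - k) W \<longleftrightarrow> subspace_over UNIV W \<and> card W = ?q ^ (?N - k)" for W :: "('a ^ 'n) set"
  proof -
    have "?N - 1 - k + 1 = ?N - k" using k by simp
    thus ?thesis unfolding proj_subspace_iff by metis
  qed
  have mod: "[card (points_in B W) = 1] (mod m)" if "subspace_over UNIV W" "card W = ?q ^ (?N - k)" for W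
    using assms(9) that unfolding has_exponent_def meets_one_mod_def proj m_def by blast
  have "1 \<le> card B" using card_blocking_set_ge[OF block] k q2 by (metis Suc_leD Suc_le_lessD add_2_eq_Suc' le_trans one_le_power one_le_numeral)
  then obtain P where P: "P \<in> B" by (metis card.empty ex_in_conv not_one_le_zero)
  (* by minimality some (n - k)-space meets B in a single point; this makes m a divisor of q *)
  have "\<not> blocking_set k (B - {P})" using min P unfolding minimal_blocking_set_def by blast
  then obtain W where W: "subspace_over UNIV W" "card W = ?q ^ (?N - k)" "points_in (B - {P}) W = {}"
    using B unfolding blocking_set_def proj by blast
  have "points_in B W \<noteq> {}" using block W(1,2) unfolding blocking_set_def proj by blast
  hence PW: "points_in B W = {P}" using W(3) unfolding points_in_def by blast
  obtain v where v: "v \<noteq> 0" "P = vec.span {v}" using B P proj_pointsE by blast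
  have dvd: "m dvd ?q" using one_mod_modulus_dvd[OF B k mod W(1,2) _ v(1)] PW v(2) by blast
  have larger: "[card (points_in B Z) = 1] (mod m)" if "subspace_over UNIV Z" "?q ^ (?N - k) \<le> card Z" for Z
    by (rule one_mod_larger_subspaces[OF B _ dvd mod that]) (use k in simp)
  have small: "real (card B) < (real m - 2) * real ?q ^ k"
  proof -
    have "3 * (x + 1) / 2 \<le> 10 * x" if "1 \<le> x" for x :: real using that by (simp add: field_simps)
    from this[OF one_le_power, of "real ?q" k] have "3 * (real ?q ^ k + 1) / 2 \<le> 10 * real ?q ^ k" using q2 by simp
    also have "\<dots> \<le> (real m - 2) * real ?q ^ k" using m12 by (intro mult_right_mono) auto
    finally show ?thesis using size by simp
  qed
  interpret small_one_mod_set B k e m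
    by unfold_locales (use one_blocking_linear B k p m12 dvd larger small in \<open>simp_all add: m_def\<close>)
  (* otherwise all lines with two points of B, hence all (n - k)-spaces, would satisfy the
     congruence for e + 1 *)
  have "\<exists>v w. vec.span {v} \<in> B \<and> vec.span {w} \<in> B \<and> w \<notin> vec.span {v} \<and>
    \<not> [card (points_in B (vec.span {v, w})) = 1] (mod p ^ Suc e)"
  proof (rule ccontr)
    assume not: "\<not> ?thesis"
    have "meets_one_mod (p ^ Suc e) k B"
      unfolding meets_one_mod_def proj
    proof (intro allI impI)
      fix W :: "('a ^ 'n) set" assume W: "subspace_over UNIV W \<and> card W = ?q ^ (?N - k)"
      have ne: "points_in B W \<noteq> {}" using block W unfolding blocking_set_def proj by blast
      show "[card (points_in B W) = 1] (mod p ^ Suc e)"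
      proof (rule one_mod_of_lines[OF B conjunct1[OF W] ne])
        fix v w :: "'a ^ 'n" assume "vec.span {v} \<in> B" "vec.span {w} \<in> B" "w \<notin> vec.span {v}"
        thus "[card (points_in B (vec.span {v, w})) = 1] (mod p ^ Suc e)" using not by blast
      qed
    qed
    hence "Suc e \<le> e" using assms(9) unfolding has_exponent_def by blast
    thus False by simp
  qed
  then obtain v w where vw: "vec.span {v} \<in> B" "w \<notin> vec.span {v}"
    "\<not> [card (points_in B (vec.span {v, w})) = 1] (mod CHAR('a) ^ Suc e)" unfolding p by blast
  have "v \<noteq> 0" using B vw(1) by (intro point_span_nonzero) blast
  thus ?thesis using linear_if_minimal[OF min vw(1) _ vw(2,3)] by blast
qed

end
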